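(* Let $X$ be a proper cocompact CAT(0) space with basepoint $x_0$, and let $\omega$ be a non-principal ultrafilter on $\mathbb N$. Then the metric direct limit $\lim\limits_{\rightarrow}\bigl(\mathrm{Con}^\omega(X,(x_0),d),\Theta^d_{d'}\bigr)$ of the asymptotic cones of $X$, taken over all scaling sequences, is isometric to the Euclidean cone $\mathrm{Cone}(\partial_T X)$ on the Tits boundary of $X$. Moreover, for each scaling sequence $d$, the canonical projection map $$\Theta_d:\mathrm{Con}^\omega(X,(x_0),d)\to\lim_{\rightarrow}\bigl(\mathrm{Con}^\omega(X,(x_0),d),\Theta^d_{d'}\bigr)$$ is determined by the equation $$\Theta_d\circ\Psi^\omega_d\bigl(t,(\alpha_n)\bigr)=\Theta_d\circ\Psi_d\bigl(t,\textstyle\lim^\omega\alpha_n\bigr)\qquad\text{for all } t\ge 0,\ (\alpha_n)\in\partial^\omega_\angle X,$$ where $\lim^\omega\alpha_n$ is taken in the visual boundary $\partial_\infty X$, and $\Theta_d\circ\Psi_d$ is an isometry (from $\mathrm{Cone}(\partial_TX)=\mathrm{Cone}(\partial_\angle X)$ onto the direct limit).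
   Context: A metric space is proper if closed balls are compact; it is cocompact if the translates of some compact set under its full isometry group cover it. Boundaries. Fix $x_0\in X$. $\partial X$ is the set of geodesic rays $\alpha:[0,\infty)\to X$ with $\alpha(0)=x_0$. The visual boundary $\partial_\infty X$ is $\partial X$ with the topology with basis $U(\alpha,R,\epsilon)=\{\beta\in\partial X\mid \mathrm{dist}(\alpha(R),\mathrm{im}(\beta))<\epsilon\}$, $\alpha\in\partial X$, $R,\epsilon>0$; it is compact when $X$ is proper. With $\overline\angle_{x_0}$ denoting the Euclidean comparison angle at $x_0$, the angle metric is $\angle(\alpha,\beta)=\lim_{t\to\infty}\overline\angle_{x_0}(\alpha(t),\beta(t))$; $\partial_\angle X$ is $\partial X$ with this metric. The Tits metric $d_T$ is the (extended) path metric induced by $\angle$, and $\partial_TX$ is $\partial X$ with $d_T$. Euclidean cone. For a metric space $Z$, $\mathrm{Cone}(Z)=([0,\infty)\times Z)/\sim$ with $(0,z)\sim(0,z')$, and metric given by $\mathrm{dist}^2((t,z),(t',z'))=t^2+t'^2-2tt'\cos(\min\{\pi,\mathrm{dist}(z,z')\})$; if $Z=\emptyset$ the cone is a single point. The identity of $\partial X$ induces an isometry $\mathrm{Cone}(\partial_\angle X)\to\mathrm{Cone}(\partial_TX)$, and these two are identified. Ultraproducts. $\omega$ is a non-principal ultrafilter on $\mathbb N$; $\lim^\omega$ is the ultralimit; a property holds $\omega$-almost surely if it holds on a set in $\omega$. For metric spaces $(X_n,d_n)$ and $e=(e_n)\in\prod X_n$, the ultraproduct $\prod^\omega_eX_n$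 is the set of sequences $(x_n)$ with $d_n(x_n,e_n)$ bounded, modulo $\lim^\omega d_n(x_n,y_n)=0$, with metric $\lim^\omega d_n(x_n,y_n)$. A scaling sequence is a sequence $d=(d_n)$ of positive reals with $\lim^\omega d_n=\infty$. $\mathrm{Con}^\omega(X,(x_0),d)$ is the ultraproduct of the spaces $(X,\mathrm{dist}/d_n)$ with respect to the constant sequence $(x_0)$. $\partial^\omega_\angle X$ is the ultraproduct of copies of $\partial_\angle X$. Maps: $\Psi^\omega_d:\mathrm{Cone}(\partial^\omega_\angle X)\to\mathrm{Con}^\omega(X,(x_0),d)$, $\Psi^\omega_d(t,(\alpha_n))=(\alpha_n(td_n))$, and $\Psi_d:\mathrm{Cone}(\partial_\angle X)\to\mathrm{Con}^\omega(X,(x_0),d)$, $\Psi_d(t,\alpha)=(\alpha(td_n))$. Connecting maps. Write $d'\preceq d$ if $d'_n\le d_n$ $\omega$-almost surely (a total order on scaling sequences, up to $\omega$-almost sure equality). Let $\Xi(x,t)=x$ if $t\ge \mathrm{dist}(x_0,x)$, and otherwise the point of the geodesic $[x_0,x]$ at distance $t$ from $x_0$. For $d'\preceq d$, $\Theta^d_{d'}:\mathrm{Con}^\omega(X,(x_0),d)\to\mathrm{Con}^\omega(X,(x_0),d')$ is $\Theta^d_{d'}((x_n))=\bigl(\Xi(x_n,\tfrac{d'_n}{d_n}\mathrm{dist}(x_n,x_0))\bigr)$; this is a well-defined 1-Lipschitz map. Direct limit. For a system of metric spaces $(X_j,d_j)$ indexed by a totally ordered set with non-expansive maps $f_{i,j}:X_i\to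 X_j$ for $i\ge j$, satisfying $f_{i,k}=f_{j,k}\circ f_{i,j}$ for $i\ge j\ge k$, the direct limit is the disjoint union $\bigsqcup X_j$ with pseudometric $\underline{\mathrm d}(x,y)=\inf\{d_k(f_{i,k}(x),f_{j,k}(y))\mid i,j\ge k\}$ ($x\in X_i$, $y\in X_j$), modulo $\underline{\mathrm d}(x,y)=0$. The maps $X_i\to\lim_\rightarrow X_i$ induced by inclusion are the canonical projections (here denoted $\Theta_d$). *)

theory Defs
  imports "HOL-Analysis.Analysis"
begin

section \<open>Metric quotients and isometries\<close>

text \<open>A metric space that is not a whole type is a carrier set together with a distance function;
  the values of the distance function outside the carrier are irrelevant.\<close>

definition zero_dist_rel :: "'b set \<Rightarrow> ('b \<Rightarrow> 'b \<Rightarrow> real) \<Rightarrow> ('b \<times> 'b) set" where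
  "zero_dist_rel S \<rho> = {(x, y). x \<in> S \<and> y \<in> S \<and> \<rho> x y = 0}"

definition metric_quotient :: "'b set \<Rightarrow> ('b \<Rightarrow> 'b \<Rightarrow> real) \<Rightarrow> 'b set set" where
  "metric_quotient S \<rho> = S // zero_dist_rel S \<rho>"

definition quotient_class :: "'b set \<Rightarrow> ('b \<Rightarrow> 'b \<Rightarrow> real) \<Rightarrow> 'b \<Rightarrow> 'b set" where
  "quotient_class S \<rho> x = zero_dist_rel S \<rho> `` {x}"

text \<open>When \<open>\<rho>\<close> is a pseudometric on the underlying set, the choice of representatives below
  does not matter.\<close>

definition quotient_dist :: "('b \<Rightarrow> 'b \<Rightarrow> real) \<Rightarrow> 'b set \<Rightarrow> 'b set \<Rightarrow> real" where
  "quotient_dist \<rho> A B = \<rho> (SOME a. a \<in> A) (SOME b. b \<in> B)"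

definition isometry_onto ::
  "('b \<Rightarrow> 'c) \<Rightarrow> 'b set \<Rightarrow> ('b \<Rightarrow> 'b \<Rightarrow> real) \<Rightarrow> 'c set \<Rightarrow> ('c \<Rightarrow> 'c \<Rightarrow> real) \<Rightarrow> bool" where
  "isometry_onto f M \<rho> N \<sigma> \<longleftrightarrow>
     bij_betw f M N \<and> (\<forall>x\<in>M. \<forall>y\<in>M. \<sigma> (f x) (f y) = \<rho> x y)"

definition isometric_spaces ::
  "'b set \<Rightarrow> ('b \<Rightarrow> 'b \<Rightarrow> real) \<Rightarrow> 'c set \<Rightarrow> ('c \<Rightarrow> 'c \<Rightarrow> real) \<Rightarrow> bool" where
  "isometric_spaces M \<rho> N \<sigma> \<longleftrightarrow> (\<exists>f. isometry_onto f M \<rho> N \<sigma>)"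


section \<open>Proper cocompact CAT(0) spaces\<close>

definition proper_space :: "'a::metric_space itself \<Rightarrow> bool" where
  "proper_space T \<longleftrightarrow> (\<forall>(x::'a) r. compact (cball x r))"

definition isometry_group :: "('a::metric_space \<Rightarrow> 'a) set" where
  "isometry_group = {g. bij g \<and> (\<forall>x y. dist (g x) (g y) = dist x y)}"

definition cocompact_space :: "'a::metric_space itself \<Rightarrow> bool" where
  "cocompact_space T \<longleftrightarrow> (\<exists>K::'a set. compact K \<and> (\<Union>g\<in>isometry_group. g ` K) = UNIV)"

definition geodesic :: "(real \<Rightarrow> 'a::metric_space) \<Rightarrow> real \<Rightarrow> 'a \<Rightarrow> 'a \<Rightarrow> bool" where
  "geodesic c l x y \<longleftrightarrow> 0 \<le> l \<and> c 0 = x \<and> c l = y \<and>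
     (\<forall>s\<in>{0..l}. \<forall>t\<in>{0..l}. dist (c s) (c t) = \<bar>s - t\<bar>)"

text \<open>The Euclidean plane is the type \<^typ>\<open>complex\<close>. Any two distinct sides of a geodesic triangle
  share a vertex, here called \<open>p\<close>, and the CAT(0) inequality is trivial for two points on the same
  side. The points \<open>P\<close>, \<open>Q\<close>, \<open>R\<close> form a comparison triangle, and \<open>x'\<close>, \<open>y'\<close> are the comparison
  points of \<open>a s\<close> and \<open>b t\<close>.\<close>

definition CAT0_space :: "'a::metric_space itself \<Rightarrow> bool" where
  "CAT0_space T \<longleftrightarrow>
     (\<forall>x y::'a. \<exists>c l. geodesic c l x y) \<and>
     (\<forall>(p::'a) q r a la b lb c lc (P::complex) Q R.
        geodesic a la p q \<and> geodesic b lb p r \<and> geodesic c lc q r \<and>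
        dist P Q = dist p q \<and> dist P R = dist p r \<and> dist Q R = dist q r \<longrightarrow>
        (\<forall>s\<in>{0..la}. \<forall>t\<in>{0..lb}. \<forall>x'\<in>closed_segment P Q. \<forall>y'\<in>closed_segment P R.
           dist P x' = s \<and> dist P y' = t \<longrightarrow> dist (a s) (b t) \<le> dist x' y'))"


section \<open>Boundaries\<close>

text \<open>Rays are functions on \<open>[0,\<infinity>)\<close>; they are made extensional so that equality of rays is
  equality of HOL functions.\<close>

definition rays :: "'a::metric_space \<Rightarrow> (real \<Rightarrow> 'a) set" where
  "rays x0 = {\<alpha> \<in> extensional {0..}. \<alpha> 0 = x0 \<and>
     (\<forall>s\<ge>0. \<forall>t\<ge>0. dist (\<alpha> s) (\<alpha> t) = \<bar>s - t\<bar>)}"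

definition visual_nbhd :: "'a::metric_space \<Rightarrow> (real \<Rightarrow> 'a) \<Rightarrow> real \<Rightarrow> real \<Rightarrow> (real \<Rightarrow> 'a) set" where
  "visual_nbhd x0 \<alpha> R \<epsilon> = {\<beta> \<in> rays x0. infdist (\<alpha> R) (\<beta> ` {0..}) < \<epsilon>}"

definition visual_topology :: "'a::metric_space \<Rightarrow> (real \<Rightarrow> 'a) topology" where
  "visual_topology x0 =
     topology_generated_by {visual_nbhd x0 \<alpha> R \<epsilon> | \<alpha> R \<epsilon>. \<alpha> \<in> rays x0 \<and> 0 < R \<and> 0 < \<epsilon>}"

definition visual_lim :: "nat filter \<Rightarrow> 'a::metric_space \<Rightarrow> (nat \<Rightarrow> real \<Rightarrow> 'a) \<Rightarrow> (real \<Rightarrow> 'a)" where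
  "visual_lim \<omega> x0 \<alpha> = (THE \<beta>. limitin (visual_topology x0) \<alpha> \<beta> \<omega>)"

text \<open>The angle given by the law of cosines in a comparison triangle.\<close>

definition comparison_angle :: "'a::metric_space \<Rightarrow> 'a \<Rightarrow> 'a \<Rightarrow> real" where
  "comparison_angle p x y =
     arccos (((dist p x)\<^sup>2 + (dist p y)\<^sup>2 - (dist x y)\<^sup>2) / (2 * dist p x * dist p y))"

definition ray_angle :: "'a::metric_space \<Rightarrow> (real \<Rightarrow> 'a) \<Rightarrow> (real \<Rightarrow> 'a) \<Rightarrow> real" where
  "ray_angle x0 \<alpha> \<beta> = Lim at_top (\<lambda>t. comparison_angle x0 (\<alpha> t) (\<beta> t))"

definition curve_length :: "('b \<Rightarrow> 'b \<Rightarrow> real) \<Rightarrow> (real \<Rightarrow> 'b) \<Rightarrow> ennreal" where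
  "curve_length \<rho> p =
     (SUP (n, s) \<in> {(n::nat, s::nat \<Rightarrow> real).
         (\<forall>i\<le>n. s i \<in> {0..1}) \<and> (\<forall>i<n. s i \<le> s (Suc i))}.
       \<Sum>i<n. ennreal (\<rho> (p (s i)) (p (s (Suc i)))))"

definition curves_between ::
  "'b set \<Rightarrow> ('b \<Rightarrow> 'b \<Rightarrow> real) \<Rightarrow> 'b \<Rightarrow> 'b \<Rightarrow> (real \<Rightarrow> 'b) set" where
  "curves_between Z \<rho> x y = {p. p ` {0..1} \<subseteq> Z \<and> p 0 = x \<and> p 1 = y \<and>
     (\<forall>t\<in>{0..1}. ((\<lambda>s. \<rho> (p s) (p t)) \<longlongrightarrow> 0) (at t within {0..1}))}"

text \<open>The infimum of the empty set in \<^typ>\<open>ennreal\<close> is \<open>\<infinity>\<close>.\<close>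

definition path_metric :: "'b set \<Rightarrow> ('b \<Rightarrow> 'b \<Rightarrow> real) \<Rightarrow> 'b \<Rightarrow> 'b \<Rightarrow> ennreal" where
  "path_metric Z \<rho> x y = (INF p \<in> curves_between Z \<rho> x y. curve_length \<rho> p)"

definition tits_dist :: "'a::metric_space \<Rightarrow> (real \<Rightarrow> 'a) \<Rightarrow> (real \<Rightarrow> 'a) \<Rightarrow> ennreal" where
  "tits_dist x0 = path_metric (rays x0) (ray_angle x0)"


section \<open>Euclidean cones\<close>

text \<open>Collapsing \<open>{0} \<times> Z\<close> in \<open>[0,\<infinity>) \<times> Z\<close> leaves \<open>(0,\<infinity>) \<times> Z\<close> together with one further point,
  the apex; the apex is also the single point of the cone on the empty space.
  The point of the cone represented by \<open>(t, z)\<close> is \<open>cone_point t z\<close>.\<close>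

datatype 'z euclidean_cone = Apex | Off_Apex real 'z

definition cone_point :: "real \<Rightarrow> 'z \<Rightarrow> 'z euclidean_cone" where
  "cone_point t z = (if t = 0 then Apex else Off_Apex t z)"

definition cone_space :: "'z set \<Rightarrow> 'z euclidean_cone set" where
  "cone_space Z = insert Apex {cone_point t z | t z. 0 \<le> t \<and> z \<in> Z}"

text \<open>The distance on \<open>Z\<close> is allowed to be infinite. The first three equations are the last one
  with vanishing radii.\<close>

fun cone_dist ::
  "('z \<Rightarrow> 'z \<Rightarrow> ennreal) \<Rightarrow> 'z euclidean_cone \<Rightarrow> 'z euclidean_cone \<Rightarrow> real" where
  "cone_dist \<rho> Apex Apex = 0"
| "cone_dist \<rho> Apex (Off_Apex t' z') = t'"
| "cone_dist \<rho> (Off_Apex t z) Apex = t"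
| "cone_dist \<rho> (Off_Apex t z) (Off_Apex t' z') =
     sqrt (t\<^sup>2 + t'\<^sup>2 - 2 * t * t' * cos (enn2real (min (ennreal pi) (\<rho> z z'))))"

definition tits_cone_dist ::
  "'a::metric_space \<Rightarrow> (real \<Rightarrow> 'a) euclidean_cone \<Rightarrow> (real \<Rightarrow> 'a) euclidean_cone \<Rightarrow> real" where
  "tits_cone_dist x0 = cone_dist (tits_dist x0)"

definition angle_cone_dist ::
  "'a::metric_space \<Rightarrow> (real \<Rightarrow> 'a) euclidean_cone \<Rightarrow> (real \<Rightarrow> 'a) euclidean_cone \<Rightarrow> real" where
  "angle_cone_dist x0 = cone_dist (\<lambda>\<alpha> \<beta>. ennreal (ray_angle x0 \<alpha> \<beta>))"


section \<open>Ultraproducts and asymptotic cones\<close>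

text \<open>A non-principal ultrafilter is a filter \<open>\<omega>\<close>; a property holds \<open>\<omega>\<close>-almost surely iff it
  holds eventually along \<open>\<omega>\<close>, and ultralimits are limits along \<open>\<omega>\<close>.\<close>

definition nonprincipal_ultrafilter :: "nat filter \<Rightarrow> bool" where
  "nonprincipal_ultrafilter \<omega> \<longleftrightarrow> \<omega> \<noteq> bot \<and>
     (\<forall>P. eventually P \<omega> \<or> eventually (\<lambda>n. \<not> P n) \<omega>) \<and>
     (\<forall>m. \<not> eventually (\<lambda>n. n = m) \<omega>)"

definition bounded_sequences ::
  "(nat \<Rightarrow> 'b set) \<Rightarrow> (nat \<Rightarrow> 'b \<Rightarrow> 'b \<Rightarrow> real) \<Rightarrow> (nat \<Rightarrow> 'b) \<Rightarrow> (nat \<Rightarrow> 'b) set" where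
  "bounded_sequences M \<rho> e = {x. (\<forall>n. x n \<in> M n) \<and> (\<exists>B. \<forall>n. \<rho> n (x n) (e n) \<le> B)}"

definition ultra_dist ::
  "nat filter \<Rightarrow> (nat \<Rightarrow> 'b \<Rightarrow> 'b \<Rightarrow> real) \<Rightarrow> (nat \<Rightarrow> 'b) \<Rightarrow> (nat \<Rightarrow> 'b) \<Rightarrow> real" where
  "ultra_dist \<omega> \<rho> x y = Lim \<omega> (\<lambda>n. \<rho> n (x n) (y n))"

definition ultraproduct ::
  "nat filter \<Rightarrow> (nat \<Rightarrow> 'b set) \<Rightarrow> (nat \<Rightarrow> 'b \<Rightarrow> 'b \<Rightarrow> real) \<Rightarrow> (nat \<Rightarrow> 'b) \<Rightarrow> (nat \<Rightarrow> 'b) set set"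
  where "ultraproduct \<omega> M \<rho> e = metric_quotient (bounded_sequences M \<rho> e) (ultra_dist \<omega> \<rho>)"

definition scaling_sequence :: "nat filter \<Rightarrow> (nat \<Rightarrow> real) \<Rightarrow> bool" where
  "scaling_sequence \<omega> d \<longleftrightarrow> (\<forall>n. 0 < d n) \<and> filterlim d at_top \<omega>"

definition rescaled_dist :: "(nat \<Rightarrow> real) \<Rightarrow> nat \<Rightarrow> 'a::metric_space \<Rightarrow> 'a \<Rightarrow> real" where
  "rescaled_dist d n x y = dist x y / d n"

definition asymptotic_cone ::
  "nat filter \<Rightarrow> 'a::metric_space \<Rightarrow> (nat \<Rightarrow> real) \<Rightarrow> (nat \<Rightarrow> 'a) set set" where
  "asymptotic_cone \<omega> x0 d = ultraproduct \<omega> (\<lambda>_. UNIV) (rescaled_dist d) (\<lambda>_. x0)"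

definition asymptotic_cone_dist ::
  "nat filter \<Rightarrow> (nat \<Rightarrow> real) \<Rightarrow> (nat \<Rightarrow> 'a::metric_space) set \<Rightarrow> (nat \<Rightarrow> 'a) set \<Rightarrow> real" where
  "asymptotic_cone_dist \<omega> d = quotient_dist (ultra_dist \<omega> (rescaled_dist d))"

definition asymptotic_cone_class ::
  "nat filter \<Rightarrow> 'a::metric_space \<Rightarrow> (nat \<Rightarrow> real) \<Rightarrow> (nat \<Rightarrow> 'a) \<Rightarrow> (nat \<Rightarrow> 'a) set" where
  "asymptotic_cone_class \<omega> x0 d =
     quotient_class (bounded_sequences (\<lambda>_. UNIV) (rescaled_dist d) (\<lambda>_. x0))
       (ultra_dist \<omega> (rescaled_dist d))"

text \<open>Since angles are bounded by \<open>\<pi>\<close>, every sequence of rays is bounded, whatever the base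
  sequence.\<close>

definition ultra_boundary :: "nat filter \<Rightarrow> 'a::metric_space \<Rightarrow> (nat \<Rightarrow> real \<Rightarrow> 'a) set set" where
  "ultra_boundary \<omega> x0 =
     ultraproduct \<omega> (\<lambda>_. rays x0) (\<lambda>_. ray_angle x0) (\<lambda>_. SOME \<alpha>. \<alpha> \<in> rays x0)"

fun Psi ::
  "nat filter \<Rightarrow> 'a::metric_space \<Rightarrow> (nat \<Rightarrow> real) \<Rightarrow> (real \<Rightarrow> 'a) euclidean_cone \<Rightarrow> (nat \<Rightarrow> 'a) set"
  where
  "Psi \<omega> x0 d Apex = asymptotic_cone_class \<omega> x0 d (\<lambda>_. x0)"
| "Psi \<omega> x0 d (Off_Apex t \<alpha>) = asymptotic_cone_class \<omega> x0 d (\<lambda>n. \<alpha> (t * d n))"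

fun Psi_ultra ::
  "nat filter \<Rightarrow> 'a::metric_space \<Rightarrow> (nat \<Rightarrow> real) \<Rightarrow> (nat \<Rightarrow> real \<Rightarrow> 'a) set euclidean_cone \<Rightarrow>
    (nat \<Rightarrow> 'a) set"
  where
  "Psi_ultra \<omega> x0 d Apex = asymptotic_cone_class \<omega> x0 d (\<lambda>_. x0)"
| "Psi_ultra \<omega> x0 d (Off_Apex t A) =
     asymptotic_cone_class \<omega> x0 d (\<lambda>n. (SOME \<alpha>. \<alpha> \<in> A) n (t * d n))"


section \<open>Connecting maps and the direct limit\<close>

definition scaling_le :: "nat filter \<Rightarrow> (nat \<Rightarrow> real) \<Rightarrow> (nat \<Rightarrow> real) \<Rightarrow> bool" where
  "scaling_le \<omega> d' d \<longleftrightarrow> eventually (\<lambda>n. d' n \<le> d n) \<omega>"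

definition Xi :: "'a::metric_space \<Rightarrow> 'a \<Rightarrow> real \<Rightarrow> 'a" where
  "Xi x0 x t =
     (if dist x0 x \<le> t then x else (THE y. \<exists>c l. geodesic c l x0 x \<and> y = c t))"

definition connecting_map ::
  "nat filter \<Rightarrow> 'a::metric_space \<Rightarrow> (nat \<Rightarrow> real) \<Rightarrow> (nat \<Rightarrow> real) \<Rightarrow> (nat \<Rightarrow> 'a) set \<Rightarrow>
    (nat \<Rightarrow> 'a) set" where
  "connecting_map \<omega> x0 d d' A =
     (let x = (SOME x. x \<in> A)
      in asymptotic_cone_class \<omega> x0 d' (\<lambda>n. Xi x0 (x n) (d' n / d n * dist (x n) x0)))"

text \<open>The maps \<open>f i j\<close> from \<open>Y i\<close> to \<open>Y j\<close> are given for \<open>i\<close> above \<open>j\<close>.\<close>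

definition direct_limit_predist ::
  "'i set \<Rightarrow> ('i \<Rightarrow> 'i \<Rightarrow> bool) \<Rightarrow> ('i \<Rightarrow> 'b \<Rightarrow> 'b \<Rightarrow> real) \<Rightarrow> ('i \<Rightarrow> 'i \<Rightarrow> 'b \<Rightarrow> 'b) \<Rightarrow>
    'i \<times> 'b \<Rightarrow> 'i \<times> 'b \<Rightarrow> real" where
  "direct_limit_predist I le \<rho> f = (\<lambda>(i, x) (j, y).
     INF k \<in> {k \<in> I. le k i \<and> le k j}. \<rho> k (f i k x) (f j k y))"

definition direct_limit ::
  "'i set \<Rightarrow> ('i \<Rightarrow> 'i \<Rightarrow> bool) \<Rightarrow> ('i \<Rightarrow> 'b set) \<Rightarrow> ('i \<Rightarrow> 'b \<Rightarrow> 'b \<Rightarrow> real) \<Rightarrow>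
    ('i \<Rightarrow> 'i \<Rightarrow> 'b \<Rightarrow> 'b) \<Rightarrow> ('i \<times> 'b) set set" where
  "direct_limit I le Y \<rho> f = metric_quotient (SIGMA i:I. Y i) (direct_limit_predist I le \<rho> f)"

definition direct_limit_dist ::
  "'i set \<Rightarrow> ('i \<Rightarrow> 'i \<Rightarrow> bool) \<Rightarrow> ('i \<Rightarrow> 'b \<Rightarrow> 'b \<Rightarrow> real) \<Rightarrow> ('i \<Rightarrow> 'i \<Rightarrow> 'b \<Rightarrow> 'b) \<Rightarrow>
    ('i \<times> 'b) set \<Rightarrow> ('i \<times> 'b) set \<Rightarrow> real" where
  "direct_limit_dist I le \<rho> f = quotient_dist (direct_limit_predist I le \<rho> f)"

definition canonical_projection ::
  "'i set \<Rightarrow> ('i \<Rightarrow> 'i \<Rightarrow> bool) \<Rightarrow> ('i \<Rightarrow> 'b set) \<Rightarrow> ('i \<Rightarrow> 'b \<Rightarrow> 'b \<Rightarrow> real) \<Rightarrow>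
    ('i \<Rightarrow> 'i \<Rightarrow> 'b \<Rightarrow> 'b) \<Rightarrow> 'i \<Rightarrow> 'b \<Rightarrow> ('i \<times> 'b) set" where
  "canonical_projection I le Y \<rho> f i x =
     quotient_class (SIGMA i:I. Y i) (direct_limit_predist I le \<rho> f) (i, x)"

text \<open>The index set consists of the scaling sequences themselves. Sequences that agree
  \<open>\<omega>\<close>-almost surely are not identified beforehand; the connecting maps between their cones are
  mutually inverse isometries, so they contribute the same points to the limit.\<close>

definition cone_limit ::
  "nat filter \<Rightarrow> 'a::metric_space \<Rightarrow> ((nat \<Rightarrow> real) \<times> (nat \<Rightarrow> 'a) set) set set" where
  "cone_limit \<omega> x0 =
     direct_limit {d. scaling_sequence \<omega> d} (scaling_le \<omega>) (asymptotic_cone \<omega> x0)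
       (asymptotic_cone_dist \<omega>) (connecting_map \<omega> x0)"

definition cone_limit_dist ::
  "nat filter \<Rightarrow> 'a::metric_space \<Rightarrow> ((nat \<Rightarrow> real) \<times> (nat \<Rightarrow> 'a) set) set \<Rightarrow>
    ((nat \<Rightarrow> real) \<times> (nat \<Rightarrow> 'a) set) set \<Rightarrow> real" where
  "cone_limit_dist \<omega> x0 =
     direct_limit_dist {d. scaling_sequence \<omega> d} (scaling_le \<omega>)
       (asymptotic_cone_dist \<omega>) (connecting_map \<omega> x0)"

definition Theta ::
  "nat filter \<Rightarrow> 'a::metric_space \<Rightarrow> (nat \<Rightarrow> real) \<Rightarrow> (nat \<Rightarrow> 'a) set \<Rightarrow>
    ((nat \<Rightarrow> real) \<times> (nat \<Rightarrow> 'a) set) set" where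
  "Theta \<omega> x0 =
     canonical_projection {d. scaling_sequence \<omega> d} (scaling_le \<omega>) (asymptotic_cone \<omega> x0)
       (asymptotic_cone_dist \<omega>) (connecting_map \<omega> x0)"

end

theory Submission
  imports Defs "HOL-Library.Poly_Mapping" "HOL-Library.Z2" "HOL-Library.FSet"
begin

text \<open>The geodesics from \<open>x0\<close> to the points of a sequence representing a point of an asymptotic cone
  converge, when run through with speed \<open>dist (x n) x0 / d n\<close>, to a ray of constant speed, i.e. to a
  point of \<open>Cone(\<partial>X)\<close>. The CAT(0) inequality shows that the distance of two points decreases under
  the connecting maps at most to the cone distance of the corresponding rays, and a scaling sequence
  that grows slowly enough attains this value. Hence the direct limit is the cone over the angle
  metric. It is also the cone over the Tits metric because rays with an angle less than \<open>\<pi>\<close> have a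
  midpoint in the angle metric, a limit of the midpoints of \<open>\<alpha> n\<close> and \<open>\<beta> n\<close>.

  That the projection is determined by its values on the image of \<open>\<Psi>\<^sup>\<omega>\<close> amounts to surjectivity of
  \<open>\<Psi>\<^sup>\<omega>\<close>, which follows from almost geodesic completeness: every point of \<open>X\<close> is within
  bounded distance of a ray from \<open>x0\<close>. If this fails, cocompactness yields for every \<open>v\<close> and \<open>n\<close> a
  point \<open>p\<close> such that all geodesics from \<open>p\<close> through the \<open>n\<close>-ball around \<open>v\<close> end uniformly
  close to \<open>v\<close>. The geodesic contraction to \<open>p\<close> induces a contraction of the augmented chain complex
  of a finite-dimensional Rips complex of a net. By descending induction on the degree these
  contractions are combined into one of bounded propagation in all degrees down to \<open>0\<close>, so
  that every vertex is a boundary, which contradicts the augmentation.\<close>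

section \<open>Geodesics in CAT(0) spaces\<close>

text \<open>Combining the contractions is a vanishing argument for compactly supported cohomology
  mod two. Once \<open>s\<close> is known in the degrees above, the coefficient of a fixed simplex
  \<open>\<sigma>\<close> in the defect of \<open>s\<close> is a cocycle supported near
  \<open>\<sigma>\<close>. Every contraction of the complex yields a primitive of it, but the
  primitive has bounded support only if the contraction brings no distant simplex back near
  \<open>\<sigma>\<close>; the contraction to the point \<open>p\<close> that belongs to a vertex of
  \<open>\<sigma>\<close> has this property. Finite dimension starts the induction. In degree 0 the
  same argument kills the defect itself, because \<open>p\<close> is far from that vertex.

  The obstacle is that the contraction must stay inside one Rips complex: points moved along
  geodesics have to be rounded to the net, and moving the vertices one by one would exceed the
  diameter bound. Simplices are therefore subdivided at circumcentres, whose relevant distances are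
  smaller than the bound by a definite factor, and this gain pays for the rounding. Coefficients mod
  two spare all orientations.\<close>

lemma geodesicD:
  assumes "geodesic c l x y"
  shows "0 \<le> l" "c 0 = x" "c l = y" "l = dist x y"
    "\<And>s t. s \<in> {0..l} \<Longrightarrow> t \<in> {0..l} \<Longrightarrow> dist (c s) (c t) = \<bar>s - t\<bar>"
proof -
  show a: "0 \<le> l" "c 0 = x" "c l = y"
    "\<And>s t. s \<in> {0..l} \<Longrightarrow> t \<in> {0..l} \<Longrightarrow> dist (c s) (c t) = \<bar>s - t\<bar>"
    using assms by (auto simp: geodesic_def)
  show "l = dist x y" using a(4)[of 0 l] a(1-3) by auto
qed

text \<open>The third vertex of a Euclidean triangle with the vertices 0 and \<open>a\<close>. The
  law of cosines forces \<open>Re R\<close>, and the triangle inequalities for \<open>d\<close> are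
  what makes \<open>\<bar>Re R\<bar> \<le> b\<close>, so that the ordinate is real.\<close>

lemma ex_complex_triangle:
  fixes a b d :: real
  assumes "0 < a" "0 \<le> b" "\<bar>a - b\<bar> \<le> d" "d \<le> a + b"
  shows "\<exists>R::complex. cmod R = b \<and> cmod (of_real a - R) = d \<and> 2 * a * Re R = a\<^sup>2 + b\<^sup>2 - d\<^sup>2"
proof -
  define u where "u = (a\<^sup>2 + b\<^sup>2 - d\<^sup>2) / (2 * a)"
  have "(a - b)\<^sup>2 \<le> d\<^sup>2" using assms(3) by (metis abs_ge_zero power2_abs power_mono)
  then have u1: "u \<le> b" using assms(1) by (simp add: u_def field_simps power2_eq_square)
  have "0 \<le> d" using assms(3) by linarith
  then have "d\<^sup>2 \<le> (a + b)\<^sup>2" using assms(4) by (intro power_mono) auto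
  then have u2: "- b \<le> u" using assms(1) by (simp add: u_def field_simps power2_eq_square)
  have ub: "u\<^sup>2 \<le> b\<^sup>2" using u1 u2 by (metis abs_le_iff abs_le_square_iff abs_of_nonneg assms(2) minus_le_iff)
  define R where "R = Complex u (sqrt (b\<^sup>2 - u\<^sup>2))"
  have r: "cmod R = b" using ub assms(2) by (simp add: R_def cmod_def)
  have q: "2 * a * u = a\<^sup>2 + b\<^sup>2 - d\<^sup>2" using assms(1) by (simp add: u_def)
  have "(cmod (of_real a - R))\<^sup>2 = (a - u)\<^sup>2 + (b\<^sup>2 - u\<^sup>2)"
    using ub by (simp add: R_def cmod_power2)
  also have "\<dots> = d\<^sup>2" using q by (simp add: power2_eq_square algebra_simps)
  finally have "cmod (of_real a - R) = d" using \<open>0 \<le> d\<close> by simp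
  with r q show ?thesis by (intro exI[of _ R]) (simp add: R_def)
qed

locale cat0_space =
  fixes ty :: "'a::metric_space itself"
  assumes cat0: "CAT0_space ty"
begin

lemma ex_geodesic: "\<exists>c l. geodesic c l (x::'a) y"
  using cat0 unfolding CAT0_space_def by blast

lemma cat0_comparison:
  fixes P Q R :: complex and p q r :: 'a
  assumes "geodesic a la p q" "geodesic b lb p r"
    "dist P Q = dist p q" "dist P R = dist p r" "dist Q R = dist q r"
    "s \<in> {0..la}" "t \<in> {0..lb}" "x' \<in> closed_segment P Q" "y' \<in> closed_segment P R"
    "dist P x' = s" "dist P y' = t"
  shows "dist (a s) (b t) \<le> dist x' y'"
proof -
  obtain c lc where "geodesic c lc q r" using ex_geodesic by blast
  then show ?thesis using cat0 assms unfolding CAT0_space_def by blast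
qed

text \<open>The CAT(0) inequality with the comparison triangle eliminated: the right-hand side is
  the squared Euclidean distance, its cosine expressed through the side lengths. If
  \<open>la\<close> or \<open>lb\<close> is 0, the quotient is 0 by the convention for division, and
  \<open>s\<close> or \<open>t\<close> vanishes as well.\<close>

lemma geodesic_comparison:
  fixes p q r :: 'a
  assumes a: "geodesic a la p q" and b: "geodesic b lb p r"
    and s: "s \<in> {0..la}" and t: "t \<in> {0..lb}"
  shows "(dist (a s) (b t))\<^sup>2 \<le> s\<^sup>2 + t\<^sup>2 - s * t / (la * lb) * (la\<^sup>2 + lb\<^sup>2 - (dist q r)\<^sup>2)"
proof -
  note A = geodesicD[OF a] and B = geodesicD[OF b]
  consider "la = 0" | "lb = 0" | "la > 0" "lb > 0" using A(1) B(1) by linarith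
  then show ?thesis
  proof cases
    case 1
    then have "s = 0" using s by simp
    then show ?thesis using B(5)[of 0 t] t A(2) B(2) by simp
  next
    case 2
    then have "t = 0" using t by simp
    then show ?thesis using A(5)[of s 0] s A(2) B(2) by simp
  next
    case 3
    have tr: "\<bar>la - lb\<bar> \<le> dist q r" "dist q r \<le> la + lb"
      unfolding A(4) B(4)
      by (metis abs_dist_diff_le dist_commute) (metis dist_commute dist_triangle)
    obtain R :: complex where R: "cmod R = lb" "cmod (of_real la - R) = dist q r"
      "2 * la * Re R = la\<^sup>2 + lb\<^sup>2 - (dist q r)\<^sup>2"
      using ex_complex_triangle[of la lb "dist q r"] 3 tr by auto
    define y where "y = of_real (t / lb) * R"
    have d1: "dist (0::complex) (of_real s) = s" using s by (simp add: dist_norm)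
    have d2: "dist 0 y = t" using t R(1) 3 by (simp add: dist_norm y_def norm_mult norm_divide)
    have x': "of_real s \<in> closed_segment (0::complex) (of_real la)"
      unfolding in_segment using s 3 by (intro exI[of _ "s / la"]) (simp add: scaleR_conv_of_real)
    have y': "y \<in> closed_segment 0 R"
      unfolding in_segment using t 3
      by (intro exI[of _ "t / lb"]) (simp add: scaleR_conv_of_real y_def)
    have le: "dist (a s) (b t) \<le> dist (of_real s) y"
      by (rule cat0_comparison[OF a b _ _ _ s t x' y' d1 d2])
        (use A(1,4) B(1,4) R in \<open>auto simp: dist_norm\<close>)
    have "(dist (a s) (b t))\<^sup>2 \<le> (dist (of_real s) y)\<^sup>2"
      using le by (intro power_mono) auto
    also have "\<dots> = s\<^sup>2 - 2 * s * Re y + (cmod y)\<^sup>2"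
      unfolding dist_norm cmod_power2 by (simp add: power2_eq_square algebra_simps)
    also have "cmod y = t" using d2 by (simp add: dist_norm)
    also have "Re y = t / lb * Re R" by (simp add: y_def)
    also have "s\<^sup>2 - 2 * s * (t / lb * Re R) + t\<^sup>2 = s\<^sup>2 + t\<^sup>2 - s * t / (la * lb) * (2 * la * Re R)"
      using 3 by (simp add: field_simps)
    finally show ?thesis using R(3) by simp
  qed
qed

lemma geodesic_unique:
  fixes p q :: 'a
  assumes a: "geodesic a la p q" and b: "geodesic b lb p q" and t: "t \<in> {0..la}"
  shows "a t = b t"
proof -
  have l: "lb = la" using geodesicD(4)[OF a] geodesicD(4)[OF b] by simp
  show ?thesis
  proof (cases "la = 0")
    case True
    then show ?thesis using geodesicD[OF a] geodesicD[OF b] t by simp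
  next
    case False
    have "(dist (a t) (b t))\<^sup>2 \<le> 0"
      using geodesic_comparison[OF a b t t[folded l]] False
      by (simp add: l power2_eq_square field_simps)
    then show ?thesis by simp
  qed
qed

lemma Xi_eq:
  fixes p x :: 'a
  assumes "geodesic c l p x" "0 \<le> t" "t \<le> l"
  shows "Xi p x t = c t"
proof (cases "dist p x \<le> t")
  case True
  then show ?thesis using geodesicD[OF assms(1)] assms by (simp add: Xi_def)
next
  case False
  have "(THE y. \<exists>c l. geodesic c l p x \<and> y = c t) = c t"
  proof (rule the_equality)
    show "\<exists>c' l. geodesic c' l p x \<and> c t = c' t" using assms by blast
    fix y assume "\<exists>c l. geodesic c l p x \<and> y = c t"
    then show "y = c t" using geodesic_unique[OF assms(1)] assms by fastforce
  qed
  then show ?thesis using False by (simp add: Xi_def)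
qed

lemma geodesic_Xi: "geodesic (Xi p x) (dist p (x::'a)) p x"
proof -
  obtain c l where c: "geodesic c l p x" using ex_geodesic by blast
  note C = geodesicD[OF c]
  have e: "Xi p x t = c t" if "t \<in> {0..l}" for t using Xi_eq[OF c] that by simp
  show ?thesis unfolding geodesic_def C(4)[symmetric]
    using C e by auto
qed

lemma Xi_ge: "dist p x \<le> t \<Longrightarrow> Xi p x t = x"
  by (simp add: Xi_def)

lemma Xi_0 [simp]: "Xi p (x::'a) 0 = p"
  using geodesicD(2)[OF geodesic_Xi] .

lemma Xi_self [simp]: "0 \<le> t \<Longrightarrow> Xi p (p::'a) t = p"
  by (simp add: Xi_def)

lemma Xi_dist [simp]: "Xi p (x::'a) (dist p x) = x"
  by (simp add: Xi_def)

lemma dist_Xi_Xi_same: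
  "0 \<le> s \<Longrightarrow> s \<le> dist p x \<Longrightarrow> 0 \<le> t \<Longrightarrow> t \<le> dist p x \<Longrightarrow> dist (Xi p x s) (Xi p (x::'a) t) = \<bar>s - t\<bar>"
  using geodesicD(5)[OF geodesic_Xi] by simp

lemma dist_base_Xi: "0 \<le> t \<Longrightarrow> t \<le> dist p x \<Longrightarrow> dist p (Xi p (x::'a) t) = t"
  using dist_Xi_Xi_same[of 0 p x t] by simp

lemma dist_Xi_le:
  assumes "0 \<le> s" "0 \<le> t"
  shows "dist (Xi p x s) (Xi p (x::'a) t) \<le> \<bar>s - t\<bar>"
proof -
  have e: "Xi p x t = Xi p x (min t (dist p x))" for t by (cases "dist p x \<le> t") (auto simp: Xi_ge min_def)
  show ?thesis
    unfolding e[of s] e[of t] using assms by (subst dist_Xi_Xi_same) auto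
qed

lemma Xi_compare:
  fixes p x y :: 'a
  assumes "0 \<le> s" "s \<le> dist p x" "0 \<le> t" "t \<le> dist p y"
  shows "(dist (Xi p x s) (Xi p y t))\<^sup>2
    \<le> s\<^sup>2 + t\<^sup>2 - s * t / (dist p x * dist p y) * ((dist p x)\<^sup>2 + (dist p y)\<^sup>2 - (dist x y)\<^sup>2)"
  using geodesic_comparison[OF geodesic_Xi geodesic_Xi] assms by simp

text \<open>For \<open>s = l * dist p x\<close> and \<open>t = l * dist p y\<close> the bound in
  \<open>Xi_compare\<close> is \<open>l\<^sup>2\<close> times the squared distance of
  \<open>x\<close> and \<open>y\<close>. The monotonicity of distance ratios along rays rests on
  this estimate.\<close>

lemma Xi_contract:
  fixes p x y :: 'a
  assumes "0 \<le> l" "l \<le> 1"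
  shows "dist (Xi p x (l * dist p x)) (Xi p y (l * dist p y)) \<le> l * dist x y"
proof (cases "x = p \<or> y = p")
  case True
  then show ?thesis using assms dist_base_Xi[of "l * dist p x" p x] dist_base_Xi[of "l * dist p y" p y]
    by (auto simp: mult_left_le_one_le dist_commute)
next
  case False
  then have pos: "dist p x > 0" "dist p y > 0" by auto
  have "(dist (Xi p x (l * dist p x)) (Xi p y (l * dist p y)))\<^sup>2 \<le> (l * dist x y)\<^sup>2"
    using Xi_compare[of "l * dist p x" p x "l * dist p y" y] assms pos
    by (simp add: mult_left_le_one_le power_mult_distrib) (simp add: algebra_simps power2_eq_square)
  then show ?thesis using assms by (simp add: power2_le_iff_abs_le)
qed

text \<open>\<open>Xi p x R\<close> is the projection of \<open>x\<close> to the closed ball of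
  radius \<open>R\<close> around \<open>p\<close>. With \<open>x\<close> the point farther from
  \<open>p\<close>, only the cases in which \<open>x\<close> lies outside the ball need an estimate;
  they differ in whether \<open>y\<close> moves too.\<close>

lemma Xi_nonexpansive:
  fixes p x y :: 'a
  assumes "0 \<le> R"
  shows "dist (Xi p x R) (Xi p y R) \<le> dist x y"
proof -
  have main: "dist (Xi p x R) (Xi p y R) \<le> dist x y" if le: "dist p y \<le> dist p x" for x y :: 'a
  proof -
    define a b d where "a = dist p x" and "b = dist p y" and "d = dist x y"
    consider "a \<le> R" | "b < R" "R < a" "b = 0" | "b < R" "R < a" "b > 0" | "R \<le> b" "b = 0"
      | "R \<le> b" "b > 0"
      using zero_le_dist[of p y] unfolding b_def by linarith
    then show ?thesis
    proof cases
      case 1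
      then show ?thesis using le by (simp add: Xi_ge a_def)
    next
      case 2
      then have "p = y" by (simp add: b_def)
      then show ?thesis using 2 dist_base_Xi[of R p x] assms by (simp add: a_def dist_commute)
    next
      case 3
      then have a: "a > 0" by linarith
      have y: "Xi p y R = Xi p y b" using 3 by (simp add: Xi_ge b_def)
      have "(dist (Xi p x R) (Xi p y R))\<^sup>2 \<le> R\<^sup>2 + b\<^sup>2 - R * b / (a * b) * (a\<^sup>2 + b\<^sup>2 - d\<^sup>2)"
        unfolding y using Xi_compare[of R p x b y] assms 3 by (simp add: a_def b_def d_def)
      \<comment> \<open>This form isolates a term that is nonpositive because \<open>b < R\<close>
        and \<open>b < a\<close>.\<close>
      also have "\<dots> = (R / a) * d\<^sup>2 + (a - R) * (b\<^sup>2 / a - R)"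
        using a 3 by (simp add: field_simps power2_eq_square)
      also have "\<dots> \<le> 1 * d\<^sup>2 + 0"
      proof (intro add_mono mult_right_mono mult_nonneg_nonpos)
        have "b * b \<le> R * a" using 3 by (intro mult_mono) auto
        then show "b\<^sup>2 / a - R \<le> 0" using a by (simp add: field_simps power2_eq_square)
      qed (use 3 a in auto)
      finally show ?thesis by (simp add: d_def power2_le_iff_abs_le)
    next
      case 4
      then have "R = 0" using assms by simp
      then show ?thesis by simp
    next
      case 5
      then have a: "a > 0" "R \<le> a" using le by (auto simp: a_def b_def)
      have "(dist (Xi p x R) (Xi p y R))\<^sup>2 \<le> R\<^sup>2 + R\<^sup>2 - R * R / (a * b) * (a\<^sup>2 + b\<^sup>2 - d\<^sup>2)"
        using Xi_compare[of R p x R y] assms 5 a by (simp add: a_def b_def d_def)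
      also have "\<dots> = (R * R / (a * b)) * d\<^sup>2 - (R * R / (a * b)) * (a - b)\<^sup>2"
        using a 5 by (simp add: field_simps power2_eq_square)
      also have "\<dots> \<le> (R * R / (a * b)) * d\<^sup>2" using a 5 by simp
      also have "\<dots> \<le> 1 * d\<^sup>2"
      proof (intro mult_right_mono)
        have "R * R \<le> a * b" using 5 a assms by (intro mult_mono) auto
        then show "R * R / (a * b) \<le> 1" using a 5 by simp
      qed auto
      finally show ?thesis by (simp add: d_def power2_le_iff_abs_le)
    qed
  qed
  show ?thesis using main[of y x] main[of x y] by (cases "dist p y \<le> dist p x") (auto simp: dist_commute)
qed

text \<open>The inequality of Bruhat and Tits for an arbitrary division point: the squared distance
  to \<open>z\<close> is at least as convex along a geodesic as in the plane, where equality is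
  Stewart's theorem.\<close>

lemma Xi_convex_sq:
  fixes x y z :: 'a
  assumes "0 \<le> t" "t \<le> 1"
  shows "(dist z (Xi x y (t * dist x y)))\<^sup>2
    \<le> (1 - t) * (dist z x)\<^sup>2 + t * (dist z y)\<^sup>2 - t * (1 - t) * (dist x y)\<^sup>2"
proof -
  define l where "l = dist x y"
  let ?m = "Xi x y (t * l)"
  have l: "0 \<le> l" by (simp add: l_def)
  have tl: "0 \<le> t * l" "t * l \<le> dist x y" using assms l by (auto simp: mult_left_le_one_le l_def)
  consider "l = 0" | "dist x z = 0" | "l > 0" "dist x z > 0" using l zero_le_dist[of x z] by linarith
  then have "(dist z ?m)\<^sup>2 \<le> (1 - t) * (dist z x)\<^sup>2 + t * (dist z y)\<^sup>2 - t * (1 - t) * l\<^sup>2"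
  proof cases
    case 1
    then show ?thesis by (simp add: l_def algebra_simps)
  next
    case 2
    then have "z = x" by simp
    then have *: "dist z ?m = t * l" "dist z y = l" "dist z x = 0"
      using dist_base_Xi[OF tl] by (auto simp: l_def)
    show ?thesis unfolding * by (simp add: power2_eq_square algebra_simps)
  next
    case 3
    have "(dist ?m z)\<^sup>2 \<le> (t * l)\<^sup>2 + (dist x z)\<^sup>2
        - (t * l) * dist x z / (l * dist x z) * (l\<^sup>2 + (dist x z)\<^sup>2 - (dist y z)\<^sup>2)"
      using Xi_compare[OF tl, of "dist x z" z] 3 by (simp add: l_def)
    also have "\<dots> = (1 - t) * (dist x z)\<^sup>2 + t * (dist y z)\<^sup>2 - t * (1 - t) * l\<^sup>2"
      using 3 by (simp add: field_simps power2_eq_square)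
    finally show ?thesis by (simp add: dist_commute)
  qed
  then show ?thesis by (simp add: l_def)
qed

lemma Xi_isometry:
  fixes p x :: 'a and g :: "'a \<Rightarrow> 'a"
  assumes "\<And>x y. dist (g x) (g y) = dist x (y::'a)" "0 \<le> t"
  shows "Xi (g p) (g x) t = g (Xi p x t)"
proof (cases "dist p x \<le> t")
  case True
  then show ?thesis using assms by (simp add: Xi_def)
next
  case False
  have "geodesic (\<lambda>t. g (Xi p x t)) (dist p x) (g p) (g x)"
    using geodesic_Xi[of p x] assms(1) unfolding geodesic_def by auto
  then show ?thesis using Xi_eq[of "\<lambda>t. g (Xi p x t)"] False assms(2) by simp
qed

lemma Xi_geodesic_ray:
  assumes "\<alpha> \<in> rays (x0::'a)" "0 \<le> s" "s \<le> t"
  shows "Xi x0 (\<alpha> t) s = \<alpha> s"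
proof -
  have "geodesic \<alpha> t x0 (\<alpha> t)" using assms by (auto simp: geodesic_def rays_def)
  then show ?thesis using Xi_eq assms by blast
qed

lemma Xi_Xi:
  fixes p x :: 'a
  assumes "0 \<le> s" "s \<le> t" "t \<le> dist p x"
  shows "Xi p (Xi p x t) s = Xi p x s"
proof -
  have "geodesic (Xi p x) t p (Xi p x t)"
    using geodesic_Xi[of p x] assms by (auto simp: geodesic_def)
  then show ?thesis using Xi_eq assms by blast
qed

end

section \<open>Chains modulo two\<close>

type_synonym 'v chain = "'v \<Rightarrow>\<^sub>0 bit"

definition bas :: "'v \<Rightarrow> 'v chain" where
  "bas x = Poly_Mapping.single x 1"

text \<open>Over \<open>bit\<close> every nonzero coefficient is 1, so the linear extension of
  \<open>f\<close> is a plain sum over the support.\<close>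

definition lin :: "('v \<Rightarrow> 'w chain) \<Rightarrow> 'v chain \<Rightarrow> 'w chain" where
  "lin f c = (\<Sum>x\<in>Poly_Mapping.keys c. f x)"

lemma chain_add_self [simp]: "c + c = (0 :: 'v chain)"
  by (rule poly_mapping_eqI) (simp add: lookup_add)

lemma chain_add_cancel [simp]: "c + (c + d) = (d :: 'v chain)"
  by (simp add: add.assoc[symmetric])

lemma chain_add_eq_0_iff: "c + d = 0 \<longleftrightarrow> c = (d :: 'v chain)"
  by (metis add.right_neutral chain_add_cancel)

lemma keys_bas [simp]: "Poly_Mapping.keys (bas x) = {x}"
  by (simp add: bas_def)

lemma bas_nonzero [simp]: "bas x \<noteq> 0"
  by (metis keys_bas keys_zero insert_not_empty)

lemma lin_add:
  fixes f :: "'v \<Rightarrow> 'w chain"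
  shows "lin f (c + d) = lin f c + lin f d"
proof -
  have "(\<Sum>k\<in>Poly_Mapping.keys (c + d). (\<lambda>k b. if b = 1 then f k else 0) k (Poly_Mapping.lookup (c + d) k))
      = (\<Sum>k\<in>Poly_Mapping.keys c. (\<lambda>k b. if b = 1 then f k else 0) k (Poly_Mapping.lookup c k))
      + (\<Sum>k\<in>Poly_Mapping.keys d. (\<lambda>k b. if b = 1 then f k else 0) k (Poly_Mapping.lookup d k))"
  proof (rule setsum_keys_plus_distrib)
    fix k :: 'v and b1 b2 :: bit
    show "(if b1 + b2 = 1 then f k else 0) = (if b1 = 1 then f k else 0) + (if b2 = 1 then f k else 0)"
      by (cases b1; cases b2) auto
  qed auto
  moreover have "(\<Sum>k\<in>Poly_Mapping.keys c. (\<lambda>k b. if b = 1 then f k else 0) k (Poly_Mapping.lookup c k)) = lin f c" for c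
    unfolding lin_def by (intro sum.cong) (auto simp: in_keys_iff)
  ultimately show ?thesis by simp
qed

lemma lin_0 [simp]: "lin f 0 = 0"
  by (simp add: lin_def)

lemma lin_bas [simp]: "lin f (bas x) = f x"
  by (simp add: lin_def)

lemma lin_sum: "lin f (sum g A) = (\<Sum>x\<in>A. lin f (g x))"
  by (induction A rule: infinite_finite_induct) (auto simp: lin_add)

lemma lin_lin: "lin f (lin g c) = lin (\<lambda>x. lin f (g x)) c"
  by (simp add: lin_def[of g] lin_sum) (simp add: lin_def)

lemma lin_fun_add: "lin (\<lambda>x. f x + g x) c = lin f c + lin g c"
  by (simp add: lin_def sum.distrib)

lemma lin_zero_fun [simp]: "lin (\<lambda>x. 0) c = 0"
  by (simp add: lin_def)

lemma lin_cong: "(\<And>x. x \<in> Poly_Mapping.keys c \<Longrightarrow> f x = g x) \<Longrightarrow> lin f c = lin g c"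
  by (simp add: lin_def)

lemma keys_lin: "Poly_Mapping.keys (lin f c) \<subseteq> (\<Union>x\<in>Poly_Mapping.keys c. Poly_Mapping.keys (f x))"
  unfolding lin_def by (rule keys_sum)

lemma keys_linE:
  assumes "y \<in> Poly_Mapping.keys (lin f c)"
  obtains x where "x \<in> Poly_Mapping.keys c" "y \<in> Poly_Mapping.keys (f x)"
  using subsetD[OF keys_lin assms] by auto

lemma keys_addE:
  assumes "x \<in> Poly_Mapping.keys (c + d)"
  obtains "x \<in> Poly_Mapping.keys c" | "x \<in> Poly_Mapping.keys d"
  using subsetD[OF keys_add assms] by auto

lemma lin_bas_self [simp]: "lin bas c = c"
proof (rule poly_mapping_eqI)
  fix k
  have "Poly_Mapping.lookup (lin bas c) k = (\<Sum>x\<in>Poly_Mapping.keys c. if x = k then 1 else 0)"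
    by (simp add: lin_def lookup_sum bas_def lookup_single when_def)
  also have "\<dots> = Poly_Mapping.lookup c k"
    by (auto simp: in_keys_iff)
  finally show "Poly_Mapping.lookup (lin bas c) k = Poly_Mapping.lookup c k" .
qed

text \<open>The empty simplex is a chain of degree \<open>-1\<close>: the complex is augmented, so that a cone
  operator is a contraction in all degrees.\<close>

definition face_sum :: "'v fset \<Rightarrow> 'v fset chain" where
  "face_sum \<sigma> = (\<Sum>v\<in>fset \<sigma>. bas (\<sigma> |-| {|v|}))"

abbreviation bdry :: "'v fset chain \<Rightarrow> 'v fset chain" where
  "bdry \<equiv> lin face_sum"

text \<open>The join with the vertex \<open>a\<close>. A simplex that already contains
  \<open>a\<close> has a degenerate join, which counts as 0.\<close>

definition cone_on :: "'v \<Rightarrow> 'v fset \<Rightarrow> 'v fset chain" where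
  "cone_on a \<sigma> = (if a |\<in>| \<sigma> then 0 else bas (finsert a \<sigma>))"

lemma lin_face_sum: "lin f (face_sum \<sigma>) = (\<Sum>v\<in>fset \<sigma>. f (\<sigma> |-| {|v|}))"
  by (simp add: face_sum_def lin_sum)

lemma keys_face_sum:
  "\<tau> \<in> Poly_Mapping.keys (face_sum \<sigma>) \<Longrightarrow> \<exists>v. v |\<in>| \<sigma> \<and> \<tau> = \<sigma> |-| {|v|}"
  using keys_sum[of "\<lambda>v. bas (\<sigma> |-| {|v|})" "fset \<sigma>"] by (auto simp: face_sum_def)

lemma keys_face_sum_fcard:
  "\<tau> \<in> Poly_Mapping.keys (face_sum \<sigma>) \<Longrightarrow> \<tau> |\<subseteq>| \<sigma> \<and> fcard \<sigma> = Suc (fcard \<tau>)"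
  using keys_face_sum[of \<tau> \<sigma>] fcard_Suc_fminus1[of _ \<sigma>] by (metis fminus_fsubset_conv finsert_is_funion funion_upper2)

text \<open>If \<open>a\<close> is a vertex of \<open>\<sigma>\<close>, only the face opposite to
  \<open>a\<close> has a nonzero join, and that join is \<open>\<sigma>\<close>. Otherwise the faces
  of the join are \<open>\<sigma>\<close> and the joins of the faces of
  \<open>\<sigma>\<close>.\<close>

lemma bdry_cone_on: "bdry (cone_on a \<sigma>) + lin (cone_on a) (face_sum \<sigma>) = bas \<sigma>"
proof (cases "a |\<in>| \<sigma>")
  case True
  have "lin (cone_on a) (face_sum \<sigma>) = (\<Sum>v\<in>fset \<sigma>. if v = a then bas \<sigma> else 0)"
    unfolding lin_face_sum using True by (intro sum.cong) (auto simp: cone_on_def finsert_absorb)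
  also have "\<dots> = bas \<sigma>" using True by simp
  finally show ?thesis using True by (simp add: cone_on_def)
next
  case False
  have "bdry (cone_on a \<sigma>) = (\<Sum>v\<in>insert a (fset \<sigma>). bas (finsert a \<sigma> |-| {|v|}))"
    using False by (simp add: cone_on_def face_sum_def)
  also have "\<dots> = bas (finsert a \<sigma> |-| {|a|}) + (\<Sum>v\<in>fset \<sigma>. bas (finsert a \<sigma> |-| {|v|}))"
    using False by (subst sum.insert) auto
  also have "finsert a \<sigma> |-| {|a|} = \<sigma>" using False by auto
  also have "(\<Sum>v\<in>fset \<sigma>. bas (finsert a \<sigma> |-| {|v|})) = lin (cone_on a) (face_sum \<sigma>)"
    unfolding lin_face_sum
  proof (intro sum.cong refl)
    fix v assume "v \<in> fset \<sigma>"
    then have "finsert a \<sigma> |-| {|v|} = finsert a (\<sigma> |-| {|v|})" using False by auto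
    then show "bas (finsert a \<sigma> |-| {|v|}) = cone_on a (\<sigma> |-| {|v|})"
      using False by (simp add: cone_on_def)
  qed
  finally show ?thesis by (simp add: add.assoc)
qed

lemma bdry_lin_cone_on: "bdry (lin (cone_on a) c) = c + lin (cone_on a) (bdry c)"
proof -
  have "bdry (lin (cone_on a) c) + lin (cone_on a) (bdry c) = c"
    by (simp add: lin_lin lin_fun_add[symmetric] bdry_cone_on)
  then show ?thesis by (metis add.assoc add.right_neutral chain_add_self)
qed

text \<open>The cone formula replaces the pairwise cancellation of faces: a simplex with the vertex
  \<open>a\<close> is the join of \<open>a\<close> with the opposite face, so its boundary is
  computed from that of the smaller simplex.\<close>

lemma bdry_face_sum [simp]: "bdry (face_sum \<sigma>) = 0"
proof (induction \<sigma>)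
  case empty
  then show ?case by (simp add: face_sum_def)
next
  case (insert a \<sigma>)
  have "face_sum (finsert a \<sigma>) = bdry (cone_on a \<sigma>)"
    using insert.hyps by (simp add: cone_on_def)
  also have "\<dots> = bas \<sigma> + lin (cone_on a) (face_sum \<sigma>)"
    using bdry_lin_cone_on[of a "bas \<sigma>"] by simp
  finally show ?case by (simp add: lin_add bdry_lin_cone_on insert.IH)
qed

lemma bdry_bdry [simp]: "bdry (bdry c) = 0"
  by (simp add: lin_lin)

lemma fcard_face_less: "v \<in> fset \<sigma> \<Longrightarrow> fcard (\<sigma> |-| {|v|}) < fcard \<sigma>"
  by (rule fcard_fminus1_less)

section \<open>Homotopies and subdivisions defined by iterated cones\<close>

context
  \<comment> \<open>The congruence rule makes \<open>v\<close> a known vertex of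
    \<open>\<sigma>\<close> in the recursive calls, which is why the faces are smaller.\<close>
  notes sum.cong [fundef_cong]
begin

text \<open>A null homotopy of a chain map \<open>T\<close> is built degree by degree:
  \<open>T \<sigma>\<close> plus the homotopy on the boundary of \<open>\<sigma>\<close> is a cycle,
  and it is filled by the cone with apex \<open>b \<sigma>\<close>.\<close>

function cone_homotopy :: "('v fset \<Rightarrow> 'v) \<Rightarrow> ('v fset \<Rightarrow> 'v fset chain) \<Rightarrow> 'v fset \<Rightarrow> 'v fset chain" where
  "cone_homotopy b T \<sigma> =
     lin (cone_on (b \<sigma>)) (T \<sigma> + (\<Sum>v\<in>fset \<sigma>. cone_homotopy b T (\<sigma> |-| {|v|})))"
  by pat_completeness auto
termination by (relation "Wellfounded.measure (\<lambda>(b, T, \<sigma>). fcard \<sigma>)") (auto simp: fcard_face_less simp del: fcard_fminus_finsert)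

text \<open>Barycentric subdivision with \<open>a \<sigma>\<close> in the role of the barycentre:
  the subdivided boundary is coned off from it. The empty simplex is kept, so that the augmentation
  is preserved.\<close>

function cone_subdivision :: "('v fset \<Rightarrow> 'v) \<Rightarrow> 'v fset \<Rightarrow> 'v fset chain" where
  "cone_subdivision a \<sigma> = (if \<sigma> = {||} then bas {||}
     else lin (cone_on (a \<sigma>)) (\<Sum>v\<in>fset \<sigma>. cone_subdivision a (\<sigma> |-| {|v|})))"
  by pat_completeness auto
termination by (relation "Wellfounded.measure (\<lambda>(a, \<sigma>). fcard \<sigma>)") (auto simp: fcard_face_less simp del: fcard_fminus_finsert)

end

declare cone_homotopy.simps [simp del] cone_subdivision.simps [simp del]

lemma cone_homotopy_eq:
  "cone_homotopy b T \<sigma> = lin (cone_on (b \<sigma>)) (T \<sigma> + lin (cone_homotopy b T) (face_sum \<sigma>))"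
  unfolding lin_face_sum by (rule cone_homotopy.simps)

lemma cone_homotopy_empty: "T {||} = 0 \<Longrightarrow> cone_homotopy b T {||} = 0"
  by (subst cone_homotopy_eq) (simp add: face_sum_def)

lemma cone_subdivision_empty [simp]: "cone_subdivision a {||} = bas {||}"
  using cone_subdivision.simps[of a "{||}"] by (simp only: if_True simp_thms)

lemma cone_subdivision_eq:
  assumes "\<sigma> \<noteq> {||}"
  shows "cone_subdivision a \<sigma> = lin (cone_on (a \<sigma>)) (lin (cone_subdivision a) (face_sum \<sigma>))"
  using cone_subdivision.simps[of a \<sigma>] assms unfolding lin_face_sum by argo

lemma fset_face_induct [case_names face]:
  assumes "\<And>\<sigma>. (\<And>v. v |\<in>| \<sigma> \<Longrightarrow> P (\<sigma> |-| {|v|})) \<Longrightarrow> P \<sigma>"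
  shows "P \<sigma>"
proof (induction "fcard \<sigma>" arbitrary: \<sigma> rule: less_induct)
  case (less \<sigma>)
  show ?case
  proof (rule assms)
    fix v assume "v |\<in>| \<sigma>"
    then show "P (\<sigma> |-| {|v|})" by (intro less fcard_face_less)
  qed
qed

lemma bdry_cone_subdivision: "bdry (cone_subdivision a \<sigma>) = lin (cone_subdivision a) (face_sum \<sigma>)"
proof (induction \<sigma> rule: fset_face_induct)
  case (face \<sigma>)
  show ?case
  proof (cases "\<sigma> = {||}")
    case True
    then show ?thesis by (simp add: face_sum_def)
  next
    case False
    have "bdry (lin (cone_subdivision a) (face_sum \<sigma>))
        = lin (\<lambda>\<tau>. bdry (cone_subdivision a \<tau>)) (face_sum \<sigma>)"
      by (rule lin_lin)
    also have "\<dots> = lin (\<lambda>\<tau>. lin (cone_subdivision a) (face_sum \<tau>)) (face_sum \<sigma>)"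
    proof (rule lin_cong)
      fix \<tau> assume "\<tau> \<in> Poly_Mapping.keys (face_sum \<sigma>)"
      then obtain v where v: "v |\<in>| \<sigma>" "\<tau> = \<sigma> |-| {|v|}" using keys_face_sum by blast
      show "bdry (cone_subdivision a \<tau>) = lin (cone_subdivision a) (face_sum \<tau>)"
        unfolding v(2) by (rule face[OF v(1)])
    qed
    also have "\<dots> = lin (cone_subdivision a) (bdry (face_sum \<sigma>))"
      by (rule lin_lin[symmetric])
    finally have "bdry (lin (cone_subdivision a) (face_sum \<sigma>)) = 0"
      by (simp only: bdry_face_sum lin_0)
    then show ?thesis
      unfolding cone_subdivision_eq[OF False] bdry_lin_cone_on by (simp only: lin_0 add_0_right)
  qed
qed

text \<open>By induction \<open>T \<sigma> + lin (cone_homotopy b T) (face_sum \<sigma>)\<close> is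
  a cycle, and by the cone formula the cone over a cycle has that cycle as its boundary.\<close>

lemma bdry_cone_homotopy:
  assumes T: "\<And>\<sigma>. bdry (T \<sigma>) = lin T (face_sum \<sigma>)"
  shows "bdry (cone_homotopy b T \<sigma>) + lin (cone_homotopy b T) (face_sum \<sigma>) = T \<sigma>"
proof (induction \<sigma> rule: fset_face_induct)
  case (face \<sigma>)
  let ?G = "cone_homotopy b T"
  have "bdry (lin ?G (face_sum \<sigma>)) + lin ?G (bdry (face_sum \<sigma>))
      = lin (\<lambda>\<tau>. bdry (?G \<tau>) + lin ?G (face_sum \<tau>)) (face_sum \<sigma>)"
    by (simp only: lin_lin lin_fun_add)
  also have "\<dots> = lin T (face_sum \<sigma>)"
  proof (rule lin_cong)
    fix \<tau> assume "\<tau> \<in> Poly_Mapping.keys (face_sum \<sigma>)"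
    then obtain v where v: "v |\<in>| \<sigma>" "\<tau> = \<sigma> |-| {|v|}" using keys_face_sum by blast
    show "bdry (?G \<tau>) + lin ?G (face_sum \<tau>) = T \<tau>"
      unfolding v(2) by (rule face[OF v(1)])
  qed
  finally have "bdry (lin ?G (face_sum \<sigma>)) = bdry (T \<sigma>)"
    by (simp only: bdry_face_sum lin_0 add_0_right T)
  then have "bdry (T \<sigma> + lin ?G (face_sum \<sigma>)) = 0" by (simp only: lin_add chain_add_self)
  then have "bdry (?G \<sigma>) = T \<sigma> + lin ?G (face_sum \<sigma>)"
    by (simp only: cone_homotopy_eq[of b T \<sigma>] bdry_lin_cone_on lin_0 add_0_right)
  then show ?case by (simp only: add.assoc chain_add_self add_0_right)
qed

text \<open>A carrier argument: a family \<open>C\<close> that admits the joins of carried simplices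
  with the apex contains all simplices of the homotopy. The clause
  \<open>b \<sigma> |\<notin>| \<rho>\<close> may be assumed since other joins are 0; it keeps the
  counts of vertices exact.\<close>

lemma keys_cone_homotopy:
  assumes "\<And>\<sigma> \<rho>. P \<sigma> \<Longrightarrow> \<rho> \<in> Poly_Mapping.keys (T \<sigma>) \<Longrightarrow> b \<sigma> |\<notin>| \<rho> \<Longrightarrow> finsert (b \<sigma>) \<rho> \<in> C \<sigma>"
    and "\<And>\<sigma> v \<rho>. P \<sigma> \<Longrightarrow> v |\<in>| \<sigma> \<Longrightarrow> \<rho> \<in> C (\<sigma> |-| {|v|}) \<Longrightarrow> b \<sigma> |\<notin>| \<rho> \<Longrightarrow> finsert (b \<sigma>) \<rho> \<in> C \<sigma>"
    and "\<And>\<sigma> v. P \<sigma> \<Longrightarrow> v |\<in>| \<sigma> \<Longrightarrow> P (\<sigma> |-| {|v|})" and "P \<sigma>"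
  shows "Poly_Mapping.keys (cone_homotopy b T \<sigma>) \<subseteq> C \<sigma>"
  using \<open>P \<sigma>\<close>
proof (induction \<sigma> rule: fset_face_induct)
  case (face \<sigma>)
  show ?case
  proof
    fix \<rho> assume "\<rho> \<in> Poly_Mapping.keys (cone_homotopy b T \<sigma>)"
    then have "\<rho> \<in> Poly_Mapping.keys (lin (cone_on (b \<sigma>)) (T \<sigma> + lin (cone_homotopy b T) (face_sum \<sigma>)))"
      by (simp only: cone_homotopy_eq[of b T \<sigma>])
    then obtain \<rho>' where \<rho>': "\<rho>' \<in> Poly_Mapping.keys (T \<sigma> + lin (cone_homotopy b T) (face_sum \<sigma>))"
      and "\<rho> \<in> Poly_Mapping.keys (cone_on (b \<sigma>) \<rho>')"
      by (rule keys_linE)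
    then have \<rho>: "b \<sigma> |\<notin>| \<rho>'" "\<rho> = finsert (b \<sigma>) \<rho>'" by (auto simp: cone_on_def split: if_splits)
    from \<rho>' show "\<rho> \<in> C \<sigma>"
    proof (cases rule: keys_addE)
      case 1
      then show ?thesis unfolding \<rho>(2) by (rule assms(1)[OF face.prems _ \<rho>(1)])
    next
      case 2
      then obtain \<tau> where \<tau>: "\<tau> \<in> Poly_Mapping.keys (face_sum \<sigma>)" "\<rho>' \<in> Poly_Mapping.keys (cone_homotopy b T \<tau>)"
        by (rule keys_linE)
      then obtain v where v: "v |\<in>| \<sigma>" "\<tau> = \<sigma> |-| {|v|}" using keys_face_sum by blast
      have "\<rho>' \<in> C (\<sigma> |-| {|v|})"
        by (rule subsetD[OF face.IH[OF v(1) assms(3)[OF face.prems v(1)]] \<tau>(2)[unfolded v(2)]])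
      then show ?thesis unfolding \<rho>(2) by (rule assms(2)[OF face.prems v(1) _ \<rho>(1)])
    qed
  qed
qed

lemma keys_cone_subdivision:
  assumes "\<And>\<sigma> v \<rho>. v |\<in>| \<sigma> \<Longrightarrow> \<rho> \<in> C (\<sigma> |-| {|v|}) \<Longrightarrow> a \<sigma> |\<notin>| \<rho> \<Longrightarrow> finsert (a \<sigma>) \<rho> \<in> C \<sigma>"
    and "{||} \<in> C {||}"
  shows "Poly_Mapping.keys (cone_subdivision a \<sigma>) \<subseteq> C \<sigma>"
proof (induction \<sigma> rule: fset_face_induct)
  case (face \<sigma>)
  show ?case
  proof (cases "\<sigma> = {||}")
    case True
    then show ?thesis using assms(2) by simp
  next
    case False
    show ?thesis
    proof
      fix \<rho> assume "\<rho> \<in> Poly_Mapping.keys (cone_subdivision a \<sigma>)"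
      then have "\<rho> \<in> Poly_Mapping.keys (lin (cone_on (a \<sigma>)) (lin (cone_subdivision a) (face_sum \<sigma>)))"
        by (simp only: cone_subdivision_eq[OF False])
      then obtain \<rho>' where \<rho>': "\<rho>' \<in> Poly_Mapping.keys (lin (cone_subdivision a) (face_sum \<sigma>))"
        and "\<rho> \<in> Poly_Mapping.keys (cone_on (a \<sigma>) \<rho>')"
        by (rule keys_linE)
      then have \<rho>: "a \<sigma> |\<notin>| \<rho>'" "\<rho> = finsert (a \<sigma>) \<rho>'" by (auto simp: cone_on_def split: if_splits)
      obtain \<tau> where \<tau>: "\<tau> \<in> Poly_Mapping.keys (face_sum \<sigma>)" "\<rho>' \<in> Poly_Mapping.keys (cone_subdivision a \<tau>)"
        using \<rho>' by (rule keys_linE)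
      then obtain v where v: "v |\<in>| \<sigma>" "\<tau> = \<sigma> |-| {|v|}" using keys_face_sum by blast
      have "\<rho>' \<in> C (\<sigma> |-| {|v|})"
        by (rule subsetD[OF face.IH[OF v(1)] \<tau>(2)[unfolded v(2)]])
      then show "\<rho> \<in> C \<sigma>" unfolding \<rho>(2) by (rule assms(1)[OF v(1) _ \<rho>(1)])
    qed
  qed
qed

text \<open>Only the faces of \<open>\<sigma>\<close> enter the recursion. The values
  \<open>b {||}\<close> and \<open>b' {||}\<close> may differ because \<open>T {||} = 0\<close>
  makes the homotopy 0 there.\<close>

lemma cone_homotopy_cong:
  assumes "\<And>\<tau>. \<tau> |\<subseteq>| \<sigma> \<Longrightarrow> T \<tau> = T' \<tau>" "\<And>\<tau>. \<tau> |\<subseteq>| \<sigma> \<Longrightarrow> \<tau> \<noteq> {||} \<Longrightarrow> b \<tau> = b' \<tau>" "T {||} = 0"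
  shows "cone_homotopy b T \<sigma> = cone_homotopy b' T' \<sigma>"
  using assms
proof (induction \<sigma> rule: fset_face_induct)
  case (face \<sigma>)
  have "lin (cone_homotopy b T) (face_sum \<sigma>) = lin (cone_homotopy b' T') (face_sum \<sigma>)"
  proof (rule lin_cong)
    fix \<tau> assume "\<tau> \<in> Poly_Mapping.keys (face_sum \<sigma>)"
    then obtain v where v: "v |\<in>| \<sigma>" "\<tau> = \<sigma> |-| {|v|}" using keys_face_sum by blast
    have "\<rho> |\<subseteq>| \<sigma>" if "\<rho> |\<subseteq>| \<sigma> |-| {|v|}" for \<rho> using that by blast
    then show "cone_homotopy b T \<tau> = cone_homotopy b' T' \<tau>"
      unfolding v(2) by (intro face.IH[OF v(1)] face.prems)
  qed
  then have step: "cone_homotopy b T \<sigma> = lin (cone_on (b \<sigma>)) (T \<sigma> + lin (cone_homotopy b' T') (face_sum \<sigma>))"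
    by (subst cone_homotopy_eq) (rule arg_cong[of _ _ "\<lambda>x. lin (cone_on (b \<sigma>)) (T \<sigma> + x)"])
  show ?case
  proof (cases "\<sigma> = {||}")
    case True
    then show ?thesis using face.prems(3) face.prems(1)[of "{||}"]
      by (metis cone_homotopy_empty fempty_fsubsetI)
  next
    case False
    have "T \<sigma> = T' \<sigma>" "b \<sigma> = b' \<sigma>" using face.prems(1,2)[of \<sigma>] False by simp_all
    with step show ?thesis using cone_homotopy_eq[of b' T' \<sigma>] by argo
  qed
qed

lemma cone_homotopy_0: "(\<And>\<tau>. \<tau> |\<subseteq>| \<sigma> \<Longrightarrow> T \<tau> = 0) \<Longrightarrow> cone_homotopy b T \<sigma> = 0"
proof (induction \<sigma> rule: fset_face_induct)
  case (face \<sigma>)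
  have "lin (cone_homotopy b T) (face_sum \<sigma>) = lin (\<lambda>_. 0) (face_sum \<sigma>)"
  proof (rule lin_cong)
    fix \<tau> assume "\<tau> \<in> Poly_Mapping.keys (face_sum \<sigma>)"
    then obtain v where v: "v |\<in>| \<sigma>" "\<tau> = \<sigma> |-| {|v|}" using keys_face_sum by blast
    have "\<rho> |\<subseteq>| \<sigma>" if "\<rho> |\<subseteq>| \<sigma> |-| {|v|}" for \<rho> using that by blast
    then show "cone_homotopy b T \<tau> = 0"
      unfolding v(2) by (intro face.IH[OF v(1)] face.prems)
  qed
  moreover have "T \<sigma> = 0" by (rule face.prems) simp
  ultimately have "T \<sigma> + lin (cone_homotopy b T) (face_sum \<sigma>) = 0" by simp
  then show ?case using cone_homotopy_eq[of b T \<sigma>] lin_0[of "cone_on (b \<sigma>)"] by argo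
qed

lemma cone_subdivision_cong:
  "(\<And>\<tau>. \<tau> |\<subseteq>| \<sigma> \<Longrightarrow> \<tau> \<noteq> {||} \<Longrightarrow> a \<tau> = a' \<tau>) \<Longrightarrow> cone_subdivision a \<sigma> = cone_subdivision a' \<sigma>"
proof (induction \<sigma> rule: fset_face_induct)
  case (face \<sigma>)
  show ?case
  proof (cases "\<sigma> = {||}")
    case False
    have "lin (cone_subdivision a) (face_sum \<sigma>) = lin (cone_subdivision a') (face_sum \<sigma>)"
    proof (rule lin_cong)
      fix \<tau> assume "\<tau> \<in> Poly_Mapping.keys (face_sum \<sigma>)"
      then obtain v where v: "v |\<in>| \<sigma>" "\<tau> = \<sigma> |-| {|v|}" using keys_face_sum by blast
      have "\<rho> |\<subseteq>| \<sigma>" if "\<rho> |\<subseteq>| \<sigma> |-| {|v|}" for \<rho> using that by blast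
      then show "cone_subdivision a \<tau> = cone_subdivision a' \<tau>"
        unfolding v(2) by (intro face.IH[OF v(1)] face.prems)
    qed
    moreover have "a \<sigma> = a' \<sigma>" by (rule face.prems) (use False in simp_all)
    ultimately show ?thesis using cone_subdivision_eq[OF False, of a] cone_subdivision_eq[OF False, of a'] by argo
  qed simp
qed

section \<open>Chain contractions of bounded propagation\<close>

lemma fcard_fempty [simp]: "fcard {||} = 0"
  by (simp only: fcard_0_eq)

text \<open>The homotopy formula expresses \<open>lin s (face_sum \<kappa>)\<close> as
  \<open>bas \<kappa> + bdry (s \<kappa>)\<close>; taking boundaries leaves
  \<open>face_sum \<kappa>\<close>, which cancels.\<close>

lemma bdry_defect:
  assumes "bdry (s \<kappa>) + lin s (face_sum \<kappa>) = bas \<kappa>"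
  shows "lin (\<lambda>\<rho>. bas \<rho> + bdry (s \<rho>)) (face_sum \<kappa>) = 0"
proof -
  have "lin (\<lambda>\<rho>. bas \<rho> + bdry (s \<rho>)) (face_sum \<kappa>) = face_sum \<kappa> + bdry (lin s (face_sum \<kappa>))"
    by (simp only: lin_fun_add lin_lin lin_bas_self)
  also have "lin s (face_sum \<kappa>) = bas \<kappa> + bdry (s \<kappa>)"
    using assms by (metis add.commute chain_add_cancel)
  finally show ?thesis by (simp add: lin_add)
qed

text \<open>The operator \<open>s\<close> is extended one degree down. Its defect \<open>z\<close> vanishes on boundaries, so the
  coefficient of \<open>\<sigma>\<close> in \<open>z \<rho>\<close> can be computed from the boundary of \<open>\<rho>\<close> by any contraction of the
  complex. The contraction is chosen to depend on \<open>\<sigma>\<close>: the one that moves only simplices near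
  \<open>\<sigma>\<close> through a neighbourhood of \<open>\<sigma>\<close> keeps the propagation bounded.\<close>

lemma exists_local_contraction_step:
  fixes S :: "'v::metric_space fset set" and D r :: real and s :: "'v fset \<Rightarrow> 'v fset chain"
  assumes locfin: "\<And>\<tau> R. \<tau> \<in> S \<Longrightarrow> \<tau> \<noteq> {||} \<Longrightarrow> finite {\<sigma> \<in> S. \<forall>x\<in>fset \<sigma>. \<forall>y\<in>fset \<tau>. dist x y \<le> R}"
    and sub: "\<And>\<sigma> \<tau>. \<sigma> \<in> S \<Longrightarrow> \<tau> |\<subseteq>| \<sigma> \<Longrightarrow> \<tau> \<in> S"
    and diam: "\<And>\<sigma> x y. \<sigma> \<in> S \<Longrightarrow> x |\<in>| \<sigma> \<Longrightarrow> y |\<in>| \<sigma> \<Longrightarrow> dist x y \<le> D"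
    and k: "1 \<le> k"
    and s: "\<And>\<tau>. \<tau> \<in> S \<Longrightarrow> Suc k \<le> fcard \<tau> \<Longrightarrow> Poly_Mapping.keys (s \<tau>) \<subseteq>
        {\<sigma> \<in> S. fcard \<sigma> = Suc (fcard \<tau>) \<and> (\<forall>x\<in>fset \<sigma>. \<forall>y\<in>fset \<tau>. dist x y \<le> r)}"
    and hs: "\<And>\<rho>. \<rho> \<in> S \<Longrightarrow> Suc (Suc k) \<le> fcard \<rho> \<Longrightarrow> bdry (s \<rho>) + lin s (face_sum \<rho>) = bas \<rho>"
    and H: "\<And>v \<sigma>. \<sigma> \<in> S \<Longrightarrow> Poly_Mapping.keys (H v \<sigma>) \<subseteq> {\<rho> \<in> S. fcard \<rho> = Suc (fcard \<sigma>)}"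
    and hH: "\<And>v \<sigma>. \<sigma> \<in> S \<Longrightarrow> bdry (H v \<sigma>) + lin (H v) (face_sum \<sigma>) = bas \<sigma>"
    and near: "\<And>v \<sigma> \<rho> u w. \<sigma> \<in> S \<Longrightarrow> \<sigma> \<noteq> {||} \<Longrightarrow> {|v|} \<in> S \<Longrightarrow> \<rho> \<in> Poly_Mapping.keys (H v \<sigma>) \<Longrightarrow>
        u |\<in>| \<rho> \<Longrightarrow> dist u v \<le> max r D \<Longrightarrow> w |\<in>| \<sigma> \<Longrightarrow> dist w v \<le> m"
  shows "\<exists>s' r'. (\<forall>\<tau>. \<tau> \<in> S \<longrightarrow> k \<le> fcard \<tau> \<longrightarrow> Poly_Mapping.keys (s' \<tau>) \<subseteq>
        {\<sigma> \<in> S. fcard \<sigma> = Suc (fcard \<tau>) \<and> (\<forall>x\<in>fset \<sigma>. \<forall>y\<in>fset \<tau>. dist x y \<le> r')})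
     \<and> (\<forall>\<rho>. \<rho> \<in> S \<longrightarrow> Suc k \<le> fcard \<rho> \<longrightarrow> bdry (s' \<rho>) + lin s' (face_sum \<rho>) = bas \<rho>)"
proof -
  \<comment> \<open>An extension of \<open>s\<close> to simplices with \<open>k\<close> vertices
    satisfies the homotopy formula on those with \<open>Suc k\<close> vertices iff it maps the
    boundary of each such \<open>\<rho>\<close> to \<open>z \<rho>\<close>.\<close>
  define z where "z \<rho> = bas \<rho> + bdry (s \<rho>)" for \<rho>
  have zfun: "z = (\<lambda>\<rho>. bas \<rho> + bdry (s \<rho>))" by (simp add: z_def fun_eq_iff)
  have zkeys: "\<sigma> \<in> S \<and> fcard \<sigma> = fcard \<rho> \<and> (\<forall>x\<in>fset \<sigma>. \<forall>y\<in>fset \<rho>. dist x y \<le> max r D)"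
    if "\<rho> \<in> S" "Suc k \<le> fcard \<rho>" "\<sigma> \<in> Poly_Mapping.keys (z \<rho>)" for \<rho> \<sigma>
  proof -
    consider "\<sigma> = \<rho>" | "\<sigma> \<in> Poly_Mapping.keys (bdry (s \<rho>))"
      using \<open>\<sigma> \<in> Poly_Mapping.keys (z \<rho>)\<close> unfolding z_def by (rule keys_addE) simp_all
    then show ?thesis
    proof cases
      case 1
      then show ?thesis using that diam by (auto simp: le_max_iff_disj)
    next
      case 2
      then obtain \<kappa> where \<kappa>: "\<kappa> \<in> Poly_Mapping.keys (s \<rho>)" "\<sigma> \<in> Poly_Mapping.keys (face_sum \<kappa>)"
        by (rule keys_linE)
      have "\<kappa> \<in> S" "fcard \<kappa> = Suc (fcard \<rho>)" "\<forall>x\<in>fset \<kappa>. \<forall>y\<in>fset \<rho>. dist x y \<le> r"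
        using s[OF that(1,2)] \<kappa>(1) by auto
      then show ?thesis using keys_face_sum_fcard[OF \<kappa>(2)] sub by (fastforce simp: le_max_iff_disj)
    qed
  qed
  have zb: "lin z (face_sum \<kappa>) = 0" if "\<kappa> \<in> S" "Suc (Suc k) \<le> fcard \<kappa>" for \<kappa>
    unfolding zfun by (rule bdry_defect[OF hs[OF that]])
  define pt :: "'v fset \<Rightarrow> 'v" where "pt \<sigma> = (SOME v. v |\<in>| \<sigma>)" for \<sigma>
  have pt: "pt \<sigma> |\<in>| \<sigma>" if "\<sigma> \<noteq> {||}" for \<sigma>
    unfolding pt_def using that by (metis ex_fin_conv someI)
  \<comment> \<open>\<open>m\<close> bounds the distance of \<open>\<tau>\<close> from the chosen
    vertex of \<open>\<sigma>\<close>, and \<open>D\<close> the distance of this vertex from the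
    rest of \<open>\<sigma>\<close>.\<close>
  define R where "R = m + D"
  define Near where "Near \<tau> = {\<sigma> \<in> S. \<forall>x\<in>fset \<sigma>. \<forall>y\<in>fset \<tau>. dist x y \<le> R}" for \<tau>
  \<comment> \<open>For fixed \<open>\<sigma>\<close> the coefficient of \<open>\<sigma>\<close> in
    \<open>z\<close> is a cocycle; \<open>co\<close> is its primitive obtained from the contraction
    that belongs to a vertex of \<open>\<sigma>\<close>.\<close>
  define co where "co \<tau> \<sigma> = Poly_Mapping.lookup (lin z (H (pt \<sigma>) \<tau>)) \<sigma>" for \<tau> \<sigma>
  define t where "t \<tau> = (\<Sum>\<sigma>\<in>Near \<tau>. Poly_Mapping.single \<sigma> (co \<tau> \<sigma>))" for \<tau>
  have co: "\<sigma> \<in> Near \<tau> \<and> fcard \<sigma> = Suc k" if \<tau>: "\<tau> \<in> S" "fcard \<tau> = k" and "co \<tau> \<sigma> \<noteq> 0" for \<sigma> \<tau>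
  proof -
    have "\<sigma> \<in> Poly_Mapping.keys (lin z (H (pt \<sigma>) \<tau>))" using that by (simp add: co_def in_keys_iff)
    then obtain \<rho> where \<rho>: "\<rho> \<in> Poly_Mapping.keys (H (pt \<sigma>) \<tau>)" "\<sigma> \<in> Poly_Mapping.keys (z \<rho>)"
      by (rule keys_linE)
    have \<rho>': "\<rho> \<in> S" "fcard \<rho> = Suc k" using H[OF \<tau>(1)] \<rho>(1) \<tau>(2) by auto
    have \<sigma>: "\<sigma> \<in> S" "fcard \<sigma> = Suc k" "\<And>x y. x |\<in>| \<sigma> \<Longrightarrow> y |\<in>| \<rho> \<Longrightarrow> dist x y \<le> max r D"
      using zkeys[OF \<rho>'(1) _ \<rho>(2)] \<rho>'(2) by auto
    have "\<sigma> \<noteq> {||}" "\<rho> \<noteq> {||}" using \<sigma>(2) \<rho>'(2) by auto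
    then obtain u where u: "u |\<in>| \<rho>" by auto
    have v: "pt \<sigma> |\<in>| \<sigma>" using pt \<open>\<sigma> \<noteq> {||}\<close> .
    have "\<tau> \<noteq> {||}" using \<tau>(2) k by auto
    \<comment> \<open>The simplex \<open>\<rho>\<close> in the contraction of \<open>\<tau>\<close>
      comes close to \<open>\<sigma>\<close>, so \<open>near\<close> forces \<open>\<tau>\<close>
      itself to be close.\<close>
    have "dist w (pt \<sigma>) \<le> m" if "w |\<in>| \<tau>" for w
      by (rule near[OF \<tau>(1) \<open>\<tau> \<noteq> {||}\<close> _ \<rho>(1) u _ that])
        (use sub[OF \<sigma>(1), of "{|pt \<sigma>|}"] v \<sigma>(3)[OF v u] in \<open>auto simp: dist_commute\<close>)
    moreover have "dist x (pt \<sigma>) \<le> D" if "x |\<in>| \<sigma>" for x using diam[OF \<sigma>(1) that v] .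
    ultimately have "dist x y \<le> R" if "x |\<in>| \<sigma>" "y |\<in>| \<tau>" for x y
      using that dist_triangle2[of x y "pt \<sigma>"] unfolding R_def by fastforce
    then show ?thesis using \<sigma> by (auto simp: Near_def)
  qed
  have tl: "Poly_Mapping.lookup (t \<tau>) \<sigma> = co \<tau> \<sigma>" if "\<tau> \<in> S" "fcard \<tau> = k" for \<tau> \<sigma>
  proof -
    have "finite (Near \<tau>)" unfolding Near_def using that k by (intro locfin) auto
    then have "Poly_Mapping.lookup (t \<tau>) \<sigma> = (if \<sigma> \<in> Near \<tau> then co \<tau> \<sigma> else 0)"
      by (simp add: t_def lookup_sum lookup_single when_def)
    moreover have "co \<tau> \<sigma> = 0" if "\<sigma> \<notin> Near \<tau>"
      using co[OF \<open>\<tau> \<in> S\<close> \<open>fcard \<tau> = k\<close>, of \<sigma>] that by blast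
    ultimately show ?thesis by simp
  qed
  define s' where "s' \<tau> = (if Suc k \<le> fcard \<tau> then s \<tau> else t \<tau>)" for \<tau>
  have A: "Poly_Mapping.keys (s' \<tau>) \<subseteq>
        {\<sigma> \<in> S. fcard \<sigma> = Suc (fcard \<tau>) \<and> (\<forall>x\<in>fset \<sigma>. \<forall>y\<in>fset \<tau>. dist x y \<le> max r R)}"
    if \<tau>: "\<tau> \<in> S" "k \<le> fcard \<tau>" for \<tau>
  proof (cases "Suc k \<le> fcard \<tau>")
    case True
    then show ?thesis using s[OF \<tau>(1) True] by (auto simp: s'_def le_max_iff_disj)
  next
    case False
    then have "fcard \<tau> = k" using \<tau> by simp
    then show ?thesis using tl[OF \<tau>(1)] co[OF \<tau>(1)] False
      by (auto simp: s'_def in_keys_iff Near_def le_max_iff_disj)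
  qed
  have B: "bdry (s' \<rho>) + lin s' (face_sum \<rho>) = bas \<rho>" if \<rho>: "\<rho> \<in> S" "Suc k \<le> fcard \<rho>" for \<rho>
  proof (cases "Suc (Suc k) \<le> fcard \<rho>")
    case True
    have "lin s' (face_sum \<rho>) = lin s (face_sum \<rho>)"
      by (rule lin_cong) (use True keys_face_sum_fcard in \<open>fastforce simp: s'_def\<close>)
    then show ?thesis using hs[OF \<rho>(1) True] True by (simp add: s'_def)
  next
    case False
    then have c: "fcard \<rho> = Suc k" using \<rho> by simp
    have face: "\<tau> \<in> S \<and> fcard \<tau> = k" if "\<tau> \<in> Poly_Mapping.keys (face_sum \<rho>)" for \<tau>
      using keys_face_sum_fcard[OF that] sub[OF \<rho>(1)] c by auto
    have "lin s' (face_sum \<rho>) = lin t (face_sum \<rho>)"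
      by (rule lin_cong) (use face in \<open>fastforce simp: s'_def\<close>)
    also have "\<dots> = z \<rho>"
    proof (rule poly_mapping_eqI)
      fix \<sigma>
      let ?H = "H (pt \<sigma>)"
      have "Poly_Mapping.lookup (lin t (face_sum \<rho>)) \<sigma> = (\<Sum>\<tau>\<in>Poly_Mapping.keys (face_sum \<rho>). co \<tau> \<sigma>)"
        unfolding lin_def lookup_sum using face by (intro sum.cong) (auto simp: tl)
      also have "\<dots> = Poly_Mapping.lookup (lin (\<lambda>\<tau>. lin z (?H \<tau>)) (face_sum \<rho>)) \<sigma>"
        unfolding co_def lin_def[of _ "face_sum \<rho>"] lookup_sum ..
      also have "lin (\<lambda>\<tau>. lin z (?H \<tau>)) (face_sum \<rho>) = lin z (lin ?H (face_sum \<rho>))"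
        by (simp add: lin_lin)
      \<comment> \<open>The homotopy formula turns the contraction of the boundary into
        \<open>\<rho>\<close> plus a boundary, and \<open>z\<close> vanishes on boundaries.\<close>
      also have "lin ?H (face_sum \<rho>) = bas \<rho> + bdry (?H \<rho>)"
        using hH[OF \<rho>(1), of "pt \<sigma>"] by (metis add.commute chain_add_cancel)
      also have "lin z (bas \<rho> + bdry (?H \<rho>)) = z \<rho> + lin (\<lambda>\<kappa>. lin z (face_sum \<kappa>)) (?H \<rho>)"
        by (simp add: lin_add lin_lin)
      also have "lin (\<lambda>\<kappa>. lin z (face_sum \<kappa>)) (?H \<rho>) = lin (\<lambda>\<kappa>. 0) (?H \<rho>)"
        by (rule lin_cong) (use H[OF \<rho>(1), of "pt \<sigma>"] c in \<open>auto intro!: zb\<close>)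
      finally show "Poly_Mapping.lookup (lin t (face_sum \<rho>)) \<sigma> = Poly_Mapping.lookup (z \<rho>) \<sigma>" by simp
    qed
    finally show ?thesis using \<rho> by (simp add: s'_def z_def add.left_commute)
  qed
  from A B show ?thesis by blast
qed

text \<open>Above the dimension the zero operator has the required properties, and
  \<open>exists_local_contraction_step\<close> lowers the degree until only the empty simplex is
  left out. The defect of a vertex is then computed with the contraction belonging to a vertex
  \<open>v\<close> that occurs in it: the surviving term is the contraction of the empty simplex,
  which by \<open>contr\<close> stays away from \<open>v\<close>. So the defect is 0 and the vertex
  is a boundary, although its own boundary is the empty simplex.\<close>

lemma no_local_contractions:
  fixes S :: "'v::metric_space fset set" and D :: real and N :: nat
  assumes locfin: "\<And>\<tau> R. \<tau> \<in> S \<Longrightarrow> \<tau> \<noteq> {||} \<Longrightarrow> finite {\<sigma> \<in> S. \<forall>x\<in>fset \<sigma>. \<forall>y\<in>fset \<tau>. dist x y \<le> R}"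
    and sub: "\<And>\<sigma> \<tau>. \<sigma> \<in> S \<Longrightarrow> \<tau> |\<subseteq>| \<sigma> \<Longrightarrow> \<tau> \<in> S"
    and diam: "\<And>\<sigma> x y. \<sigma> \<in> S \<Longrightarrow> x |\<in>| \<sigma> \<Longrightarrow> y |\<in>| \<sigma> \<Longrightarrow> dist x y \<le> D"
    and dim: "\<And>\<sigma>. \<sigma> \<in> S \<Longrightarrow> fcard \<sigma> \<le> N"
    and ne: "{|w|} \<in> S"
    and contr: "\<And>n::real. \<exists>m::real. \<forall>v. {|v|} \<in> S \<longrightarrow> (\<exists>H.
      (\<forall>\<sigma>. \<sigma> \<in> S \<longrightarrow> Poly_Mapping.keys (H \<sigma>) \<subseteq> {\<rho> \<in> S. fcard \<rho> = Suc (fcard \<sigma>)} \<and>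
         bdry (H \<sigma>) + lin H (face_sum \<sigma>) = bas \<sigma>) \<and>
      (\<forall>\<sigma> \<rho> u w. \<sigma> \<in> S \<longrightarrow> \<rho> \<in> Poly_Mapping.keys (H \<sigma>) \<longrightarrow> u |\<in>| \<rho> \<longrightarrow> dist u v \<le> n \<longrightarrow>
         \<sigma> \<noteq> {||} \<and> (w |\<in>| \<sigma> \<longrightarrow> dist w v \<le> m)))"
  shows False
proof -
  define Q where "Q n m v H \<longleftrightarrow>
      (\<forall>\<sigma>. \<sigma> \<in> S \<longrightarrow> Poly_Mapping.keys (H \<sigma>) \<subseteq> {\<rho> \<in> S. fcard \<rho> = Suc (fcard \<sigma>)} \<and>
         bdry (H \<sigma>) + lin H (face_sum \<sigma>) = bas \<sigma>) \<and>
      (\<forall>\<sigma> \<rho> u w. \<sigma> \<in> S \<longrightarrow> \<rho> \<in> Poly_Mapping.keys (H \<sigma>) \<longrightarrow> u |\<in>| \<rho> \<longrightarrow> dist u v \<le> n \<longrightarrow>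
         \<sigma> \<noteq> {||} \<and> (w |\<in>| \<sigma> \<longrightarrow> dist w v \<le> m))" for n m :: real and v H
  have Q: "Poly_Mapping.keys (H \<sigma>) \<subseteq> {\<rho> \<in> S. fcard \<rho> = Suc (fcard \<sigma>)}"
      "bdry (H \<sigma>) + lin H (face_sum \<sigma>) = bas \<sigma>"
      "\<And>\<rho> u w. \<rho> \<in> Poly_Mapping.keys (H \<sigma>) \<Longrightarrow> u |\<in>| \<rho> \<Longrightarrow> dist u v \<le> n \<Longrightarrow>
         \<sigma> \<noteq> {||} \<and> (w |\<in>| \<sigma> \<longrightarrow> dist w v \<le> m)"
    if "Q n m v H" "\<sigma> \<in> S" for n m v H \<sigma>
    using that unfolding Q_def by simp_all
  have H: "\<exists>H m. \<forall>v. {|v|} \<in> S \<longrightarrow> Q n m v (H v)" for n :: real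
  proof -
    have "\<exists>m. \<forall>v. {|v|} \<in> S \<longrightarrow> (\<exists>H. Q n m v H)" unfolding Q_def by (rule contr)
    then obtain m where m: "\<And>v. {|v|} \<in> S \<Longrightarrow> \<exists>H. Q n m v H" by auto
    have "Q n m v (SOME H. Q n m v H)" if "{|v|} \<in> S" for v
      by (rule someI_ex[OF m[OF that]])
    then show ?thesis by (intro exI[of _ "\<lambda>v. SOME H. Q n m v H"] exI[of _ m]) simp
  qed
  have "\<exists>s r. (\<forall>\<tau>. \<tau> \<in> S \<longrightarrow> Suc N - i \<le> fcard \<tau> \<longrightarrow> Poly_Mapping.keys (s \<tau>) \<subseteq>
        {\<sigma> \<in> S. fcard \<sigma> = Suc (fcard \<tau>) \<and> (\<forall>x\<in>fset \<sigma>. \<forall>y\<in>fset \<tau>. dist x y \<le> r)})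
     \<and> (\<forall>\<rho>. \<rho> \<in> S \<longrightarrow> Suc (Suc N - i) \<le> fcard \<rho> \<longrightarrow> bdry (s \<rho>) + lin s (face_sum \<rho>) = bas \<rho>)"
    (is "?P i") if "i \<le> N" for i
    using that
  proof (induction i)
    case 0
    \<comment> \<open>No simplex has more than \<open>N\<close> vertices, so both conditions are
      vacuous.\<close>
    show ?case by (intro exI[of _ "\<lambda>_. 0"]) (use dim in \<open>fastforce\<close>)
  next
    case (Suc i)
    then have "?P i" by simp
    then obtain s r where s: "\<And>\<tau>. \<tau> \<in> S \<Longrightarrow> Suc N - i \<le> fcard \<tau> \<Longrightarrow> Poly_Mapping.keys (s \<tau>) \<subseteq>
        {\<sigma> \<in> S. fcard \<sigma> = Suc (fcard \<tau>) \<and> (\<forall>x\<in>fset \<sigma>. \<forall>y\<in>fset \<tau>. dist x y \<le> r)}"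
      "\<And>\<rho>. \<rho> \<in> S \<Longrightarrow> Suc (Suc N - i) \<le> fcard \<rho> \<Longrightarrow> bdry (s \<rho>) + lin s (face_sum \<rho>) = bas \<rho>"
      by (elim exE conjE) auto
    obtain H0 m where H0: "\<And>v. {|v|} \<in> S \<Longrightarrow> Q (max r D) m v (H0 v)"
      using H[of "max r D"] by auto
    \<comment> \<open>The induction step wants an operator for every point \<open>v\<close>; for
      points that are not vertices the one of \<open>w\<close> serves.\<close>
    define H where "H v = H0 (if {|v|} \<in> S then v else w)" for v
    have e: "Suc N - i = Suc (Suc N - Suc i)" "1 \<le> Suc N - Suc i" using Suc.prems by auto
    show ?case
    proof (rule exists_local_contraction_step[where D = D and s = s and r = r and H = H and m = m])
      show "1 \<le> Suc N - Suc i" by (fact e)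
      show "dist w v \<le> m" if "\<sigma> \<in> S" "{|v|} \<in> S" "\<rho> \<in> Poly_Mapping.keys (H v \<sigma>)" "u |\<in>| \<rho>"
        "dist u v \<le> max r D" "w |\<in>| \<sigma>" for v \<sigma> \<rho> u w
        using Q(3)[OF H0[OF that(2)] that(1), of \<rho> u w] that by (simp add: H_def)
      show "Poly_Mapping.keys (H v \<sigma>) \<subseteq> {\<rho> \<in> S. fcard \<rho> = Suc (fcard \<sigma>)}" if "\<sigma> \<in> S" for v \<sigma>
        using Q(1)[OF H0 that] ne by (simp add: H_def)
      show "bdry (H v \<sigma>) + lin (H v) (face_sum \<sigma>) = bas \<sigma>" if "\<sigma> \<in> S" for v \<sigma>
        using Q(2)[OF H0 that] ne by (simp add: H_def)
    qed (use locfin sub diam s[unfolded e(1)] in auto)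
  qed
  from this[of N] obtain s r where s: "\<And>\<tau>. \<tau> \<in> S \<Longrightarrow> Suc 0 \<le> fcard \<tau> \<Longrightarrow> Poly_Mapping.keys (s \<tau>) \<subseteq>
        {\<sigma> \<in> S. fcard \<sigma> = Suc (fcard \<tau>) \<and> (\<forall>x\<in>fset \<sigma>. \<forall>y\<in>fset \<tau>. dist x y \<le> r)}"
      "\<And>\<rho>. \<rho> \<in> S \<Longrightarrow> Suc (Suc 0) \<le> fcard \<rho> \<Longrightarrow> bdry (s \<rho>) + lin s (face_sum \<rho>) = bas \<rho>"
    by auto
  obtain H m where H0: "\<And>v. {|v|} \<in> S \<Longrightarrow> Q (max r D) m v (H v)"
    using H[of "max r D"] by auto
  define z where "z \<rho> = bas \<rho> + bdry (s \<rho>)" for \<rho>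
  have zfun: "z = (\<lambda>\<rho>. bas \<rho> + bdry (s \<rho>))" by (simp add: z_def fun_eq_iff)
  have zb: "lin z (face_sum \<kappa>) = 0" if "\<kappa> \<in> S" "Suc (Suc 0) \<le> fcard \<kappa>" for \<kappa>
    unfolding zfun by (rule bdry_defect[OF s(2)[OF that]])
  have zkeys: "fcard \<sigma> = Suc 0 \<and> (\<exists>u. u |\<in>| \<rho> \<and> (\<exists>v. v |\<in>| \<sigma> \<and> {|v|} \<in> S \<and> dist u v \<le> max r D))"
    if "\<rho> \<in> S" "fcard \<rho> = Suc 0" "\<sigma> \<in> Poly_Mapping.keys (z \<rho>)" for \<rho> \<sigma>
  proof -
    have "\<rho> \<noteq> {||}" using that by auto
    then obtain u where u: "u |\<in>| \<rho>" by auto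
    consider "\<sigma> = \<rho>" | "\<sigma> \<in> Poly_Mapping.keys (bdry (s \<rho>))"
      using \<open>\<sigma> \<in> Poly_Mapping.keys (z \<rho>)\<close> unfolding z_def by (rule keys_addE) simp_all
    then show ?thesis
    proof cases
      case 1
      then show ?thesis using that u diam[OF that(1) u u] sub[OF that(1), of "{|u|}"]
        by (intro conjI exI[of _ u]) (auto simp: le_max_iff_disj)
    next
      case 2
      then obtain \<kappa> where \<kappa>: "\<kappa> \<in> Poly_Mapping.keys (s \<rho>)" "\<sigma> \<in> Poly_Mapping.keys (face_sum \<kappa>)"
        by (rule keys_linE)
      have k: "\<kappa> \<in> S" "fcard \<kappa> = Suc (fcard \<rho>)" "\<forall>x\<in>fset \<kappa>. \<forall>y\<in>fset \<rho>. dist x y \<le> r"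
        using s(1)[OF that(1)] that(2) \<kappa>(1) by auto
      have f: "\<sigma> |\<subseteq>| \<kappa>" "fcard \<kappa> = Suc (fcard \<sigma>)" using keys_face_sum_fcard[OF \<kappa>(2)] by auto
      then have "\<sigma> \<noteq> {||}" using k that by auto
      then obtain v where v: "v |\<in>| \<sigma>" by auto
      have "dist v u \<le> r" "{|v|} \<in> S" using k v u f sub[OF k(1), of "{|v|}"] by auto
      then show ?thesis using that f k u v by (auto simp: dist_commute le_max_iff_disj)
    qed
  qed
  have "z {|w|} = 0"
  proof (rule ccontr)
    assume "z {|w|} \<noteq> 0"
    then obtain \<sigma> where \<sigma>: "\<sigma> \<in> Poly_Mapping.keys (z {|w|})" by (metis ex_in_conv keys_eq_empty)
    have c1: "fcard {|w|} = Suc 0" by (simp add: fcard_finsert_disjoint)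
    obtain v where v: "{|v|} \<in> S" "v |\<in>| \<sigma>" using zkeys[OF ne c1 \<sigma>] by (elim conjE exE) simp
    have e: "{||} \<in> S" using sub[OF ne] by auto
    have fw: "face_sum {|w|} = bas {||}" by (simp add: face_sum_def)
    \<comment> \<open>In the augmented complex the boundary of a vertex is the empty simplex, hence
      the additional term \<open>H v {||}\<close>.\<close>
    have "bas {|w|} = bdry (H v {|w|}) + H v {||}"
      using Q(2)[OF H0[OF v(1)] ne] by (simp add: fw)
    then have "z {|w|} = lin z (bdry (H v {|w|}) + H v {||})" by (simp only: lin_bas[of z "{|w|}", symmetric])
    also have "\<dots> = lin (\<lambda>\<kappa>. lin z (face_sum \<kappa>)) (H v {|w|}) + lin z (H v {||})"
      by (simp add: lin_add lin_lin)
    also have "lin (\<lambda>\<kappa>. lin z (face_sum \<kappa>)) (H v {|w|}) = lin (\<lambda>\<kappa>. 0) (H v {|w|})"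
      by (rule lin_cong) (use Q(1)[OF H0[OF v(1)] ne] c1 in \<open>auto intro!: zb\<close>)
    finally have "\<sigma> \<in> Poly_Mapping.keys (lin z (H v {||}))" using \<sigma> by simp
    then obtain \<rho> where \<rho>: "\<rho> \<in> Poly_Mapping.keys (H v {||})" "\<sigma> \<in> Poly_Mapping.keys (z \<rho>)"
      by (rule keys_linE)
    have \<rho>': "\<rho> \<in> S" "fcard \<rho> = Suc 0" using Q(1)[OF H0[OF v(1)] e] \<rho>(1) by auto
    have \<sigma>1: "\<sigma> = {|v|}"
    proof -
      have "fcard \<sigma> = Suc 0" using zkeys[OF ne c1 \<sigma>] by (rule conjunct1)
      then show ?thesis using v(2) fcard_seteq[of "{|v|}" \<sigma>] by (simp add: fcard_finsert_disjoint)
    qed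
    obtain u v' where "u |\<in>| \<rho>" "v' |\<in>| \<sigma>" "dist u v' \<le> max r D" using zkeys[OF \<rho>' \<rho>(2)] by (elim conjE exE) simp
    then show False using Q(3)[OF H0[OF v(1)] e \<rho>(1)] \<sigma>1 by auto
  qed
  then have "bas {|w|} = bdry (s {|w|})" by (simp add: z_def chain_add_eq_0_iff)
  then have "bdry (bas {|w|}) = 0" by simp
  then show False by (simp add: face_sum_def)
qed

section \<open>Rips complexes of a net and their geodesic contraction\<close>

lemma fcard_finsert_new: "x |\<notin>| \<rho> \<Longrightarrow> fcard (finsert x \<rho>) = Suc (fcard \<rho>)"
  by (rule fcard_finsert_disjoint)

text \<open>The empty simplex always belongs to the set, which makes the complex augmented.\<close>

definition rips :: "real \<Rightarrow> 'v::metric_space set \<Rightarrow> 'v fset set" where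
  "rips D V = {\<sigma>. fset \<sigma> \<subseteq> V \<and> (\<forall>x. x |\<in>| \<sigma> \<longrightarrow> (\<forall>y. y |\<in>| \<sigma> \<longrightarrow> dist x y \<le> D))}"

lemma rips_mono: "\<sigma> \<in> rips D V \<Longrightarrow> \<tau> |\<subseteq>| \<sigma> \<Longrightarrow> \<tau> \<in> rips D V"
  unfolding rips_def by (auto simp: less_eq_fset.rep_eq)

text \<open>The vertices of a simplex of the subdivided complex belong to a flag of faces of \<open>\<sigma>\<close>; with
  \<open>e\<close> the flag may start with a face of \<open>\<sigma>\<close> that is kept as it is.\<close>

definition flag_carrier :: "bool \<Rightarrow> ('v fset \<Rightarrow> 'v set) \<Rightarrow> 'v fset \<Rightarrow> 'v fset set" where
  "flag_carrier e B \<sigma> = {\<rho>. \<exists>\<mu> \<Phi>. (e \<or> \<mu> = {||}) \<and> \<mu> |\<subseteq>| \<sigma> \<and>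
     (\<forall>\<tau>\<in>\<Phi>. \<tau> |\<subseteq>| \<sigma> \<and> \<tau> \<noteq> {||} \<and> \<mu> |\<subseteq>| \<tau>) \<and> (\<forall>\<tau>\<in>\<Phi>. \<forall>\<tau>'\<in>\<Phi>. \<tau> |\<subseteq>| \<tau>' \<or> \<tau>' |\<subseteq>| \<tau>) \<and>
     fset \<rho> \<subseteq> fset \<mu> \<union> (\<Union>\<tau>\<in>\<Phi>. B \<tau>)}"

lemma flag_carrierI:
  assumes "e \<or> \<mu> = {||}" "\<mu> |\<subseteq>| \<sigma>" "\<And>\<tau>. \<tau> \<in> \<Phi> \<Longrightarrow> \<tau> |\<subseteq>| \<sigma> \<and> \<tau> \<noteq> {||} \<and> \<mu> |\<subseteq>| \<tau>"
    "\<And>\<tau> \<tau>'. \<tau> \<in> \<Phi> \<Longrightarrow> \<tau>' \<in> \<Phi> \<Longrightarrow> \<tau> |\<subseteq>| \<tau>' \<or> \<tau>' |\<subseteq>| \<tau>" "fset \<rho> \<subseteq> fset \<mu> \<union> (\<Union>\<tau>\<in>\<Phi>. B \<tau>)"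
  shows "\<rho> \<in> flag_carrier e B \<sigma>"
  unfolding flag_carrier_def mem_Collect_eq
  by (rule exI[of _ \<mu>], rule exI[of _ \<Phi>]) (intro conjI ballI; use assms in simp)

lemma flag_carrierE:
  assumes "\<rho> \<in> flag_carrier e B \<sigma>"
  obtains \<mu> \<Phi> where "e \<or> \<mu> = {||}" "\<mu> |\<subseteq>| \<sigma>" "\<And>\<tau>. \<tau> \<in> \<Phi> \<Longrightarrow> \<tau> |\<subseteq>| \<sigma> \<and> \<tau> \<noteq> {||} \<and> \<mu> |\<subseteq>| \<tau>"
    "\<And>\<tau> \<tau>'. \<tau> \<in> \<Phi> \<Longrightarrow> \<tau>' \<in> \<Phi> \<Longrightarrow> \<tau> |\<subseteq>| \<tau>' \<or> \<tau>' |\<subseteq>| \<tau>" "fset \<rho> \<subseteq> fset \<mu> \<union> (\<Union>\<tau>\<in>\<Phi>. B \<tau>)"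
proof -
  from assms obtain \<mu> \<Phi> where "e \<or> \<mu> = {||}" "\<mu> |\<subseteq>| \<sigma>" "\<forall>\<tau>\<in>\<Phi>. \<tau> |\<subseteq>| \<sigma> \<and> \<tau> \<noteq> {||} \<and> \<mu> |\<subseteq>| \<tau>"
    "\<forall>\<tau>\<in>\<Phi>. \<forall>\<tau>'\<in>\<Phi>. \<tau> |\<subseteq>| \<tau>' \<or> \<tau>' |\<subseteq>| \<tau>" "fset \<rho> \<subseteq> fset \<mu> \<union> (\<Union>\<tau>\<in>\<Phi>. B \<tau>)"
    unfolding flag_carrier_def mem_Collect_eq by (elim exE conjE)
  then show thesis by (intro that[of \<mu> \<Phi>]) simp_all
qed

text \<open>The new vertex is attributed to \<open>\<sigma>\<close>, which lies above all faces of
  the flag, so the flag stays totally ordered.\<close>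

lemma flag_carrier_finsert:
  assumes "\<rho> \<in> flag_carrier e B \<tau>" "\<tau> |\<subseteq>| \<sigma>" "\<sigma> \<noteq> {||}" "x \<in> B \<sigma>"
  shows "finsert x \<rho> \<in> flag_carrier e B \<sigma>"
  using assms(1)
proof (rule flag_carrierE)
  fix \<mu> \<Phi>
  assume *: "e \<or> \<mu> = {||}" "\<mu> |\<subseteq>| \<tau>" "\<And>\<kappa>. \<kappa> \<in> \<Phi> \<Longrightarrow> \<kappa> |\<subseteq>| \<tau> \<and> \<kappa> \<noteq> {||} \<and> \<mu> |\<subseteq>| \<kappa>"
    "\<And>\<kappa> \<kappa>'. \<kappa> \<in> \<Phi> \<Longrightarrow> \<kappa>' \<in> \<Phi> \<Longrightarrow> \<kappa> |\<subseteq>| \<kappa>' \<or> \<kappa>' |\<subseteq>| \<kappa>" "fset \<rho> \<subseteq> fset \<mu> \<union> (\<Union>\<tau>\<in>\<Phi>. B \<tau>)"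
  have sub: "\<kappa> |\<subseteq>| \<sigma>" if "\<kappa> \<in> \<Phi>" for \<kappa> using *(3)[OF that] assms(2) by (meson order_trans)
  show ?thesis
  proof (rule flag_carrierI[where \<mu> = \<mu> and \<Phi> = "insert \<sigma> \<Phi>"])
    show "\<mu> |\<subseteq>| \<sigma>" using *(2) assms(2) by (rule order_trans)
    show "\<kappa> |\<subseteq>| \<sigma> \<and> \<kappa> \<noteq> {||} \<and> \<mu> |\<subseteq>| \<kappa>" if "\<kappa> \<in> insert \<sigma> \<Phi>" for \<kappa>
      using that *(3) sub \<open>\<mu> |\<subseteq>| \<sigma>\<close> assms(3) by auto
    show "\<kappa> |\<subseteq>| \<kappa>' \<or> \<kappa>' |\<subseteq>| \<kappa>" if "\<kappa> \<in> insert \<sigma> \<Phi>" "\<kappa>' \<in> insert \<sigma> \<Phi>" for \<kappa> \<kappa>'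
      using that *(4) sub by auto
    show "fset (finsert x \<rho>) \<subseteq> fset \<mu> \<union> (\<Union>\<tau>\<in>insert \<sigma> \<Phi>. B \<tau>)" using *(5) assms(4) by auto
  qed (use * in auto)
qed

lemma flag_carrier_empty: "{||} \<in> flag_carrier e B \<sigma>"
  by (rule flag_carrierI[where \<mu> = "{||}" and \<Phi> = "{}"]) auto

lemma flag_carrier_self: "\<sigma> \<in> flag_carrier True B \<sigma>"
  by (rule flag_carrierI[where \<mu> = \<sigma> and \<Phi> = "{}"]) auto

lemma flag_carrier_mono:
  assumes "\<rho> \<in> flag_carrier e B \<sigma>" "e \<Longrightarrow> e'" "\<And>\<tau>. B \<tau> \<subseteq> B' \<tau>"
  shows "\<rho> \<in> flag_carrier e' B' \<sigma>"
  using assms(1)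
proof (rule flag_carrierE)
  fix \<mu> \<Phi>
  assume *: "e \<or> \<mu> = {||}" "\<mu> |\<subseteq>| \<sigma>" "\<And>\<kappa>. \<kappa> \<in> \<Phi> \<Longrightarrow> \<kappa> |\<subseteq>| \<sigma> \<and> \<kappa> \<noteq> {||} \<and> \<mu> |\<subseteq>| \<kappa>"
    "\<And>\<kappa> \<kappa>'. \<kappa> \<in> \<Phi> \<Longrightarrow> \<kappa>' \<in> \<Phi> \<Longrightarrow> \<kappa> |\<subseteq>| \<kappa>' \<or> \<kappa>' |\<subseteq>| \<kappa>" "fset \<rho> \<subseteq> fset \<mu> \<union> (\<Union>\<tau>\<in>\<Phi>. B \<tau>)"
  show ?thesis
  proof (rule flag_carrierI[where \<mu> = \<mu> and \<Phi> = \<Phi>])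
    show "fset \<rho> \<subseteq> fset \<mu> \<union> (\<Union>\<tau>\<in>\<Phi>. B' \<tau>)" using *(5) assms(3) by blast
  qed (use * assms(2) in auto)
qed

lemma flag_carrier_vertex:
  assumes "\<rho> \<in> flag_carrier e B \<sigma>" "u |\<in>| \<rho>"
  obtains "e" "u |\<in>| \<sigma>" | \<tau> where "\<tau> |\<subseteq>| \<sigma>" "\<tau> \<noteq> {||}" "u \<in> B \<tau>"
  using assms(1)
proof (rule flag_carrierE)
  fix \<mu> \<Phi>
  assume *: "e \<or> \<mu> = {||}" "\<mu> |\<subseteq>| \<sigma>" "\<And>\<kappa>. \<kappa> \<in> \<Phi> \<Longrightarrow> \<kappa> |\<subseteq>| \<sigma> \<and> \<kappa> \<noteq> {||} \<and> \<mu> |\<subseteq>| \<kappa>"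
    "fset \<rho> \<subseteq> fset \<mu> \<union> (\<Union>\<tau>\<in>\<Phi>. B \<tau>)"
  have "u |\<in>| \<mu> \<or> (\<exists>\<tau>\<in>\<Phi>. u \<in> B \<tau>)" using *(4) assms(2) by auto
  then show thesis
  proof
    assume "u |\<in>| \<mu>"
    then show thesis using that(1) *(1,2) by auto
  next
    assume "\<exists>\<tau>\<in>\<Phi>. u \<in> B \<tau>"
    then show thesis using that(2) *(3) by auto
  qed
qed

text \<open>Two vertices of a carried simplex belong to comparable faces. Hence the diameter bound
  has to be checked only between points attributed to a face and to a face of that face, which is
  the case in which circumcentres are known to be close.\<close>

lemma flag_carrier_rips:
  assumes \<rho>: "\<rho> \<in> flag_carrier e B \<sigma>" and \<sigma>: "\<sigma> \<in> rips D V"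
    and V: "\<And>\<tau>. B \<tau> \<subseteq> V"
    and B: "\<And>\<tau> \<tau>' x y. \<tau> |\<subseteq>| \<tau>' \<Longrightarrow> \<tau>' |\<subseteq>| \<sigma> \<Longrightarrow> \<tau> \<noteq> {||} \<Longrightarrow> x \<in> B \<tau> \<Longrightarrow> y \<in> B \<tau>' \<Longrightarrow> dist x y \<le> D"
    and e: "\<And>v \<tau> x. e \<Longrightarrow> \<tau> |\<subseteq>| \<sigma> \<Longrightarrow> v |\<in>| \<tau> \<Longrightarrow> x \<in> B \<tau> \<Longrightarrow> dist v x \<le> D"
  shows "\<rho> \<in> rips D V"
  using \<rho>
proof (rule flag_carrierE)
  fix \<mu> \<Phi>
  assume *: "e \<or> \<mu> = {||}" "\<mu> |\<subseteq>| \<sigma>" "\<And>\<kappa>. \<kappa> \<in> \<Phi> \<Longrightarrow> \<kappa> |\<subseteq>| \<sigma> \<and> \<kappa> \<noteq> {||} \<and> \<mu> |\<subseteq>| \<kappa>"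
    "\<And>\<kappa> \<kappa>'. \<kappa> \<in> \<Phi> \<Longrightarrow> \<kappa>' \<in> \<Phi> \<Longrightarrow> \<kappa> |\<subseteq>| \<kappa>' \<or> \<kappa>' |\<subseteq>| \<kappa>" "fset \<rho> \<subseteq> fset \<mu> \<union> (\<Union>\<tau>\<in>\<Phi>. B \<tau>)"
  have s: "fset \<sigma> \<subseteq> V" "\<And>x y. x |\<in>| \<sigma> \<Longrightarrow> y |\<in>| \<sigma> \<Longrightarrow> dist x y \<le> D"
    using \<sigma> by (auto simp: rips_def)
  have t0: "x |\<in>| \<sigma>" "e" if "x |\<in>| \<mu>" for x using *(1,2) that by auto
  have m: "dist x y \<le> D" if "x |\<in>| \<mu>" "y \<in> B \<kappa>" "\<kappa> \<in> \<Phi>" for x y \<kappa>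
    by (rule e[OF t0(2)[OF that(1)], of \<kappa>]) (use *(3)[OF that(3)] that in auto)
  have b: "dist x y \<le> D" if xy: "x \<in> B \<kappa>" "\<kappa> \<in> \<Phi>" "y \<in> B \<kappa>'" "\<kappa>' \<in> \<Phi>" for x y \<kappa> \<kappa>'
    using *(4)[OF xy(2,4)]
  proof
    assume "\<kappa> |\<subseteq>| \<kappa>'"
    then show ?thesis by (rule B) (use *(3) xy in auto)
  next
    assume "\<kappa>' |\<subseteq>| \<kappa>"
    then have "dist y x \<le> D" by (rule B) (use *(3) xy in auto)
    then show ?thesis by (simp add: dist_commute)
  qed
  have v: "x |\<in>| \<mu> \<or> (\<exists>\<kappa>\<in>\<Phi>. x \<in> B \<kappa>)" if "x |\<in>| \<rho>" for x using *(5) that by auto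
  show ?thesis unfolding rips_def mem_Collect_eq
  proof (intro conjI allI impI)
    show "fset \<rho> \<subseteq> V" using v t0(1) s(1) V by blast
    fix x y assume "x |\<in>| \<rho>" "y |\<in>| \<rho>"
    from v[OF this(1)] v[OF this(2)] show "dist x y \<le> D"
      using m[of x y] m[of y x] b[of x _ y] s(2)[OF t0(1) t0(1)] by (auto simp: dist_commute)
  qed
qed

text \<open>Circumcentres of sets of diameter at most \<open>30\<close> have distance at most
  \<open>30 * sqrt (4/7) < 23\<close> from the points and at most \<open>30 * sqrt (16/21) < 27\<close> from the
  circumcentres of subsets. Two applications of the rounding map \<open>rd\<close> and one step along the
  geodesics use up the remaining \<open>3\<close>.\<close>

locale cat0_net = cat0_space ty for ty :: "'a::metric_space itself" +
  fixes V :: "'a set" and rd :: "'a \<Rightarrow> 'a" and ctr :: "'a fset \<Rightarrow> 'a"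
  assumes rd: "rd x \<in> V" "dist (rd x) x \<le> 1"
    and ctr: "\<sigma> \<in> rips 30 V \<Longrightarrow> v |\<in>| \<sigma> \<Longrightarrow> dist v (ctr \<sigma>) \<le> 23"
    and ctr_ctr: "\<sigma> \<in> rips 30 V \<Longrightarrow> \<tau> |\<subseteq>| \<sigma> \<Longrightarrow> \<tau> \<noteq> {||} \<Longrightarrow> dist (ctr \<tau>) (ctr \<sigma>) \<le> 27"
begin

text \<open>The geodesic contraction to \<open>p\<close> in discrete time, run backwards: at time 0
  every apex is \<open>rd p\<close>, and once \<open>j\<close> exceeds the distance of the
  circumcentre from \<open>p\<close> it is the rounded circumcentre.\<close>

definition apex :: "'a \<Rightarrow> nat \<Rightarrow> 'a fset \<Rightarrow> 'a" where
  "apex p j \<sigma> = rd (Xi p (ctr \<sigma>) (real j))"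

definition push :: "'a \<Rightarrow> nat \<Rightarrow> 'a fset \<Rightarrow> 'a fset chain" where
  "push p j = cone_subdivision (apex p j)"

definition push_step :: "'a \<Rightarrow> nat \<Rightarrow> 'a fset \<Rightarrow> 'a fset chain" where
  "push_step p j = cone_homotopy (apex p j) (\<lambda>\<sigma>. push p j \<sigma> + push p (Suc j) \<sigma>)"

definition push_end :: "'a \<Rightarrow> nat \<Rightarrow> 'a fset \<Rightarrow> 'a fset chain" where
  "push_end p j = cone_homotopy (apex p j) (\<lambda>\<sigma>. push p j \<sigma> + bas \<sigma>)"

text \<open>A null homotopy of \<open>push p j\<close>: at time 0 all vertices are
  \<open>rd p\<close> and cones with this apex suffice, and each later time adds the homotopy
  between consecutive subdivisions.\<close>

primrec push_upto :: "'a \<Rightarrow> nat \<Rightarrow> 'a fset \<Rightarrow> 'a fset chain" where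
  "push_upto p 0 \<sigma> = cone_homotopy (\<lambda>_. rd p) (push p 0) \<sigma>"
| "push_upto p (Suc j) \<sigma> = push_upto p j \<sigma> + push_step p j \<sigma>"

text \<open>The sum over all vertices is a crude maximum that is monotone in \<open>\<sigma>\<close>
  and defined for the empty simplex; 23 bounds the distance of the circumcentre from a
  vertex.\<close>

definition range_bound :: "'a \<Rightarrow> 'a fset \<Rightarrow> nat" where
  "range_bound p \<sigma> = nat \<lceil>(\<Sum>w\<in>fset \<sigma>. dist p w) + 23\<rceil>"

text \<open>The null homotopy of the subdivision at a late time, followed by the homotopy from this
  subdivision to the identity. The time depends on \<open>\<sigma>\<close> because simplices far
  from \<open>p\<close> need longer.\<close>

definition contraction :: "'a \<Rightarrow> 'a fset \<Rightarrow> 'a fset chain" where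
  "contraction p \<sigma> = push_upto p (range_bound p \<sigma>) \<sigma> + push_end p (range_bound p \<sigma>) \<sigma>"

lemma bdry_push: "bdry (push p j \<sigma>) = lin (push p j) (face_sum \<sigma>)"
  unfolding push_def by (rule bdry_cone_subdivision)

lemma bdry_push_step:
  "bdry (push_step p j \<sigma>) + lin (push_step p j) (face_sum \<sigma>) = push p j \<sigma> + push p (Suc j) \<sigma>"
  unfolding push_step_def by (rule bdry_cone_homotopy) (simp only: lin_add bdry_push lin_fun_add)

lemma bdry_push_end:
  "bdry (push_end p j \<sigma>) + lin (push_end p j) (face_sum \<sigma>) = push p j \<sigma> + bas \<sigma>"
  unfolding push_end_def
  by (rule bdry_cone_homotopy) (simp only: lin_add bdry_push lin_fun_add lin_bas lin_bas_self)

lemma bdry_push_upto: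
  "bdry (push_upto p j \<sigma>) + lin (push_upto p j) (face_sum \<sigma>) = push p j \<sigma>"
proof (induction j)
  case 0
  have "push_upto p 0 = cone_homotopy (\<lambda>_. rd p) (push p 0)" by (rule ext) simp
  then show ?case by (simp only: bdry_cone_homotopy[OF bdry_push])
next
  case (Suc j)
  have e: "push_upto p (Suc j) = (\<lambda>\<sigma>. push_upto p j \<sigma> + push_step p j \<sigma>)" by (rule ext) simp
  have "bdry (push_upto p (Suc j) \<sigma>) + lin (push_upto p (Suc j)) (face_sum \<sigma>)
    = (bdry (push_upto p j \<sigma>) + lin (push_upto p j) (face_sum \<sigma>))
      + (bdry (push_step p j \<sigma>) + lin (push_step p j) (face_sum \<sigma>))"
    unfolding e lin_fun_add lin_add by (simp only: ac_simps)
  also have "\<dots> = push p (Suc j) \<sigma>"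
    unfolding Suc.IH bdry_push_step by (simp only: chain_add_cancel)
  finally show ?case .
qed

lemma range_bound_mono:
  assumes "\<tau> |\<subseteq>| \<sigma>" shows "range_bound p \<tau> \<le> range_bound p \<sigma>"
proof -
  have "(\<Sum>w\<in>fset \<tau>. dist p w) \<le> (\<Sum>w\<in>fset \<sigma>. dist p w)"
    using assms by (intro sum_mono2) (auto simp: less_eq_fset.rep_eq)
  then show ?thesis unfolding range_bound_def by (intro nat_mono ceiling_mono) simp
qed

lemma dist_le_range_bound:
  assumes "w |\<in>| \<sigma>" shows "dist p w + 23 \<le> real (range_bound p \<sigma>)"
proof -
  have "dist p w \<le> (\<Sum>w\<in>fset \<sigma>. dist p w)"
    using assms by (intro member_le_sum) auto
  then show ?thesis unfolding range_bound_def by linarith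
qed

lemma apex_eq:
  assumes "\<sigma> \<in> rips 30 V" "\<tau> |\<subseteq>| \<sigma>" "\<tau> \<noteq> {||}" "range_bound p \<sigma> \<le> j"
  shows "apex p j \<tau> = rd (ctr \<tau>)"
proof -
  obtain w where w: "w |\<in>| \<tau>" using assms(3) by auto
  have t: "\<tau> \<in> rips 30 V" using rips_mono assms(1,2) .
  have "dist p (ctr \<tau>) \<le> dist p w + dist w (ctr \<tau>)" by (rule dist_triangle)
  also have "\<dots> \<le> dist p w + 23" using ctr[OF t w] by simp
  also have "\<dots> \<le> real (range_bound p \<sigma>)" using w assms(2) by (intro dist_le_range_bound) auto
  finally show ?thesis using assms(4) by (simp add: apex_def Xi_ge)
qed

text \<open>At times beyond \<open>range_bound\<close> the apexes of \<open>\<sigma>\<close> and its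
  faces no longer move, so the further homotopies are 0. Hence the boundary formula can be verified
  with one common time for \<open>\<sigma>\<close> and its faces.\<close>

lemma contraction_stable:
  assumes \<sigma>: "\<sigma> \<in> rips 30 V" and "range_bound p \<sigma> \<le> j"
  shows "push_upto p j \<sigma> + push_end p j \<sigma> = contraction p \<sigma>"
  using assms(2)
proof (induction rule: dec_induct)
  case base
  then show ?case by (simp only: contraction_def)
next
  case (step j)
  have a: "apex p (Suc j) \<tau> = apex p j \<tau>" if "\<tau> |\<subseteq>| \<sigma>" "\<tau> \<noteq> {||}" for \<tau>
    using apex_eq[OF \<sigma> that, of p] step.hyps by simp
  have f: "push p (Suc j) \<tau> = push p j \<tau>" if t: "\<tau> |\<subseteq>| \<sigma>" for \<tau>
    unfolding push_def
  proof (rule cone_subdivision_cong)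
    fix \<kappa> :: "'a fset" assume "\<kappa> |\<subseteq>| \<tau>" "\<kappa> \<noteq> {||}"
    then show "apex p (Suc j) \<kappa> = apex p j \<kappa>" using a t by (meson order_trans)
  qed
  have "push_step p j \<sigma> = 0"
    unfolding push_step_def by (rule cone_homotopy_0) (simp only: f chain_add_self)
  moreover have "push_end p (Suc j) \<sigma> = push_end p j \<sigma>"
    unfolding push_end_def
  proof (rule cone_homotopy_cong)
    show "push p (Suc j) {||} + bas {||} = 0" by (simp only: push_def cone_subdivision_empty chain_add_self)
    show "apex p (Suc j) \<tau> = apex p j \<tau>" if "\<tau> |\<subseteq>| \<sigma>" "\<tau> \<noteq> {||}" for \<tau> using that by (rule a)
  qed (simp only: f)
  ultimately show ?case using step.IH by (simp add: add.assoc)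
qed

lemma bdry_contraction:
  assumes \<sigma>: "\<sigma> \<in> rips 30 V"
  shows "bdry (contraction p \<sigma>) + lin (contraction p) (face_sum \<sigma>) = bas \<sigma>"
proof -
  let ?j = "range_bound p \<sigma>"
  have "lin (contraction p) (face_sum \<sigma>) = lin (\<lambda>\<tau>. push_upto p ?j \<tau> + push_end p ?j \<tau>) (face_sum \<sigma>)"
  proof (rule lin_cong)
    fix \<tau> assume "\<tau> \<in> Poly_Mapping.keys (face_sum \<sigma>)"
    then have t: "\<tau> |\<subseteq>| \<sigma>" using keys_face_sum_fcard by auto
    show "contraction p \<tau> = push_upto p ?j \<tau> + push_end p ?j \<tau>"
      by (rule contraction_stable[symmetric, OF rips_mono[OF \<sigma> t] range_bound_mono[OF t]])
  qed
  then have "bdry (contraction p \<sigma>) + lin (contraction p) (face_sum \<sigma>)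
    = (bdry (push_upto p ?j \<sigma>) + lin (push_upto p ?j) (face_sum \<sigma>))
      + (bdry (push_end p ?j \<sigma>) + lin (push_end p ?j) (face_sum \<sigma>))"
    by (simp only: contraction_def[of p \<sigma>] lin_fun_add lin_add ac_simps)
  also have "\<dots> = bas \<sigma>" unfolding bdry_push_upto bdry_push_end by (simp only: chain_add_cancel)
  finally show ?thesis .
qed

lemma keys_push:
  assumes "\<rho> \<in> Poly_Mapping.keys (push p j \<sigma>)"
  shows "\<rho> \<in> flag_carrier False (\<lambda>\<tau>. {apex p j \<tau>}) \<sigma>" "fcard \<rho> = fcard \<sigma>"
proof -
  have "Poly_Mapping.keys (push p j \<sigma>)
      \<subseteq> {\<rho> \<in> flag_carrier False (\<lambda>\<tau>. {apex p j \<tau>}) \<sigma>. fcard \<rho> = fcard \<sigma>}"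
    unfolding push_def
  proof (rule keys_cone_subdivision)
    fix \<sigma> v \<rho>
    assume v: "v |\<in>| \<sigma>" and \<rho>: "\<rho> \<in> {\<rho> \<in> flag_carrier False (\<lambda>\<tau>. {apex p j \<tau>}) (\<sigma> |-| {|v|}). fcard \<rho> = fcard (\<sigma> |-| {|v|})}"
      and new: "apex p j \<sigma> |\<notin>| \<rho>"
    have "\<sigma> |-| {|v|} |\<subseteq>| \<sigma>" "\<sigma> \<noteq> {||}" using v by auto
    then have "finsert (apex p j \<sigma>) \<rho> \<in> flag_carrier False (\<lambda>\<tau>. {apex p j \<tau>}) \<sigma>"
      using \<rho> by (intro flag_carrier_finsert[where \<tau> = "\<sigma> |-| {|v|}"]) auto
    moreover have "fcard (finsert (apex p j \<sigma>) \<rho>) = fcard \<sigma>"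
      using \<rho> fcard_Suc_fminus1[OF v] fcard_finsert_new[OF new] by simp
    ultimately show "finsert (apex p j \<sigma>) \<rho> \<in> {\<rho> \<in> flag_carrier False (\<lambda>\<tau>. {apex p j \<tau>}) \<sigma>. fcard \<rho> = fcard \<sigma>}"
      by simp
  qed (simp add: flag_carrier_empty)
  then show "\<rho> \<in> flag_carrier False (\<lambda>\<tau>. {apex p j \<tau>}) \<sigma>" "fcard \<rho> = fcard \<sigma>" using assms by auto
qed

text \<open>\<open>T {||} = 0\<close> ensures that an apex is only ever added for a nonempty
  \<open>\<sigma>\<close>, and a flag consists of nonempty faces.\<close>

lemma keys_flag_homotopy:
  assumes "\<rho> \<in> Poly_Mapping.keys (cone_homotopy b T \<sigma>)"
    and T: "\<And>\<sigma> \<rho>. \<rho> \<in> Poly_Mapping.keys (T \<sigma>) \<Longrightarrow> \<rho> \<in> flag_carrier e B \<sigma> \<and> fcard \<rho> = fcard \<sigma>"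
    and "T {||} = 0" and b: "\<And>\<sigma>. b \<sigma> \<in> B \<sigma>"
  shows "\<rho> \<in> flag_carrier e B \<sigma>" "fcard \<rho> = Suc (fcard \<sigma>)"
proof -
  have "Poly_Mapping.keys (cone_homotopy b T \<sigma>) \<subseteq> {\<rho> \<in> flag_carrier e B \<sigma>. fcard \<rho> = Suc (fcard \<sigma>)}"
  proof (rule keys_cone_homotopy[where P = "\<lambda>_. True"])
    fix \<sigma> \<rho>
    assume \<rho>: "\<rho> \<in> Poly_Mapping.keys (T \<sigma>)" and new: "b \<sigma> |\<notin>| \<rho>"
    have "\<sigma> \<noteq> {||}" using \<rho> assms(3) by auto
    then have "finsert (b \<sigma>) \<rho> \<in> flag_carrier e B \<sigma>"
      using T[OF \<rho>] b by (intro flag_carrier_finsert[where \<tau> = \<sigma>]) auto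
    then show "finsert (b \<sigma>) \<rho> \<in> {\<rho> \<in> flag_carrier e B \<sigma>. fcard \<rho> = Suc (fcard \<sigma>)}"
      using T[OF \<rho>] fcard_finsert_new[OF new] by simp
  next
    fix \<sigma> v \<rho>
    assume v: "v |\<in>| \<sigma>" and \<rho>: "\<rho> \<in> {\<rho> \<in> flag_carrier e B (\<sigma> |-| {|v|}). fcard \<rho> = Suc (fcard (\<sigma> |-| {|v|}))}"
      and new: "b \<sigma> |\<notin>| \<rho>"
    have "\<sigma> |-| {|v|} |\<subseteq>| \<sigma>" "\<sigma> \<noteq> {||}" using v by auto
    then have "finsert (b \<sigma>) \<rho> \<in> flag_carrier e B \<sigma>"
      using \<rho> b by (intro flag_carrier_finsert[where \<tau> = "\<sigma> |-| {|v|}"]) auto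
    then show "finsert (b \<sigma>) \<rho> \<in> {\<rho> \<in> flag_carrier e B \<sigma>. fcard \<rho> = Suc (fcard \<sigma>)}"
      using \<rho> fcard_Suc_fminus1[OF v] fcard_finsert_new[OF new] by simp
  qed auto
  then show "\<rho> \<in> flag_carrier e B \<sigma>" "fcard \<rho> = Suc (fcard \<sigma>)" using assms(1) by auto
qed

lemma dist_apex:
  assumes "\<sigma> \<in> rips 30 V" "\<tau> |\<subseteq>| \<tau>'" "\<tau>' |\<subseteq>| \<sigma>" "\<tau> \<noteq> {||}" "\<bar>real i - real j\<bar> \<le> 1"
  shows "dist (apex p i \<tau>) (apex p j \<tau>') \<le> 30"
proof -
  have "\<tau>' \<in> rips 30 V" using rips_mono assms(1,3) .
  then have "dist (Xi p (ctr \<tau>) i) (Xi p (ctr \<tau>') i) \<le> 27"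
    using Xi_nonexpansive[of i p "ctr \<tau>" "ctr \<tau>'"] ctr_ctr[OF _ assms(2,4)] by simp
  moreover have "dist (Xi p (ctr \<tau>') i) (Xi p (ctr \<tau>') j) \<le> 1"
    using dist_Xi_le[of i j p "ctr \<tau>'"] assms(5) by simp
  moreover have "dist (apex p i \<tau>) (Xi p (ctr \<tau>) i) \<le> 1" "dist (apex p j \<tau>') (Xi p (ctr \<tau>') j) \<le> 1"
    unfolding apex_def by (rule rd)+
  ultimately show ?thesis
    using dist_triangle[of "apex p i \<tau>" "apex p j \<tau>'" "Xi p (ctr \<tau>) i"]
      dist_triangle[of "Xi p (ctr \<tau>) i" "apex p j \<tau>'" "Xi p (ctr \<tau>') i"]
      dist_triangle[of "Xi p (ctr \<tau>') i" "apex p j \<tau>'" "Xi p (ctr \<tau>') j"]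
    by (simp add: dist_commute)
qed

text \<open>54 is 23 for the circumcentre, 30 for the diameter of \<open>\<sigma>\<close> and 1 for
  rounding. Thus the contraction of \<open>\<sigma>\<close> runs along the geodesics from
  \<open>p\<close> to any of its vertices, which links it to the bound on shadows.\<close>

lemma apex_near_geodesic:
  assumes "\<sigma> \<in> rips 30 V" "\<tau> |\<subseteq>| \<sigma>" "\<tau> \<noteq> {||}" "w |\<in>| \<sigma>"
  shows "dist (apex p j \<tau>) (Xi p w j) \<le> 54"
proof -
  obtain v where v: "v |\<in>| \<tau>" using assms(3) by auto
  have "dist (ctr \<tau>) v \<le> 23" using ctr[OF rips_mono[OF assms(1,2)] v] by (simp add: dist_commute)
  moreover have "dist v w \<le> 30" using assms(1,2,4) v by (auto simp: rips_def)
  ultimately have "dist (ctr \<tau>) w \<le> 53" using dist_triangle[of "ctr \<tau>" w v] by simp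
  then have "dist (Xi p (ctr \<tau>) j) (Xi p w j) \<le> 53"
    using Xi_nonexpansive[of j p "ctr \<tau>" w] by simp
  moreover have "dist (apex p j \<tau>) (Xi p (ctr \<tau>) j) \<le> 1" unfolding apex_def by (rule rd)
  ultimately show ?thesis using dist_triangle[of "apex p j \<tau>" "Xi p w j" "Xi p (ctr \<tau>) j"] by simp
qed

lemma keys_push_step:
  assumes \<sigma>: "\<sigma> \<in> rips 30 V" and \<rho>: "\<rho> \<in> Poly_Mapping.keys (push_step p j \<sigma>)"
  shows "\<rho> \<in> rips 30 V" "fcard \<rho> = Suc (fcard \<sigma>)"
    "u |\<in>| \<rho> \<Longrightarrow> \<sigma> \<noteq> {||} \<and> (w |\<in>| \<sigma> \<longrightarrow> (\<exists>i::nat. dist u (Xi p w i) \<le> 54))"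
proof -
  let ?B = "\<lambda>\<tau>. {apex p j \<tau>, apex p (Suc j) \<tau>}"
  have T: "\<rho> \<in> flag_carrier False ?B \<sigma> \<and> fcard \<rho> = fcard \<sigma>"
    if "\<rho> \<in> Poly_Mapping.keys (push p j \<sigma> + push p (Suc j) \<sigma>)" for \<sigma> \<rho>
    using that
  proof (cases rule: keys_addE)
    case 1
    then show ?thesis using keys_push[OF 1] flag_carrier_mono[of \<rho> False _ \<sigma> False ?B] by simp
  next
    case 2
    then show ?thesis using keys_push[OF 2] flag_carrier_mono[of \<rho> False _ \<sigma> False ?B] by simp
  qed
  have c: "\<rho> \<in> flag_carrier False ?B \<sigma>" "fcard \<rho> = Suc (fcard \<sigma>)"
    by (rule keys_flag_homotopy[OF \<rho>[unfolded push_step_def] T]; simp add: push_def)+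
  show "fcard \<rho> = Suc (fcard \<sigma>)" by fact
  show "\<rho> \<in> rips 30 V"
  proof (rule flag_carrier_rips[OF c(1) \<sigma>])
    show "?B \<tau> \<subseteq> V" for \<tau> by (simp add: apex_def rd)
    show "dist x y \<le> 30" if t: "\<tau> |\<subseteq>| \<tau>'" "\<tau>' |\<subseteq>| \<sigma>" "\<tau> \<noteq> {||}" and xy: "x \<in> ?B \<tau>" "y \<in> ?B \<tau>'" for x y \<tau> \<tau>'
    proof -
      from xy obtain i i' where "x = apex p i \<tau>" "y = apex p i' \<tau>'" "\<bar>real i - real i'\<bar> \<le> 1" by auto
      then show ?thesis using dist_apex[OF \<sigma> t] by simp
    qed
  qed simp
  show "\<sigma> \<noteq> {||} \<and> (w |\<in>| \<sigma> \<longrightarrow> (\<exists>i::nat. dist u (Xi p w i) \<le> 54))" if "u |\<in>| \<rho>"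
    using c(1) that
  proof (rule flag_carrier_vertex)
    fix \<tau> assume t: "\<tau> |\<subseteq>| \<sigma>" "\<tau> \<noteq> {||}" "u \<in> ?B \<tau>"
    from t(3) obtain i where "u = apex p i \<tau>" by auto
    then show ?thesis using apex_near_geodesic[OF \<sigma> t(1,2)] t(1,2) by auto
  qed simp
qed

lemma keys_push_end:
  assumes \<sigma>: "\<sigma> \<in> rips 30 V" and \<rho>: "\<rho> \<in> Poly_Mapping.keys (push_end p (range_bound p \<sigma>) \<sigma>)"
  shows "\<rho> \<in> rips 30 V" "fcard \<rho> = Suc (fcard \<sigma>)"
    "u |\<in>| \<rho> \<Longrightarrow> \<sigma> \<noteq> {||} \<and> (w |\<in>| \<sigma> \<longrightarrow> (\<exists>i::nat. dist u (Xi p w i) \<le> 54))"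
proof -
  let ?j = "range_bound p \<sigma>"
  let ?B = "\<lambda>\<tau>. {apex p ?j \<tau>}"
  have T: "\<rho> \<in> flag_carrier True ?B \<tau> \<and> fcard \<rho> = fcard \<tau>"
    if "\<rho> \<in> Poly_Mapping.keys (push p ?j \<tau> + bas \<tau>)" for \<tau> \<rho>
    using that
  proof (cases rule: keys_addE)
    case 1
    then show ?thesis using keys_push[OF 1] flag_carrier_mono[of \<rho> False _ \<tau> True ?B] by simp
  next
    case 2
    then show ?thesis by (simp add: flag_carrier_self)
  qed
  have c: "\<rho> \<in> flag_carrier True ?B \<sigma>" "fcard \<rho> = Suc (fcard \<sigma>)"
    by (rule keys_flag_homotopy[OF \<rho>[unfolded push_end_def] T]; simp add: push_def)+
  show "fcard \<rho> = Suc (fcard \<sigma>)" by fact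
  show "\<rho> \<in> rips 30 V"
  proof (rule flag_carrier_rips[OF c(1) \<sigma>])
    fix v \<tau> x assume t: "\<tau> |\<subseteq>| \<sigma>" "v |\<in>| \<tau>" "x \<in> ?B \<tau>"
    then have "x = rd (ctr \<tau>)" using apex_eq[OF \<sigma> t(1), of p ?j] by auto
    then have "dist x (ctr \<tau>) \<le> 1" by (simp add: rd)
    then show "dist v x \<le> 30"
      using ctr[OF rips_mono[OF \<sigma> t(1)] t(2)] dist_triangle2[of v x "ctr \<tau>"] by simp
  next
    show "?B \<tau> \<subseteq> V" for \<tau> by (simp add: apex_def rd)
    show "dist x y \<le> 30" if t: "\<tau> |\<subseteq>| \<tau>'" "\<tau>' |\<subseteq>| \<sigma>" "\<tau> \<noteq> {||}" and xy: "x \<in> ?B \<tau>" "y \<in> ?B \<tau>'" for x y \<tau> \<tau>'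
      using dist_apex[OF \<sigma> t, of ?j ?j] xy by simp
  qed
  show "\<sigma> \<noteq> {||} \<and> (w |\<in>| \<sigma> \<longrightarrow> (\<exists>i::nat. dist u (Xi p w i) \<le> 54))" if "u |\<in>| \<rho>"
    using c(1) that
  proof (rule flag_carrier_vertex)
    fix \<tau> assume t: "\<tau> |\<subseteq>| \<sigma>" "\<tau> \<noteq> {||}" "u \<in> ?B \<tau>"
    then show ?thesis using apex_near_geodesic[OF \<sigma> t(1,2)] by auto
  next
    assume u: "u |\<in>| \<sigma>"
    have "dist u (Xi p w ?j) \<le> 54" if w: "w |\<in>| \<sigma>"
    proof -
      have "Xi p w ?j = w" using dist_le_range_bound[OF w, of p] by (intro Xi_ge) simp
      moreover have "dist u w \<le> 30" using \<sigma> u w by (simp add: rips_def)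
      ultimately show ?thesis by simp
    qed
    then show ?thesis using u by auto
  qed
qed

text \<open>Since all apexes coincide at time 0, joins with \<open>rd p\<close> vanish except over
  the empty simplex.\<close>

lemma keys_push_0:
  assumes "\<rho> \<in> Poly_Mapping.keys (cone_homotopy (\<lambda>_. rd p) (push p 0) \<sigma>)"
  shows "\<rho> = {|rd p|}" "\<sigma> = {||}"
proof -
  have "Poly_Mapping.keys (cone_homotopy (\<lambda>_. rd p) (push p 0) \<sigma>)
      \<subseteq> {\<rho>. \<rho> = {|rd p|} \<and> fcard \<rho> = Suc (fcard \<sigma>)}"
  proof (rule keys_cone_homotopy[where P = "\<lambda>_. True"])
    fix \<sigma> \<rho>
    assume \<rho>: "\<rho> \<in> Poly_Mapping.keys (push p 0 \<sigma>)" and new: "rd p |\<notin>| \<rho>"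
    have "u = rd p" if "u |\<in>| \<rho>" for u
      using keys_push(1)[OF \<rho>] that by (rule flag_carrier_vertex) (simp_all add: apex_def)
    then have "\<rho> = {||}" using new by (metis ex_fin_conv)
    then show "finsert (rd p) \<rho> \<in> {\<rho>. \<rho> = {|rd p|} \<and> fcard \<rho> = Suc (fcard \<sigma>)}"
      using keys_push(2)[OF \<rho>] by (auto simp: fcard_finsert_new)
  next
    fix \<sigma> v \<rho>
    assume "\<rho> \<in> {\<rho>. \<rho> = {|rd p|} \<and> fcard \<rho> = Suc (fcard (\<sigma> |-| {|v|}))}" and "rd p |\<notin>| \<rho>"
    then show "finsert (rd p) \<rho> \<in> {\<rho>. \<rho> = {|rd p|} \<and> fcard \<rho> = Suc (fcard \<sigma>)}" by simp
  qed auto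
  then have "\<rho> = {|rd p|}" "fcard \<rho> = Suc (fcard \<sigma>)" using assms by auto
  moreover have "fcard {|rd p|} = Suc 0" by (simp add: fcard_finsert_new)
  ultimately show "\<rho> = {|rd p|}" "\<sigma> = {||}" by auto
qed

text \<open>The first alternative in the last clause is the contraction of the empty simplex, whose
  single vertex is next to \<open>p\<close>; every other simplex follows the geodesics to the
  vertices of \<open>\<sigma>\<close>.\<close>

lemma keys_contraction:
  assumes \<sigma>: "\<sigma> \<in> rips 30 V" and \<rho>: "\<rho> \<in> Poly_Mapping.keys (contraction p \<sigma>)"
  shows "\<rho> \<in> rips 30 V" "fcard \<rho> = Suc (fcard \<sigma>)"
    "u |\<in>| \<rho> \<Longrightarrow> (\<sigma> = {||} \<and> u = rd p) \<or> (\<sigma> \<noteq> {||} \<and> (w |\<in>| \<sigma> \<longrightarrow> (\<exists>i::nat. dist u (Xi p w i) \<le> 54)))"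
proof -
  have upto: "\<rho> \<in> Poly_Mapping.keys (cone_homotopy (\<lambda>_. rd p) (push p 0) \<sigma>)
      \<or> (\<exists>i. \<rho> \<in> Poly_Mapping.keys (push_step p i \<sigma>))"
    if "\<rho> \<in> Poly_Mapping.keys (push_upto p j \<sigma>)" for j
    using that
  proof (induction j)
    case (Suc j)
    then have "\<rho> \<in> Poly_Mapping.keys (push_upto p j \<sigma> + push_step p j \<sigma>)" by simp
    then show ?case by (rule keys_addE) (use Suc.IH in auto)
  qed simp
  consider "\<rho> \<in> Poly_Mapping.keys (cone_homotopy (\<lambda>_. rd p) (push p 0) \<sigma>)"
    | i where "\<rho> \<in> Poly_Mapping.keys (push_step p i \<sigma>)"
    | "\<rho> \<in> Poly_Mapping.keys (push_end p (range_bound p \<sigma>) \<sigma>)"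
    using \<rho> unfolding contraction_def by (rule keys_addE) (use upto in auto)
  then have "\<rho> \<in> rips 30 V \<and> fcard \<rho> = Suc (fcard \<sigma>) \<and> (u |\<in>| \<rho> \<longrightarrow>
      (\<sigma> = {||} \<and> u = rd p) \<or> (\<sigma> \<noteq> {||} \<and> (w |\<in>| \<sigma> \<longrightarrow> (\<exists>i::nat. dist u (Xi p w i) \<le> 54))))"
  proof cases
    case 1
    have "{|rd p|} \<in> rips 30 V" by (simp add: rips_def rd)
    then show ?thesis using keys_push_0[OF 1] by (simp add: fcard_finsert_new)
  next
    case 2
    then show ?thesis using keys_push_step[OF \<sigma> 2] by simp
  next
    case 3
    then show ?thesis using keys_push_end[OF \<sigma> 3] by simp
  qed
  then show "\<rho> \<in> rips 30 V" "fcard \<rho> = Suc (fcard \<sigma>)"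
    "u |\<in>| \<rho> \<Longrightarrow> (\<sigma> = {||} \<and> u = rd p) \<or> (\<sigma> \<noteq> {||} \<and> (w |\<in>| \<sigma> \<longrightarrow> (\<exists>i::nat. dist u (Xi p w i) \<le> 54)))"
    by blast+
qed

end

section \<open>Ultralimits of rays\<close>

lemma infdist_lessE:
  assumes "infdist x A < e" "A \<noteq> {}"
  obtains a where "a \<in> A" "dist x a < e"
  using assms cInf_lessD[of "dist x ` A" e] by (auto simp: infdist_notempty)

lemma ray_dist: "\<alpha> \<in> rays x0 \<Longrightarrow> 0 \<le> s \<Longrightarrow> 0 \<le> t \<Longrightarrow> dist (\<alpha> s) (\<alpha> t) = \<bar>s - t\<bar>"
  by (simp add: rays_def)

lemma ray_0: "\<alpha> \<in> rays x0 \<Longrightarrow> \<alpha> 0 = x0"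
  by (simp add: rays_def)

lemma ray_dist_base: "\<alpha> \<in> rays x0 \<Longrightarrow> 0 \<le> t \<Longrightarrow> dist x0 (\<alpha> t) = t"
  using ray_dist[of \<alpha> x0 0 t] ray_0[of \<alpha> x0] by simp

lemma rays_eqI:
  assumes "\<alpha> \<in> rays x0" "\<beta> \<in> rays x0" "\<And>t. 0 \<le> t \<Longrightarrow> \<alpha> t = \<beta> t"
  shows "\<alpha> = \<beta>"
  using assms by (intro extensionalityI[of \<alpha> "{0..}" \<beta>]) (auto simp: rays_def)

locale nonprincipal =
  fixes \<omega> :: "nat filter"
  assumes ultra: "nonprincipal_ultrafilter \<omega>"
begin

lemma not_bot [simp]: "\<omega> \<noteq> bot"
  using ultra by (simp add: nonprincipal_ultrafilter_def)

lemma eventually_or_not: "eventually P \<omega> \<or> eventually (\<lambda>n. \<not> P n) \<omega>"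
  using ultra by (simp add: nonprincipal_ultrafilter_def)

lemma eventually_ge: "eventually (\<lambda>n. N \<le> n) \<omega>"
proof -
  have "eventually (\<lambda>n. n \<noteq> m) \<omega>" for m
    using ultra eventually_or_not[of "\<lambda>n. n = m"] by (auto simp: nonprincipal_ultrafilter_def)
  then have "eventually (\<lambda>n. \<forall>m\<in>{..<N}. n \<noteq> m) \<omega>" by (simp add: eventually_ball_finite)
  then show ?thesis by (rule eventually_mono) (auto simp: not_less[symmetric])
qed

lemma omega_le_sequentially: "\<omega> \<le> sequentially"
  by (rule filter_leI) (auto simp: eventually_sequentially intro: eventually_mono[OF eventually_ge])

lemma real_at_top: "filterlim real at_top \<omega>"
  using filterlim_real_sequentially omega_le_sequentially filterlim_mono by blast

text \<open>If no point of \<open>K\<close> were a limit, the ultrafilter property would give each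
  of them an open neighbourhood that \<open>f\<close> avoids almost surely; by a finite subcover
  \<open>f\<close> would avoid \<open>K\<close>.\<close>

lemma compact_limit:
  fixes f :: "nat \<Rightarrow> 'b::topological_space"
  assumes "compact K" "eventually (\<lambda>n. f n \<in> K) \<omega>"
  obtains l where "l \<in> K" "(f \<longlongrightarrow> l) \<omega>"
proof -
  have "\<exists>l\<in>K. (f \<longlongrightarrow> l) \<omega>"
  proof (rule ccontr)
    assume n: "\<not> ?thesis"
    have "\<exists>U. open U \<and> l \<in> U \<and> eventually (\<lambda>n. f n \<notin> U) \<omega>" if l: "l \<in> K" for l
    proof -
      obtain U where "open U" "l \<in> U" "\<not> eventually (\<lambda>n. f n \<in> U) \<omega>"
        using n l by (auto simp: tendsto_def)
      then show ?thesis using eventually_or_not by blast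
    qed
    then obtain U where U: "\<And>l. l \<in> K \<Longrightarrow> open (U l) \<and> l \<in> U l \<and> eventually (\<lambda>n. f n \<notin> U l) \<omega>"
      by metis
    obtain F where F: "F \<subseteq> K" "finite F" "K \<subseteq> (\<Union>l\<in>F. U l)"
      by (rule compactE_image[OF assms(1), of K U]) (use U in auto)
    have "eventually (\<lambda>n. \<forall>l\<in>F. f n \<notin> U l) \<omega>"
      using F U by (intro eventually_ball_finite) auto
    with assms(2) have "eventually (\<lambda>n. False) \<omega>"
      by eventually_elim (use F(3) in auto)
    then show False by simp
  qed
  then show thesis using that by blast
qed

lemma bounded_limit:
  fixes f :: "nat \<Rightarrow> real"
  assumes "eventually (\<lambda>n. \<bar>f n\<bar> \<le> B) \<omega>"
  obtains l where "(f \<longlongrightarrow> l) \<omega>"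
proof (rule compact_limit[of "{-B..B}" f])
  show "\<forall>\<^sub>F n in \<omega>. f n \<in> {- B..B}" using assms by eventually_elim auto
qed auto

lemma Lim_eq: "(f \<longlongrightarrow> l) \<omega> \<Longrightarrow> Lim \<omega> f = (l::'b::t2_space)"
  by (intro tendsto_Lim) auto

text \<open>A diagonal argument: \<open>k n\<close> is the largest admissible \<open>R\<close>.
  Restricting \<open>R\<close> to \<open>{1..n}\<close> makes the maximum exist and keeps
  \<open>k\<close> positive, as a scaling sequence must be; since \<open>\<omega>\<close> is
  nonprincipal, each \<open>R\<close> is eventually within this range.\<close>

lemma slow_sequence:
  assumes P: "\<And>R. eventually (\<lambda>n. P R n) \<omega>"
  obtains k :: "nat \<Rightarrow> nat" where "\<And>n. 1 \<le> k n" "filterlim k at_top \<omega>" "eventually (\<lambda>n. P (k n) n) \<omega>"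
proof
  define k where "k n = (if \<exists>R\<in>{1..n}. P R n then Max {R \<in> {1..n}. P R n} else 1)" for n
  have Pk: "P (k n) n \<and> 1 \<le> k n" if "\<exists>R\<in>{1..n}. P R n" for n
  proof -
    have "Max {R \<in> {1..n}. P R n} \<in> {R \<in> {1..n}. P R n}" using that by (intro Max_in) auto
    moreover have "k n = Max {R \<in> {1..n}. P R n}" unfolding k_def using that by (rule if_P)
    ultimately show ?thesis by simp
  qed
  have ex: "eventually (\<lambda>n. R \<in> {1..n} \<and> P R n) \<omega>" if "1 \<le> R" for R
  proof -
    have "eventually (\<lambda>n. R \<le> n \<and> P R n) \<omega>" by (rule eventually_conj[OF eventually_ge P])
    then show ?thesis by (rule eventually_mono) (use that in auto)
  qed
  show "1 \<le> k n" for n using Pk[of n] by (cases "\<exists>R\<in>{1..n}. P R n") (auto simp: k_def)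
  show "eventually (\<lambda>n. P (k n) n) \<omega>" using ex[of 1]
  proof (rule eventually_mono)
    fix n assume "1 \<in> {1..n} \<and> P 1 n"
    then have "\<exists>R\<in>{1..n}. P R n" by blast
    then show "P (k n) n" using Pk by simp
  qed simp
  show "filterlim k at_top \<omega>" unfolding filterlim_at_top
  proof
    fix Z :: nat
    show "eventually (\<lambda>n. Z \<le> k n) \<omega>"
      using ex[of "max 1 Z"]
    proof (rule eventually_mono)
      fix n assume a: "max 1 Z \<in> {1..n} \<and> P (max 1 Z) n"
      then have "\<exists>R\<in>{1..n}. P R n" by blast
      then have "k n = Max {R \<in> {1..n}. P R n}" unfolding k_def by (rule if_P)
      moreover have "max 1 Z \<le> Max {R \<in> {1..n}. P R n}" using a by (intro Max_ge) auto
      ultimately show "Z \<le> k n" by simp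
    qed simp
  qed
qed

end

locale proper_cat0 = cat0_space ty + nonprincipal \<omega>
  for ty :: "'a::metric_space itself" and \<omega> :: "nat filter" +
  assumes proper: "proper_space ty"
begin

lemma compact_cball_proper: "compact (cball (x::'a) r)"
  using proper by (simp add: proper_space_def)

text \<open>Pointwise ultralimits replace the theorem of Arzela and Ascoli: at each parameter the
  points stay in a compact ball, and eventually the geodesics are long enough to be isometric on the
  parameters considered.\<close>

lemma limit_ray:
  fixes x0 :: 'a
  assumes "filterlim (\<lambda>n. dist x0 (y n)) at_top \<omega>"
  obtains \<alpha> where "\<alpha> \<in> rays x0" "\<And>t. 0 \<le> t \<Longrightarrow> ((\<lambda>n. Xi x0 (y n) t) \<longlongrightarrow> \<alpha> t) \<omega>"
proof -
  have "\<exists>l. ((\<lambda>n. Xi x0 (y n) t) \<longlongrightarrow> l) \<omega>" if "0 \<le> t" for t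
  proof (rule compact_limit[OF compact_cball_proper[of x0 t], of "\<lambda>n. Xi x0 (y n) t"])
    show "\<forall>\<^sub>F n in \<omega>. Xi x0 (y n) t \<in> cball x0 t"
      using dist_Xi_le[of 0 t x0] that by (simp add: dist_commute)
  qed blast
  then obtain L where L: "\<And>t. 0 \<le> t \<Longrightarrow> ((\<lambda>n. Xi x0 (y n) t) \<longlongrightarrow> L t) \<omega>" by metis
  define \<alpha> where "\<alpha> = restrict L {0..}"
  have \<alpha>: "((\<lambda>n. Xi x0 (y n) t) \<longlongrightarrow> \<alpha> t) \<omega>" if "0 \<le> t" for t using L that by (simp add: \<alpha>_def)
  have "dist (\<alpha> s) (\<alpha> t) = \<bar>s - t\<bar>" if st: "0 \<le> s" "0 \<le> t" for s t
  proof -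
    have "((\<lambda>n. dist (Xi x0 (y n) s) (Xi x0 (y n) t)) \<longlongrightarrow> dist (\<alpha> s) (\<alpha> t)) \<omega>"
      using \<alpha> st by (intro tendsto_dist) auto
    moreover have "eventually (\<lambda>n. dist (Xi x0 (y n) s) (Xi x0 (y n) t) = \<bar>s - t\<bar>) \<omega>"
    proof -
      have "eventually (\<lambda>n. max s t \<le> dist x0 (y n)) \<omega>" using assms unfolding filterlim_at_top by (rule spec)
      then show ?thesis by eventually_elim (use st dist_Xi_Xi_same in auto)
    qed
    then have "((\<lambda>n. dist (Xi x0 (y n) s) (Xi x0 (y n) t)) \<longlongrightarrow> \<bar>s - t\<bar>) \<omega>"
      by (rule tendsto_eventually)
    ultimately show ?thesis by (rule tendsto_unique[OF not_bot])
  qed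
  moreover have "\<alpha> 0 = x0" using tendsto_unique[OF not_bot \<alpha>[of 0], of x0] by simp
  ultimately have "\<alpha> \<in> rays x0" by (auto simp: rays_def \<alpha>_def)
  then show thesis using that \<alpha> by blast
qed

lemma limit_of_rays:
  fixes x0 :: 'a
  assumes "\<And>n. \<alpha> n \<in> rays x0"
  obtains \<beta> where "\<beta> \<in> rays x0" "\<And>t. 0 \<le> t \<Longrightarrow> ((\<lambda>n. \<alpha> n t) \<longlongrightarrow> \<beta> t) \<omega>"
proof -
  \<comment> \<open>Truncating the rays at the parameter \<open>n\<close> gives geodesics to points
    that escape to infinity, to which \<open>limit_ray\<close> applies.\<close>
  have d: "dist x0 (\<alpha> n (real n)) = real n" for n
    using ray_dist_base[OF assms, of "real n"] by simp
  have "filterlim (\<lambda>n. dist x0 (\<alpha> n (real n))) at_top \<omega>" using real_at_top by (simp add: d)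
  then obtain \<beta> where \<beta>: "\<beta> \<in> rays x0" "\<And>t. 0 \<le> t \<Longrightarrow> ((\<lambda>n. Xi x0 (\<alpha> n (real n)) t) \<longlongrightarrow> \<beta> t) \<omega>"
    by (rule limit_ray) blast
  have "((\<lambda>n. \<alpha> n t) \<longlongrightarrow> \<beta> t) \<omega>" if t: "0 \<le> t" for t
  proof -
    have "eventually (\<lambda>n. t \<le> real n) \<omega>" using real_at_top by (simp add: filterlim_at_top)
    then have "eventually (\<lambda>n. Xi x0 (\<alpha> n (real n)) t = \<alpha> n t) \<omega>"
      by eventually_elim (use Xi_geodesic_ray[OF assms t] in auto)
    then show ?thesis using \<beta>(2)[OF t] by (simp add: tendsto_cong)
  qed
  with \<beta>(1) show thesis by (rule that)
qed

end

section \<open>Visual convergence as pointwise convergence\<close>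

lemma openin_visual_nbhd:
  "\<alpha> \<in> rays x0 \<Longrightarrow> 0 < R \<Longrightarrow> 0 < \<epsilon> \<Longrightarrow> openin (visual_topology x0) (visual_nbhd x0 \<alpha> R \<epsilon>)"
  unfolding visual_topology_def by (intro topology_generated_by_Basis) blast

lemma visual_nbhd_self: "\<alpha> \<in> rays x0 \<Longrightarrow> 0 < R \<Longrightarrow> 0 < \<epsilon> \<Longrightarrow> \<alpha> \<in> visual_nbhd x0 \<alpha> R \<epsilon>"
  unfolding visual_nbhd_def by auto

text \<open>A visual neighbourhood only bounds the distance of \<open>\<beta> t\<close> from the
  image of \<open>\<alpha> n\<close>. As rays are parametrised by the distance from
  \<open>x0\<close>, the parameter of a close point differs from \<open>t\<close> by at most that
  distance; hence the two halves of \<open>e\<close>.\<close>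

lemma visual_limit_pointwise:
  assumes "limitin (visual_topology x0) \<alpha> \<beta> F" and \<alpha>: "\<And>n. \<alpha> n \<in> rays x0" and \<beta>: "\<beta> \<in> rays x0" and "0 \<le> t"
  shows "((\<lambda>n. \<alpha> n t) \<longlongrightarrow> \<beta> t) F"
proof (cases "t = 0")
  case True
  have "\<alpha> n t = \<beta> t" for n using ray_0[OF \<alpha>, of n] ray_0[OF \<beta>] True by simp
  then show ?thesis by simp
next
  case False
  then have t: "0 < t" using assms by simp
  show ?thesis
  proof (rule tendstoI)
    fix e :: real assume e: "0 < e"
    have "eventually (\<lambda>n. \<alpha> n \<in> visual_nbhd x0 \<beta> t (e/2)) F"
    proof (rule mp[OF spec[OF conjunct2[OF assms(1)[unfolded limitin_def]]]])
      show "openin (visual_topology x0) (visual_nbhd x0 \<beta> t (e/2)) \<and> \<beta> \<in> visual_nbhd x0 \<beta> t (e/2)"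
        using openin_visual_nbhd[OF \<beta> t, of "e/2"] visual_nbhd_self[OF \<beta> t, of "e/2"] e by simp
    qed
    then show "eventually (\<lambda>n. dist (\<alpha> n t) (\<beta> t) < e) F"
    proof eventually_elim
      case (elim n)
      then have "infdist (\<beta> t) (\<alpha> n ` {0..}) < e / 2" by (simp add: visual_nbhd_def)
      then obtain s where s: "0 \<le> s" "dist (\<beta> t) (\<alpha> n s) < e / 2"
        by (rule infdist_lessE) auto
      have "\<bar>t - s\<bar> \<le> dist (\<beta> t) (\<alpha> n s)"
        using ray_dist_base[OF \<beta>, of t] ray_dist_base[OF \<alpha>, of s n] s t
          dist_triangle[of x0 "\<beta> t" "\<alpha> n s"] dist_triangle[of x0 "\<alpha> n s" "\<beta> t"]
        by (simp add: dist_commute)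
      then have "dist (\<alpha> n s) (\<alpha> n t) < e / 2" using ray_dist[OF \<alpha>, of s t n] s t by linarith
      then show ?case using s(2) dist_triangle[of "\<alpha> n t" "\<beta> t" "\<alpha> n s"] by (simp add: dist_commute)
    qed
  qed
qed

text \<open>The topology is given by generators centred at arbitrary rays, so the induction runs
  over generated open sets. For a generator a point of \<open>\<beta>\<close> close to
  \<open>\<gamma> R\<close> is fixed, and the rays converge at its parameter.\<close>

lemma pointwise_visual_limit:
  assumes \<alpha>: "\<And>n. \<alpha> n \<in> rays x0" and \<beta>: "\<beta> \<in> rays x0"
    and lim: "\<And>t. 0 \<le> t \<Longrightarrow> ((\<lambda>n. \<alpha> n t) \<longlongrightarrow> \<beta> t) F"
  shows "limitin (visual_topology x0) \<alpha> \<beta> F"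
  unfolding limitin_def
proof (intro conjI allI impI)
  show "\<beta> \<in> topspace (visual_topology x0)"
    using openin_subset[OF openin_visual_nbhd[OF \<beta>, of 1 1]] visual_nbhd_self[OF \<beta>, of 1 1] by auto
  fix U assume "openin (visual_topology x0) U \<and> \<beta> \<in> U"
  then have "generate_topology_on {visual_nbhd x0 \<alpha> R \<epsilon> | \<alpha> R \<epsilon>. \<alpha> \<in> rays x0 \<and> 0 < R \<and> 0 < \<epsilon>} U" "\<beta> \<in> U"
    by (auto simp: visual_topology_def openin_topology_generated_by_iff)
  then show "eventually (\<lambda>n. \<alpha> n \<in> U) F"
  proof (induction rule: generate_topology_on.induct)
    case (Int a b)
    then have "eventually (\<lambda>n. \<alpha> n \<in> a) F" "eventually (\<lambda>n. \<alpha> n \<in> b) F" by simp_all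
    then show ?case by eventually_elim simp
  next
    case (UN K)
    from UN.prems obtain k where k: "k \<in> K" "\<beta> \<in> k" by auto
    then have "eventually (\<lambda>n. \<alpha> n \<in> k) F" by (rule UN.IH)
    then show ?case by eventually_elim (use k(1) in auto)
  next
    case (Basis s)
    from Basis.hyps obtain \<gamma> R \<epsilon> where s: "s = visual_nbhd x0 \<gamma> R \<epsilon>" by auto
    have "infdist (\<gamma> R) (\<beta> ` {0..}) < \<epsilon>" using Basis.prems by (simp add: s visual_nbhd_def)
    then obtain u where u: "0 \<le> u" "dist (\<gamma> R) (\<beta> u) < \<epsilon>"
      by (rule infdist_lessE) auto
    have "((\<lambda>n. dist (\<gamma> R) (\<alpha> n u)) \<longlongrightarrow> dist (\<gamma> R) (\<beta> u)) F"
      using lim[OF u(1)] by (intro tendsto_dist tendsto_const)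
    then have "eventually (\<lambda>n. dist (\<gamma> R) (\<alpha> n u) < \<epsilon>) F" using u(2) by (rule order_tendstoD)
    then show ?case
    proof eventually_elim
      case (elim n)
      have "infdist (\<gamma> R) (\<alpha> n ` {0..}) \<le> dist (\<gamma> R) (\<alpha> n u)" using u(1) by (intro infdist_le) auto
      then show ?case using elim \<alpha> by (simp add: s visual_nbhd_def)
    qed
  qed simp
qed

lemma (in nonprincipal) visual_lim_eq:
  assumes \<alpha>: "\<And>n. \<alpha> n \<in> rays x0" and \<beta>: "\<beta> \<in> rays x0"
    and lim: "\<And>t. 0 \<le> t \<Longrightarrow> ((\<lambda>n. \<alpha> n t) \<longlongrightarrow> \<beta> t) \<omega>"
  shows "visual_lim \<omega> x0 \<alpha> = \<beta>"
  unfolding visual_lim_def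
proof (rule the_equality)
  show "limitin (visual_topology x0) \<alpha> \<beta> \<omega>" by (rule pointwise_visual_limit[OF \<alpha> \<beta> lim])
  fix \<gamma> assume g: "limitin (visual_topology x0) \<alpha> \<gamma> \<omega>"
  then have "\<gamma> \<in> topspace (visual_topology x0)" by (rule limitin_topspace)
  then have \<gamma>: "\<gamma> \<in> rays x0" by (auto simp: visual_topology_def visual_nbhd_def)
  show "\<gamma> = \<beta>"
  proof (rule rays_eqI[OF \<gamma> \<beta>])
    fix t :: real assume t: "0 \<le> t"
    show "\<gamma> t = \<beta> t"
      by (rule tendsto_unique[OF not_bot visual_limit_pointwise[OF g \<alpha> \<gamma> t] lim[OF t]])
  qed
qed

section \<open>Almost geodesic completeness\<close>

lemma isometry_groupD:
  assumes "g \<in> isometry_group"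
  shows "bij g" "dist (g x) (g y) = dist x y"
  using assms by (simp_all add: isometry_group_def)

lemma isometry_group_inverse:
  assumes "g \<in> isometry_group"
  shows "\<exists>h\<in>isometry_group. (\<forall>x. g (h x) = x) \<and> (\<forall>x. h (g x) = x)"
proof -
  note g = isometry_groupD[OF assms]
  have i: "g (inv g x) = x" "inv g (g x) = x" for x
    using g(1) by (simp_all add: bij_is_surj surj_f_inv_f bij_is_inj)
  have "dist (inv g x) (inv g y) = dist x y" for x y
    using g(2)[of "inv g x" "inv g y"] by (simp add: i)
  then have "inv g \<in> isometry_group"
    unfolding isometry_group_def using bij_imp_bij_inv[OF g(1)] by simp
  then show ?thesis using i by (intro bexI[of _ "inv g"]) simp_all
qed

text \<open>Both points are translates of points of \<open>K\<close>, and one translate is carried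
  to the other; the constant bounds the diameter of \<open>K\<close>.\<close>

lemma cocompact_translate:
  assumes "cocompact_space TYPE('a::metric_space)"
  shows "\<exists>C. \<forall>(x::'a) (v::'a). \<exists>g\<in>isometry_group. dist (g x) v \<le> C"
proof -
  obtain K :: "'a set" where K: "compact K" "(\<Union>g\<in>isometry_group. g ` K) = UNIV"
    using assms unfolding cocompact_space_def by (elim exE conjE)
  obtain C where C: "\<And>x y. x \<in> K \<Longrightarrow> y \<in> K \<Longrightarrow> dist x y \<le> C"
    using compact_imp_bounded[OF K(1)] unfolding bounded_two_points by auto
  have cover: "\<exists>g\<in>isometry_group. \<exists>k\<in>K. x = g k" for x
  proof -
    have "x \<in> (\<Union>g\<in>isometry_group. g ` K)" unfolding K(2) by (rule UNIV_I)
    then show ?thesis by (elim UN_E imageE) (intro bexI)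
  qed
  have "\<exists>g\<in>isometry_group. dist (g x) v \<le> C" for x :: 'a and v :: 'a
  proof -
    from cover[of v] obtain g k where g: "g \<in> isometry_group" "k \<in> K" "v = g k" by (elim bexE)
    from cover[of x] obtain h k' where h: "h \<in> isometry_group" "k' \<in> K" "x = h k'" by (elim bexE)
    from isometry_group_inverse[OF h(1)]
    obtain h' where h': "h' \<in> isometry_group" "\<And>x. h' (h x) = x" by auto
    have "bij (g \<circ> h')" by (rule bij_comp[OF isometry_groupD(1)[OF h'(1)] isometry_groupD(1)[OF g(1)]])
    moreover have "dist ((g \<circ> h') x) ((g \<circ> h') y) = dist x y" for x y
      by (simp add: isometry_groupD(2)[OF g(1)] isometry_groupD(2)[OF h'(1)])
    ultimately have "g \<circ> h' \<in> isometry_group" by (simp add: isometry_group_def)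
    moreover have "dist ((g \<circ> h') x) v \<le> C"
      using C[OF h(2) g(2)] by (simp add: g(3) h(3) h'(2) isometry_groupD(2)[OF g(1)])
    ultimately show ?thesis by (intro bexI[of _ "g \<circ> h'"])
  qed
  then show ?thesis by auto
qed

text \<open>A maximal 1-separated set. Separation will give local finiteness of the Rips complex,
  and maximality the rounding map.\<close>

lemma exists_separated_net:
  "\<exists>V :: 'a::metric_space set. (\<forall>u\<in>V. \<forall>v\<in>V. u \<noteq> v \<longrightarrow> 1 < dist u v) \<and> (\<forall>x. \<exists>v\<in>V. dist v x \<le> 1)"
proof -
  let ?A = "{V :: 'a set. \<forall>u\<in>V. \<forall>v\<in>V. u \<noteq> v \<longrightarrow> 1 < dist u v}"
  have "\<exists>M\<in>?A. \<forall>X\<in>?A. M \<subseteq> X \<longrightarrow> X = M"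
  proof (rule subset_Zorn')
    fix C assume C: "subset.chain ?A C"
    have "1 < dist u v" if uv: "u \<in> \<Union> C" "v \<in> \<Union> C" "u \<noteq> v" for u v
    proof -
      from uv obtain X Y where XY: "X \<in> C" "u \<in> X" "Y \<in> C" "v \<in> Y" by auto
      have CC: "C \<subseteq> ?A" "\<And>X Y. X \<in> C \<Longrightarrow> Y \<in> C \<Longrightarrow> X \<subseteq> Y \<or> Y \<subseteq> X"
        using C by (auto simp: subset_chain_def)
      obtain Z where Z: "Z \<in> C" "u \<in> Z" "v \<in> Z" using CC(2)[OF XY(1,3)] XY by auto
      then show ?thesis using CC(1) uv(3) by auto
    qed
    then show "\<Union> C \<in> ?A" by simp
  qed
  then obtain V where V: "V \<in> ?A" "\<forall>X\<in>?A. V \<subseteq> X \<longrightarrow> X = V" by (elim bexE)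
  have "\<exists>v\<in>V. dist v x \<le> 1" for x
  proof (rule ccontr)
    assume "\<not> ?thesis"
    then have n: "1 < dist v x" if "v \<in> V" for v using that by (simp add: not_le)
    then have A: "insert x V \<in> ?A" using V(1) by (simp add: dist_commute)
    have "insert x V = V" by (rule mp[OF bspec[OF V(2) A] subset_insertI])
    then have "x \<in> V" by auto
    then show False using n[of x] by simp
  qed
  then show ?thesis using V(1) by (intro exI[of _ V]) simp
qed

context proper_cat0
begin

text \<open>The centre minimises the largest distance to \<open>S\<close>. Convexity of squared
  distances at the minimum gives the last clause, a quantitative form of uniqueness that bounds the
  distance between the centres of a set and of a subset.\<close>

lemma exists_circumcenter:
  fixes S :: "'a set"
  assumes "finite S" "S \<noteq> {}"
  shows "\<exists>c r. (\<forall>v\<in>S. dist v c \<le> r) \<and> (\<exists>v\<in>S. dist v c = r) \<and>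
    (\<forall>x. \<exists>v\<in>S. r\<^sup>2 + 3/4 * (dist x c)\<^sup>2 \<le> (dist x v)\<^sup>2)"
proof -
  define f where "f x = Max ((\<lambda>v. dist v x) ` S)" for x
  have f1: "dist v x \<le> f x" if "v \<in> S" for v x unfolding f_def using assms that by (intro Max_ge) auto
  have f2: "\<exists>v\<in>S. dist v x = f x" for x
  proof -
    have "f x \<in> (\<lambda>v. dist v x) ` S" unfolding f_def by (rule Max_in) (use assms in auto)
    then obtain v where "f x = dist v x" "v \<in> S" by (rule imageE)
    then show ?thesis by (intro bexI[of _ v]) simp_all
  qed
  have lip: "f x \<le> f y + dist x y" for x y
  proof -
    obtain v where v: "v \<in> S" "dist v x = f x" using f2 by blast
    have "dist v x \<le> dist v y + dist x y" by (metis dist_commute dist_triangle)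
    then show ?thesis using f1[OF v(1), of y] v(2) by linarith
  qed
  obtain v0 where v0: "v0 \<in> S" using assms by blast
  have "continuous_on (cball v0 (f v0)) f"
  proof (rule continuous_onI)
    fix x e assume e: "0 < (e::real)"
    show "\<exists>d>0. \<forall>y\<in>cball v0 (f v0). dist y x < d \<longrightarrow> dist (f y) (f x) \<le> e"
    proof (intro exI[of _ e] conjI ballI impI)
      fix y assume "dist y x < e"
      moreover have "dist (f y) (f x) \<le> dist y x"
        using lip[of x y] lip[of y x] by (simp add: dist_real_def dist_commute abs_le_iff)
      ultimately show "dist (f y) (f x) \<le> e" by simp
    qed (rule e)
  qed
  moreover have v0': "v0 \<in> cball v0 (f v0)" using f1[OF v0, of v0] by simp
  ultimately have "\<exists>c\<in>cball v0 (f v0). \<forall>x\<in>cball v0 (f v0). f c \<le> f x"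
    by (intro continuous_attains_inf[OF compact_cball_proper]) auto
  then obtain c where c: "\<forall>x\<in>cball v0 (f v0). f c \<le> f x" by (elim bexE)
  \<comment> \<open>Outside the compact ball the distance to \<open>v0\<close> alone exceeds
    \<open>f v0\<close>, so the minimum on the ball is global.\<close>
  have min: "f c \<le> f x" for x
  proof (cases "x \<in> cball v0 (f v0)")
    case False
    then have "f v0 < f x" using f1[OF v0, of x] by simp
    moreover have "f c \<le> f v0" by (rule bspec[OF c v0'])
    ultimately show ?thesis by simp
  qed (rule bspec[OF c])
  have "\<exists>v\<in>S. (f c)\<^sup>2 + 3/4 * (dist x c)\<^sup>2 \<le> (dist x v)\<^sup>2" for x
  proof -
    \<comment> \<open>The point at the fraction \<open>u\<close> of the way from \<open>c\<close> to
      \<open>x\<close> would give the factor \<open>1 - u\<close>; the fraction 1/4 gives 3/4, which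
      suffices for the constants 23 and 27.\<close>
    let ?m = "Xi c x (1/4 * dist c x)"
    obtain v where v: "v \<in> S" "dist v ?m = f ?m" using f2 by blast
    have nn: "0 \<le> f c" using f1[OF v0, of c] zero_le_dist[of v0 c] by linarith
    have "(f c)\<^sup>2 \<le> (dist v ?m)\<^sup>2" using min[of ?m] v(2) nn by (intro power_mono) auto
    also have "\<dots> \<le> (1 - 1/4) * (dist v c)\<^sup>2 + 1/4 * (dist v x)\<^sup>2 - 1/4 * (1 - 1/4) * (dist c x)\<^sup>2"
      by (rule Xi_convex_sq) auto
    also have "\<dots> \<le> (1 - 1/4) * (f c)\<^sup>2 + 1/4 * (dist v x)\<^sup>2 - 1/4 * (1 - 1/4) * (dist c x)\<^sup>2"
      using power_mono[OF f1[OF v(1), of c], of 2] by simp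
    finally have "(f c)\<^sup>2 + 3/4 * (dist x c)\<^sup>2 \<le> (dist x v)\<^sup>2" by (simp add: dist_commute)
    then show ?thesis using v(1) by blast
  qed
  then show ?thesis using f1[of _ c] f2[of c] by (intro exI[of _ c] exI[of _ "f c"]) simp
qed

text \<open>If arbitrarily distant points had geodesics from \<open>x0\<close> passing within
  \<open>n\<close> of \<open>x\<close>, a limit of these geodesics would be a ray that meets the
  closed \<open>n\<close>-ball around \<open>x\<close>.\<close>

lemma bounded_shadow:
  fixes x0 x :: 'a
  assumes "\<And>\<alpha> s. \<alpha> \<in> rays x0 \<Longrightarrow> 0 \<le> s \<Longrightarrow> n < dist (\<alpha> s) x"
  shows "\<exists>m. \<forall>y t. 0 \<le> t \<longrightarrow> dist (Xi x0 y t) x \<le> n \<longrightarrow> dist y x \<le> m"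
proof (rule ccontr)
  assume "\<not> ?thesis"
  then have "\<forall>m::nat. \<exists>y. \<exists>t. 0 \<le> t \<and> dist (Xi x0 y t) x \<le> n \<and> real m < dist y x"
    by (simp add: not_le)
  then obtain y where "\<forall>m::nat. \<exists>t. 0 \<le> t \<and> dist (Xi x0 (y m) t) x \<le> n \<and> real m < dist (y m) x"
    by (rule choice[THEN exE])
  then obtain t where "\<forall>m::nat. 0 \<le> t m \<and> dist (Xi x0 (y m) (t m)) x \<le> n \<and> real m < dist (y m) x"
    by (rule choice[THEN exE])
  then have yt: "0 \<le> t m \<and> dist (Xi x0 (y m) (t m)) x \<le> n \<and> real m < dist (y m) x" for m :: nat
    by (rule spec)
  have "filterlim (\<lambda>m. real m - dist x0 x) at_top \<omega>"
    using filterlim_tendsto_add_at_top[OF tendsto_const[of "- dist x0 x"] real_at_top] by simp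
  moreover have "real m - dist x0 x \<le> dist x0 (y m)" for m
    using yt[of m] dist_triangle[of "y m" x x0] by (simp add: dist_commute)
  ultimately have far: "filterlim (\<lambda>m. dist x0 (y m)) at_top \<omega>"
    by (elim filterlim_at_top_mono) (simp add: always_eventually)
  then obtain \<alpha> where \<alpha>: "\<alpha> \<in> rays x0" "\<And>t. 0 \<le> t \<Longrightarrow> ((\<lambda>m. Xi x0 (y m) t) \<longlongrightarrow> \<alpha> t) \<omega>"
    by (rule limit_ray) blast
  define T where "T = dist x0 x + n"
  \<comment> \<open>A point within \<open>n\<close> of \<open>x\<close> has distance at most
    \<open>T\<close> from \<open>x0\<close>. The endpoint \<open>y m\<close> is farther away, so
    \<open>t m\<close> is the actual distance from \<open>x0\<close> and stays in a compact
    interval.\<close>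
  have "eventually (\<lambda>m. T + 1 \<le> dist x0 (y m)) \<omega>" using far unfolding filterlim_at_top by blast
  then have "eventually (\<lambda>m. t m \<in> {0..T}) \<omega>"
  proof eventually_elim
    case (elim m)
    have le: "dist x0 (Xi x0 (y m) (t m)) \<le> T"
      using yt[of m] dist_triangle[of x0 "Xi x0 (y m) (t m)" x] by (simp add: T_def dist_commute)
    have "t m \<le> dist x0 (y m)"
    proof (rule ccontr)
      assume "\<not> ?thesis"
      then have "Xi x0 (y m) (t m) = y m" by (intro Xi_ge) simp
      then show False using le elim by simp
    qed
    then show ?case using le yt[of m] dist_base_Xi[of "t m" x0 "y m"] by simp
  qed
  then obtain l where l: "l \<in> {0..T}" "(t \<longlongrightarrow> l) \<omega>" by (rule compact_limit[OF compact_Icc])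
  have "((\<lambda>m. \<bar>t m - l\<bar> + dist (Xi x0 (y m) l) (\<alpha> l)) \<longlongrightarrow> 0) \<omega>"
    using l \<alpha>(2)[of l] tendsto_add[OF tendsto_rabs_zero[OF LIM_zero[OF l(2)]] tendsto_dist[OF \<alpha>(2)[of l] tendsto_const[of "\<alpha> l"]]]
    by simp
  moreover have "dist (\<alpha> l) x \<le> (\<bar>t m - l\<bar> + dist (Xi x0 (y m) l) (\<alpha> l)) + n" for m
  proof -
    have "dist (Xi x0 (y m) (t m)) (Xi x0 (y m) l) \<le> \<bar>t m - l\<bar>"
      using yt[of m] l(1) by (intro dist_Xi_le) auto
    then show ?thesis
      using yt[of m] dist_triangle[of "\<alpha> l" x "Xi x0 (y m) l"] dist_triangle[of "Xi x0 (y m) l" x "Xi x0 (y m) (t m)"]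
      by (simp add: dist_commute)
  qed
  ultimately have "dist (\<alpha> l) x \<le> 0 + n"
    by (intro tendsto_lowerbound[OF tendsto_add[OF _ tendsto_const] always_eventually not_bot]) auto
  then show False using assms[OF \<alpha>(1), of l] l(1) by simp
qed

lemma almost_geodesically_complete:
  fixes x0 :: 'a
  assumes cc: "cocompact_space TYPE('a)" and unb: "\<And>B. \<exists>y. B < dist x0 y"
  shows "\<exists>D. \<forall>x. \<exists>\<alpha>\<in>rays x0. \<exists>s\<ge>0. dist (\<alpha> s) x \<le> D"
proof (rule ccontr)
  assume "\<not> ?thesis"
  then have neg: "\<forall>D. \<exists>x. \<forall>\<alpha>\<in>rays x0. \<forall>s\<ge>0. D < dist (\<alpha> s) x" by (simp add: not_le imp_conv_disj)
  obtain C where C: "\<And>(x::'a) (v::'a). \<exists>g\<in>isometry_group. dist (g x) v \<le> C" using cocompact_translate[OF cc] by auto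
  \<comment> \<open>\<open>neg\<close> gives a point far from all rays from \<open>x0\<close>; an
    isometry carries it close to the given \<open>v\<close> and carries \<open>x0\<close> to the
    required \<open>p\<close>, at the cost of the constant \<open>C\<close>.\<close>
  have shadow: "\<exists>m. \<forall>v::'a. \<exists>p. \<forall>y t. 0 \<le> t \<longrightarrow> dist (Xi p y t) v \<le> n \<longrightarrow> dist y v \<le> m" for n
  proof -
    from neg obtain x where "\<forall>\<alpha>\<in>rays x0. \<forall>s\<ge>0. n + C < dist (\<alpha> s) x" by (elim allE exE)
    then have "\<exists>m. \<forall>y t. 0 \<le> t \<longrightarrow> dist (Xi x0 y t) x \<le> n + C \<longrightarrow> dist y x \<le> m"
      by (intro bounded_shadow) simp
    then obtain m where m: "\<forall>y t. 0 \<le> t \<longrightarrow> dist (Xi x0 y t) x \<le> n + C \<longrightarrow> dist y x \<le> m" by (elim exE)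
    have "\<exists>p. \<forall>y t. 0 \<le> t \<longrightarrow> dist (Xi p y t) v \<le> n \<longrightarrow> dist y v \<le> m + C" for v :: 'a
    proof -
      from C[of x v] obtain g where g: "g \<in> isometry_group" "dist (g x) v \<le> C" by (elim bexE)
      obtain h where h: "\<And>x. g (h x) = x" using isometry_group_inverse[OF g(1)] by auto
      have gd: "dist (g x) (g y) = dist x y" for x y by (rule isometry_groupD(2)[OF g(1)])
      have "dist y v \<le> m + C" if t: "0 \<le> t" "dist (Xi (g x0) y t) v \<le> n" for y t
      proof -
        have "Xi (g x0) y t = g (Xi x0 (h y) t)" using Xi_isometry[of g t x0 "h y"] gd t(1) by (simp add: h)
        then have "dist (Xi x0 (h y) t) x \<le> n + C"
          using t(2) g(2) gd[of "Xi x0 (h y) t" x] dist_triangle2[of "g (Xi x0 (h y) t)" "g x" v] by simp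
        then have "dist (h y) x \<le> m" using m t(1) by simp
        then have "dist y (g x) \<le> m" using gd[of "h y" x] by (simp add: h)
        then show ?thesis using g(2) dist_triangle[of y v "g x"] by simp
      qed
      then show ?thesis by (intro exI[of _ "g x0"] allI impI)
    qed
    then show ?thesis by (intro exI[of _ "m + C"] allI)
  qed
  obtain V :: "'a set" where V: "\<And>u v. u \<in> V \<Longrightarrow> v \<in> V \<Longrightarrow> u \<noteq> v \<Longrightarrow> 1 < dist u v"
    "\<And>x. \<exists>v\<in>V. dist v x \<le> 1" using exists_separated_net by auto
  \<comment> \<open>The bound is uniform in the centre: balls are moved near \<open>x0\<close>, and
    there a 1-separated set has at most one point in each ball of radius 1/2 of a finite
    cover.\<close>
  have fin: "\<exists>N. \<forall>x. finite (V \<inter> cball x r) \<and> card (V \<inter> cball x r) \<le> N" for r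
  proof -
    have "cball x0 (r + C) \<subseteq> (\<Union>c\<in>cball x0 (r + C). ball c (1/2))" by auto
    then obtain F where F: "F \<subseteq> cball x0 (r + C)" "finite F" "cball x0 (r + C) \<subseteq> (\<Union>c\<in>F. ball c (1/2))"
      using compactE_image[OF compact_cball_proper, of "cball x0 (r + C)" "\<lambda>c. ball c (1/2)" x0 "r + C"] by auto
    have "finite (V \<inter> cball x r) \<and> card (V \<inter> cball x r) \<le> card F" for x
    proof -
      from C[of x0 x] obtain g where g: "g \<in> isometry_group" "dist (g x0) x \<le> C" by (elim bexE)
      obtain h where h: "\<And>x. g (h x) = x" using isometry_group_inverse[OF g(1)] by auto
      have gd: "dist (g x) (g y) = dist x y" for x y by (rule isometry_groupD(2)[OF g(1)])
      have hd: "dist (h x) (h y) = dist x y" for x y using gd[of "h x" "h y"] by (simp add: h)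
      have "\<exists>c\<in>F. dist c (h u) < 1/2" if u: "u \<in> V \<inter> cball x r" for u
      proof -
        have "dist x0 (h u) \<le> r + C"
          using gd[of x0 "h u"] u g(2) dist_triangle[of "g x0" u x] by (simp add: h)
        then have "h u \<in> cball x0 (r + C)" by simp
        then have "h u \<in> (\<Union>c\<in>F. ball c (1/2))" by (rule subsetD[OF F(3)])
        then show ?thesis by (simp add: Bex_def)
      qed
      then have "\<forall>u\<in>V \<inter> cball x r. \<exists>c. c \<in> F \<and> dist c (h u) < 1/2" by (simp add: Bex_def)
      then obtain c where "\<forall>u\<in>V \<inter> cball x r. c u \<in> F \<and> dist (c u) (h u) < 1/2"
        by (rule bchoice[THEN exE])
      then have c: "c u \<in> F \<and> dist (c u) (h u) < 1/2" if "u \<in> V \<inter> cball x r" for u using that by (rule bspec)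
      have inj: "inj_on c (V \<inter> cball x r)"
      proof (rule inj_onI)
        fix u v assume uv: "u \<in> V \<inter> cball x r" "v \<in> V \<inter> cball x r" "c u = c v"
        have "dist (h u) (h v) < 1"
          using c[OF uv(1)] c[OF uv(2)] uv(3) dist_triangle[of "h u" "h v" "c u"] by (simp add: dist_commute)
        then show "u = v" using V(1)[of u v] uv hd[of u v] by force
      qed
      have img: "c ` (V \<inter> cball x r) \<subseteq> F" by (rule image_subsetI) (use c in simp)
      show ?thesis by (intro conjI inj_on_finite[OF inj img F(2)] card_inj_on_le[OF inj img F(2)])
    qed
    then show ?thesis by (intro exI[of _ "card F"] allI)
  qed
  have "\<forall>x. \<exists>v. v \<in> V \<and> dist v x \<le> 1" using V(2) by (simp add: Bex_def)
  then obtain rd where "\<forall>x. rd x \<in> V \<and> dist (rd x) x \<le> 1" by (rule choice[THEN exE])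
  then have rd: "rd x \<in> V \<and> dist (rd x) x \<le> 1" for x by (rule spec)
  have "\<forall>\<sigma>::'a fset. \<exists>c. \<sigma> \<noteq> {||} \<longrightarrow> (\<exists>r. (\<forall>v\<in>fset \<sigma>. dist v c \<le> r) \<and> (\<exists>v\<in>fset \<sigma>. dist v c = r) \<and>
    (\<forall>x. \<exists>v\<in>fset \<sigma>. r\<^sup>2 + 3/4 * (dist x c)\<^sup>2 \<le> (dist x v)\<^sup>2))"
  proof
    fix \<sigma> :: "'a fset"
    show "\<exists>c. \<sigma> \<noteq> {||} \<longrightarrow> (\<exists>r. (\<forall>v\<in>fset \<sigma>. dist v c \<le> r) \<and> (\<exists>v\<in>fset \<sigma>. dist v c = r) \<and>
      (\<forall>x. \<exists>v\<in>fset \<sigma>. r\<^sup>2 + 3/4 * (dist x c)\<^sup>2 \<le> (dist x v)\<^sup>2))"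
    proof (cases "\<sigma> = {||}")
      case False
      then have "fset \<sigma> \<noteq> {}" by auto
      from exists_circumcenter[OF finite_fset this] show ?thesis by (elim exE) (intro exI impI)
    qed simp
  qed
  then obtain ctr :: "'a fset \<Rightarrow> 'a" where "\<forall>\<sigma>. \<sigma> \<noteq> {||} \<longrightarrow> (\<exists>r. (\<forall>v\<in>fset \<sigma>. dist v (ctr \<sigma>) \<le> r) \<and> (\<exists>v\<in>fset \<sigma>. dist v (ctr \<sigma>) = r) \<and>
    (\<forall>x. \<exists>v\<in>fset \<sigma>. r\<^sup>2 + 3/4 * (dist x (ctr \<sigma>))\<^sup>2 \<le> (dist x v)\<^sup>2))"
    by (rule choice[THEN exE])
  then have ctr: "\<exists>r. (\<forall>v\<in>fset \<sigma>. dist v (ctr \<sigma>) \<le> r) \<and> (\<exists>v\<in>fset \<sigma>. dist v (ctr \<sigma>) = r) \<and>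
    (\<forall>x. \<exists>v\<in>fset \<sigma>. r\<^sup>2 + 3/4 * (dist x (ctr \<sigma>))\<^sup>2 \<le> (dist x v)\<^sup>2)" if "\<sigma> \<noteq> {||}" for \<sigma>
    using that by simp
  have rad: "dist v (ctr \<sigma>) ^ 2 \<le> 3600 / 7" if \<sigma>: "\<sigma> \<in> rips 30 V" and v: "v |\<in>| \<sigma>" for v \<sigma>
  proof -
    have "\<sigma> \<noteq> {||}" using v by auto
    then obtain r where r: "\<And>v. v |\<in>| \<sigma> \<Longrightarrow> dist v (ctr \<sigma>) \<le> r" "\<exists>v\<in>fset \<sigma>. dist v (ctr \<sigma>) = r"
      "\<And>x. \<exists>v\<in>fset \<sigma>. r\<^sup>2 + 3/4 * (dist x (ctr \<sigma>))\<^sup>2 \<le> (dist x v)\<^sup>2" using ctr[of \<sigma>] by auto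
    obtain w where w: "w |\<in>| \<sigma>" "dist w (ctr \<sigma>) = r" using r(2) by auto
    \<comment> \<open>Applied to a point \<open>w\<close> at distance \<open>r\<close> from the
      centre, the circumcentre inequality makes \<open>7/4 * r\<^sup>2\<close> a lower bound for the
      square of a distance between vertices.\<close>
    obtain u where u: "u |\<in>| \<sigma>" "r\<^sup>2 + 3/4 * r\<^sup>2 \<le> (dist w u)\<^sup>2" using r(3)[of w] w(2) by auto
    have "dist w u \<le> 30" using \<sigma> u(1) w(1) by (simp add: rips_def)
    then have "(dist w u)\<^sup>2 \<le> 30\<^sup>2" by (intro power_mono) auto
    then have "r\<^sup>2 \<le> 3600 / 7" using u(2) by simp
    moreover have "(dist v (ctr \<sigma>))\<^sup>2 \<le> r\<^sup>2" using r(1)[OF v] by (intro power_mono) auto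
    ultimately show ?thesis by simp
  qed
  interpret net: cat0_net ty V rd ctr
  proof
    show "rd x \<in> V" "dist (rd x) x \<le> 1" for x using rd by auto
    show "dist v (ctr \<sigma>) \<le> 23" if "\<sigma> \<in> rips 30 V" "v |\<in>| \<sigma>" for v \<sigma>
      by (rule power2_le_imp_le) (use rad[OF that] in auto)
    show "dist (ctr \<tau>) (ctr \<sigma>) \<le> 27" if \<sigma>: "\<sigma> \<in> rips 30 V" and \<tau>: "\<tau> |\<subseteq>| \<sigma>" "\<tau> \<noteq> {||}" for \<tau> \<sigma>
    proof -
      from ctr[OF \<tau>(2)] obtain r where "\<forall>x. \<exists>v\<in>fset \<tau>. r\<^sup>2 + 3/4 * (dist x (ctr \<tau>))\<^sup>2 \<le> (dist x v)\<^sup>2"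
        by (elim exE conjE)
      \<comment> \<open>The inequality for the centre of the face \<open>\<tau>\<close> is tested at
        the centre of \<open>\<sigma>\<close>, whose distance from every vertex is bounded by
        \<open>rad\<close>.\<close>
      then have "\<exists>v\<in>fset \<tau>. r\<^sup>2 + 3/4 * (dist (ctr \<sigma>) (ctr \<tau>))\<^sup>2 \<le> (dist (ctr \<sigma>) v)\<^sup>2" by (rule spec)
      then obtain v where v: "v |\<in>| \<tau>" "r\<^sup>2 + 3/4 * (dist (ctr \<sigma>) (ctr \<tau>))\<^sup>2 \<le> (dist (ctr \<sigma>) v)\<^sup>2"
        by (elim bexE)
      have "(dist v (ctr \<sigma>))\<^sup>2 \<le> 3600 / 7" using rad[OF \<sigma>, of v] v(1) \<tau>(1) by auto
      moreover have "0 \<le> r\<^sup>2" by simp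
      ultimately have "(dist (ctr \<sigma>) (ctr \<tau>))\<^sup>2 \<le> 729"
        using v(2) unfolding dist_commute[of "ctr \<sigma>" v] by linarith
      then show ?thesis by - (rule power2_le_imp_le, simp_all add: dist_commute)
    qed
  qed
  obtain N where N: "\<And>x. finite (V \<inter> cball x 30) \<and> card (V \<inter> cball x 30) \<le> N" using fin[of 30] by auto
  show False
  proof (rule no_local_contractions[where S = "rips 30 V" and D = 30 and N = N and w = "rd x0"])
    fix \<tau> :: "'a fset" and R :: real assume \<tau>: "\<tau> \<in> rips 30 V" "\<tau> \<noteq> {||}"
    then obtain y where y: "y |\<in>| \<tau>" by auto
    have "finite (fset -` Pow (V \<inter> cball y R))"
    proof (rule finite_vimageI)
      have "finite (V \<inter> cball y R)" using fin[of R] by auto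
      then show "finite (Pow (V \<inter> cball y R))" by (simp only: finite_Pow_iff)
      show "inj fset" by (simp add: inj_def fset_inject)
    qed
    moreover have "{\<sigma> \<in> rips 30 V. \<forall>x\<in>fset \<sigma>. \<forall>y\<in>fset \<tau>. dist x y \<le> R} \<subseteq> fset -` Pow (V \<inter> cball y R)"
      using y by (auto simp: rips_def dist_commute)
    ultimately show "finite {\<sigma> \<in> rips 30 V. \<forall>x\<in>fset \<sigma>. \<forall>y\<in>fset \<tau>. dist x y \<le> R}" by (rule rev_finite_subset)
  next
    show "fcard \<sigma> \<le> N" if \<sigma>: "\<sigma> \<in> rips 30 V" for \<sigma>
    proof (cases "\<sigma> = {||}")
      case False
      then obtain y where y: "y |\<in>| \<sigma>" by auto
      have "fset \<sigma> \<subseteq> V \<inter> cball y 30" using \<sigma> y by (auto simp: rips_def)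
      then have "card (fset \<sigma>) \<le> card (V \<inter> cball y 30)" using N by (intro card_mono) auto
      then show ?thesis using N[of y] by (simp add: fcard.rep_eq)
    qed simp
  next
    fix n :: real
    \<comment> \<open>A vertex of the contraction that is within \<open>n\<close> of
      \<open>v\<close> is within 54 of a geodesic from \<open>p\<close>, which therefore passes
      within \<open>n + 54\<close> of \<open>v\<close>.\<close>
    from shadow[of "n + 54"] obtain m where
      m: "\<forall>v::'a. \<exists>p. \<forall>y t. 0 \<le> t \<longrightarrow> dist (Xi p y t) v \<le> n + 54 \<longrightarrow> dist y v \<le> m" by (elim exE)
    show "\<exists>m. \<forall>v. {|v|} \<in> rips 30 V \<longrightarrow> (\<exists>H.
      (\<forall>\<sigma>. \<sigma> \<in> rips 30 V \<longrightarrow> Poly_Mapping.keys (H \<sigma>) \<subseteq> {\<rho> \<in> rips 30 V. fcard \<rho> = Suc (fcard \<sigma>)} \<and>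
         bdry (H \<sigma>) + lin H (face_sum \<sigma>) = bas \<sigma>) \<and>
      (\<forall>\<sigma> \<rho> u w. \<sigma> \<in> rips 30 V \<longrightarrow> \<rho> \<in> Poly_Mapping.keys (H \<sigma>) \<longrightarrow> u |\<in>| \<rho> \<longrightarrow> dist u v \<le> n \<longrightarrow>
         \<sigma> \<noteq> {||} \<and> (w |\<in>| \<sigma> \<longrightarrow> dist w v \<le> m)))"
    proof (rule exI[of _ m], rule allI, rule impI)
      fix v :: 'a
      from spec[OF m, of v] obtain p where
        "\<forall>y t. 0 \<le> t \<longrightarrow> dist (Xi p y t) v \<le> n + 54 \<longrightarrow> dist y v \<le> m" by (elim exE)
      then have p: "dist y v \<le> m" if "0 \<le> t" "dist (Xi p y t) v \<le> n + 54" for y t using that by simp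
      \<comment> \<open>For \<open>t = 0\<close> the shadow condition concerns \<open>p\<close>
        itself: were \<open>p\<close> close to \<open>v\<close>, the whole space would be within
        \<open>m\<close> of \<open>v\<close>.\<close>
      have far: "n + 54 < dist p v"
      proof (rule ccontr)
        assume "\<not> ?thesis"
        then have a: "dist y v \<le> m" for y using p[of 0 y] by simp
        from unb[of "m + dist x0 v"] obtain y where "m + dist x0 v < dist x0 y" by (elim exE)
        then show False using a[of y] dist_triangle2[of x0 y v] by simp
      qed
      show "\<exists>H. (\<forall>\<sigma>. \<sigma> \<in> rips 30 V \<longrightarrow> Poly_Mapping.keys (H \<sigma>) \<subseteq> {\<rho> \<in> rips 30 V. fcard \<rho> = Suc (fcard \<sigma>)} \<and>
         bdry (H \<sigma>) + lin H (face_sum \<sigma>) = bas \<sigma>) \<and>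
      (\<forall>\<sigma> \<rho> u w. \<sigma> \<in> rips 30 V \<longrightarrow> \<rho> \<in> Poly_Mapping.keys (H \<sigma>) \<longrightarrow> u |\<in>| \<rho> \<longrightarrow> dist u v \<le> n \<longrightarrow>
         \<sigma> \<noteq> {||} \<and> (w |\<in>| \<sigma> \<longrightarrow> dist w v \<le> m))"
      proof (rule exI[of _ "net.contraction p"], intro conjI allI impI)
        fix \<sigma> assume \<sigma>: "\<sigma> \<in> rips 30 V"
        show "Poly_Mapping.keys (net.contraction p \<sigma>) \<subseteq> {\<rho> \<in> rips 30 V. fcard \<rho> = Suc (fcard \<sigma>)}"
          by (rule subsetI) (simp add: net.keys_contraction(1,2)[OF \<sigma>])
        show "bdry (net.contraction p \<sigma>) + lin (net.contraction p) (face_sum \<sigma>) = bas \<sigma>"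
          by (rule net.bdry_contraction[OF \<sigma>])
        fix \<rho> u w assume \<rho>: "\<rho> \<in> Poly_Mapping.keys (net.contraction p \<sigma>)" "u |\<in>| \<rho>" "dist u v \<le> n"
        note k = net.keys_contraction(3)[OF \<sigma> \<rho>(1,2)]
        have "u \<noteq> rd p"
        proof
          assume "u = rd p"
          then show False
            using far \<rho>(3) rd[of p] dist_triangle[of p v "rd p"] unfolding dist_commute[of p "rd p"] by simp
        qed
        then show "\<sigma> \<noteq> {||}" using k by simp
        assume w: "w |\<in>| \<sigma>"
        then have "\<exists>i::nat. dist u (Xi p w i) \<le> 54" using k \<open>u \<noteq> rd p\<close> by simp
        then obtain i :: nat where "dist u (Xi p w i) \<le> 54" by (elim exE)
        then have "dist (Xi p w i) v \<le> n + 54"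
          using \<rho>(3) dist_triangle[of "Xi p w i" v u] by (simp add: dist_commute)
        then show "dist w v \<le> m" using p[of "real i" w] by simp
      qed
    qed
  next
    show "\<tau> \<in> rips 30 V" if "\<sigma> \<in> rips 30 V" "\<tau> |\<subseteq>| \<sigma>" for \<sigma> \<tau> using rips_mono that .
    show "{|rd x0|} \<in> rips 30 V" using rd by (simp add: rips_def)
  qed (simp add: rips_def)
qed

end

section \<open>Angles between rays\<close>

lemma mono_bounded_tendsto_at_top:
  fixes f :: "real \<Rightarrow> real"
  assumes mono: "\<And>s t. 0 < s \<Longrightarrow> s \<le> t \<Longrightarrow> f s \<le> f t" and B: "\<And>t. 0 < t \<Longrightarrow> f t \<le> B"
  shows "(f \<longlongrightarrow> Sup (f ` {0<..})) at_top" "0 < t \<Longrightarrow> f t \<le> Sup (f ` {0<..})"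
proof -
  have bdd: "bdd_above (f ` {0<..})" by (rule bdd_aboveI2[of _ f B]) (simp add: B)
  show up: "f t \<le> Sup (f ` {0<..})" if "0 < t" for t using that bdd by (intro cSup_upper) auto
  show "(f \<longlongrightarrow> Sup (f ` {0<..})) at_top"
  proof (rule order_tendstoI)
    fix a assume "a < Sup (f ` {0<..})"
    then obtain t where t: "0 < t" "a < f t" using less_cSup_iff[OF _ bdd] by auto
    show "eventually (\<lambda>x. a < f x) at_top"
      by (rule eventually_mono[OF eventually_ge_at_top[of t]]) (use t mono in \<open>auto intro: less_le_trans\<close>)
  next
    fix a assume a: "Sup (f ` {0<..}) < a"
    show "eventually (\<lambda>x. f x < a) at_top"
      by (rule eventually_mono[OF eventually_gt_at_top[of 0]]) (use up a in \<open>auto intro: le_less_trans\<close>)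
  qed
qed

text \<open>The chord of the unit circle that subtends the angle between the rays. For rays from one
  point the ratios increase with \<open>t\<close>, so the supremum is their limit.\<close>

definition asymptotic_ratio :: "(real \<Rightarrow> 'a::metric_space) \<Rightarrow> (real \<Rightarrow> 'a) \<Rightarrow> real" where
  "asymptotic_ratio \<alpha> \<beta> = Sup ((\<lambda>t. dist (\<alpha> t) (\<beta> t) / t) ` {0<..})"

context cat0_space
begin

context
  fixes x0 :: 'a
begin

lemma ray_compare:
  assumes "\<alpha> \<in> rays x0" "\<beta> \<in> rays x0" "0 \<le> s" "s \<le> s'" "0 \<le> t" "t \<le> t'"
  shows "(dist (\<alpha> s) (\<beta> t))\<^sup>2 \<le> s\<^sup>2 + t\<^sup>2 - s * t / (s' * t') * (s'\<^sup>2 + t'\<^sup>2 - (dist (\<alpha> s') (\<beta> t'))\<^sup>2)"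
  using Xi_compare[of s x0 "\<alpha> s'" t "\<beta> t'"] assms
  by (simp add: Xi_geodesic_ray ray_dist_base)

lemma ray_ratio_mono:
  assumes "\<alpha> \<in> rays x0" "\<beta> \<in> rays x0" "0 < s" "s \<le> t"
  shows "dist (\<alpha> s) (\<beta> s) / s \<le> dist (\<alpha> t) (\<beta> t) / t"
proof -
  have "dist (\<alpha> s) (\<beta> s) \<le> s / t * dist (\<alpha> t) (\<beta> t)"
    using Xi_contract[of "s / t" x0 "\<alpha> t" "\<beta> t"] assms
    by (simp add: Xi_geodesic_ray ray_dist_base)
  then show ?thesis using assms by (simp add: field_simps)
qed

lemma ray_ratio_le_2:
  assumes "\<alpha> \<in> rays x0" "\<beta> \<in> rays x0" "0 < t"
  shows "dist (\<alpha> t) (\<beta> t) / t \<le> 2"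
  using dist_triangle3[of "\<alpha> t" "\<beta> t" x0] ray_dist_base[of \<alpha> x0 t] ray_dist_base[of \<beta> x0 t] assms
  by (simp add: field_simps)

lemma asymptotic_ratio:
  assumes "\<alpha> \<in> rays x0" "\<beta> \<in> rays x0"
  shows "((\<lambda>t. dist (\<alpha> t) (\<beta> t) / t) \<longlongrightarrow> asymptotic_ratio \<alpha> \<beta>) at_top"
    and "0 < t \<Longrightarrow> dist (\<alpha> t) (\<beta> t) / t \<le> asymptotic_ratio \<alpha> \<beta>"
  unfolding asymptotic_ratio_def
  using mono_bounded_tendsto_at_top[of "\<lambda>t. dist (\<alpha> t) (\<beta> t) / t" 2] ray_ratio_mono[OF assms] ray_ratio_le_2[OF assms]
  by auto

lemma asymptotic_ratio_le:
  assumes "\<alpha> \<in> rays x0" "\<beta> \<in> rays x0" "\<And>t. 0 < t \<Longrightarrow> dist (\<alpha> t) (\<beta> t) / t \<le> c"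
  shows "asymptotic_ratio \<alpha> \<beta> \<le> c"
  unfolding asymptotic_ratio_def using assms(3) by (intro cSup_least) auto

lemma asymptotic_ratio_bounds:
  assumes "\<alpha> \<in> rays x0" "\<beta> \<in> rays x0"
  shows "0 \<le> asymptotic_ratio \<alpha> \<beta>" "asymptotic_ratio \<alpha> \<beta> \<le> 2"
proof -
  show "asymptotic_ratio \<alpha> \<beta> \<le> 2" using asymptotic_ratio_le[OF assms] ray_ratio_le_2[OF assms] by simp
  have "0 \<le> dist (\<alpha> 1) (\<beta> 1) / 1" by simp
  also have "\<dots> \<le> asymptotic_ratio \<alpha> \<beta>" by (rule asymptotic_ratio(2)[OF assms]) simp
  finally show "0 \<le> asymptotic_ratio \<alpha> \<beta>" .
qed

lemma ray_angle_eq: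
  assumes \<alpha>: "\<alpha> \<in> rays x0" and \<beta>: "\<beta> \<in> rays x0"
  shows "ray_angle x0 \<alpha> \<beta> = arccos (1 - (asymptotic_ratio \<alpha> \<beta>)\<^sup>2 / 2)"
proof -
  let ?f = "\<lambda>t. 1 - (dist (\<alpha> t) (\<beta> t) / t)\<^sup>2 / 2"
  have range: "1 - u\<^sup>2 / 2 \<in> {-1..1}" if "0 \<le> u" "u \<le> 2" for u :: real
    using power_mono[OF that(2,1), of 2] by simp
  have lim: "(?f \<longlongrightarrow> 1 - (asymptotic_ratio \<alpha> \<beta>)\<^sup>2 / 2) at_top"
    by (intro tendsto_intros asymptotic_ratio(1)[OF \<alpha> \<beta>]) simp
  have "((\<lambda>t. arccos (?f t)) \<longlongrightarrow> arccos (1 - (asymptotic_ratio \<alpha> \<beta>)\<^sup>2 / 2)) at_top"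
  proof (rule continuous_on_tendsto_compose[OF continuous_on_arccos' lim])
    show "1 - (asymptotic_ratio \<alpha> \<beta>)\<^sup>2 / 2 \<in> {-1..1}" by (rule range[OF asymptotic_ratio_bounds[OF \<alpha> \<beta>]])
    show "eventually (\<lambda>t. ?f t \<in> {-1..1}) at_top"
      using eventually_gt_at_top[of 0]
      by eventually_elim (rule range, simp, rule ray_ratio_le_2[OF \<alpha> \<beta>])
  qed
  moreover have "eventually (\<lambda>t. arccos (?f t) = comparison_angle x0 (\<alpha> t) (\<beta> t)) at_top"
    using eventually_gt_at_top[of 0]
  proof eventually_elim
    case (elim t)
    then have "?f t = (t\<^sup>2 + t\<^sup>2 - (dist (\<alpha> t) (\<beta> t))\<^sup>2) / (2 * t * t)"
      by (simp add: field_simps power2_eq_square)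
    then show ?case
      using elim ray_dist_base[OF \<alpha>, of t] ray_dist_base[OF \<beta>, of t]
      by (simp only: comparison_angle_def less_imp_le)
  qed
  ultimately have "((\<lambda>t. comparison_angle x0 (\<alpha> t) (\<beta> t)) \<longlongrightarrow> arccos (1 - (asymptotic_ratio \<alpha> \<beta>)\<^sup>2 / 2)) at_top"
    by (rule Lim_transform_eventually)
  then show ?thesis unfolding ray_angle_def by (intro tendsto_Lim) simp_all
qed

lemma ray_angle_facts:
  assumes \<alpha>: "\<alpha> \<in> rays x0" and \<beta>: "\<beta> \<in> rays x0"
  shows cos_ray_angle: "cos (ray_angle x0 \<alpha> \<beta>) = 1 - (asymptotic_ratio \<alpha> \<beta>)\<^sup>2 / 2"
    and ray_angle_nonneg: "0 \<le> ray_angle x0 \<alpha> \<beta>" and ray_angle_le_pi: "ray_angle x0 \<alpha> \<beta> \<le> pi"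
proof -
  have "(asymptotic_ratio \<alpha> \<beta>)\<^sup>2 \<le> 2\<^sup>2"
    using asymptotic_ratio_bounds[OF assms] by (intro power_mono) auto
  then have *: "-1 \<le> 1 - (asymptotic_ratio \<alpha> \<beta>)\<^sup>2 / 2" "1 - (asymptotic_ratio \<alpha> \<beta>)\<^sup>2 / 2 \<le> 1" by auto
  show "cos (ray_angle x0 \<alpha> \<beta>) = 1 - (asymptotic_ratio \<alpha> \<beta>)\<^sup>2 / 2"
    unfolding ray_angle_eq[OF assms] using * by (rule cos_arccos)
  show "0 \<le> ray_angle x0 \<alpha> \<beta>" "ray_angle x0 \<alpha> \<beta> \<le> pi"
    unfolding ray_angle_eq[OF assms] using * by (auto intro: arccos_lbound arccos_ubound)
qed

text \<open>An upper bound for the angle becomes a closed condition on the pairs of points at equal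
  parameters, in place of a limit; this makes it stable under pointwise limits of rays.\<close>

lemma ray_angle_le_iff:
  assumes \<alpha>: "\<alpha> \<in> rays x0" and \<beta>: "\<beta> \<in> rays x0" and c: "0 \<le> c" "c \<le> pi"
  shows "ray_angle x0 \<alpha> \<beta> \<le> c \<longleftrightarrow> (\<forall>t>0. (dist (\<alpha> t) (\<beta> t))\<^sup>2 \<le> t\<^sup>2 * (2 - 2 * cos c))"
proof -
  let ?l = "asymptotic_ratio \<alpha> \<beta>"
  have "ray_angle x0 \<alpha> \<beta> \<le> c \<longleftrightarrow> cos c \<le> cos (ray_angle x0 \<alpha> \<beta>)"
    using ray_angle_facts(2,3)[OF \<alpha> \<beta>] c by (simp add: cos_mono_le_eq)
  also have "\<dots> \<longleftrightarrow> ?l\<^sup>2 \<le> 2 - 2 * cos c" unfolding cos_ray_angle[OF \<alpha> \<beta>] by auto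
  also have "\<dots> \<longleftrightarrow> (\<forall>t>0. (dist (\<alpha> t) (\<beta> t))\<^sup>2 \<le> t\<^sup>2 * (2 - 2 * cos c))"
  proof
    assume l: "?l\<^sup>2 \<le> 2 - 2 * cos c"
    show "\<forall>t>0. (dist (\<alpha> t) (\<beta> t))\<^sup>2 \<le> t\<^sup>2 * (2 - 2 * cos c)"
    proof (intro allI impI)
      fix t :: real assume t: "0 < t"
      have "(dist (\<alpha> t) (\<beta> t) / t)\<^sup>2 \<le> ?l\<^sup>2"
        using asymptotic_ratio(2)[OF \<alpha> \<beta> t] t by (intro power_mono) auto
      then have "(dist (\<alpha> t) (\<beta> t) / t)\<^sup>2 \<le> 2 - 2 * cos c" using l by simp
      then show "(dist (\<alpha> t) (\<beta> t))\<^sup>2 \<le> t\<^sup>2 * (2 - 2 * cos c)"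
        using t by (simp add: power_divide field_simps)
    qed
  next
    assume r: "\<forall>t>0. (dist (\<alpha> t) (\<beta> t))\<^sup>2 \<le> t\<^sup>2 * (2 - 2 * cos c)"
    have "?l \<le> sqrt (2 - 2 * cos c)"
    proof (rule asymptotic_ratio_le[OF \<alpha> \<beta>])
      fix t :: real assume t: "0 < t"
      then have "(dist (\<alpha> t) (\<beta> t) / t)\<^sup>2 \<le> 2 - 2 * cos c"
        using r by (simp add: power_divide field_simps)
      then show "dist (\<alpha> t) (\<beta> t) / t \<le> sqrt (2 - 2 * cos c)" by (rule real_le_rsqrt)
    qed
    then have "?l\<^sup>2 \<le> (sqrt (2 - 2 * cos c))\<^sup>2"
      using asymptotic_ratio_bounds(1)[OF \<alpha> \<beta>] by (intro power_mono)
    then show "?l\<^sup>2 \<le> 2 - 2 * cos c" by (simp add: cos_le_one)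
  qed
  finally show ?thesis .
qed

lemma ray_dist_le_angle:
  assumes "\<alpha> \<in> rays x0" "\<beta> \<in> rays x0" "0 \<le> t"
  shows "dist (\<alpha> t) (\<beta> t) \<le> t * sqrt (2 - 2 * cos (ray_angle x0 \<alpha> \<beta>))"
proof (cases "t = 0")
  case True
  then show ?thesis using ray_0[OF assms(1)] ray_0[OF assms(2)] by simp
next
  case False
  then have "(dist (\<alpha> t) (\<beta> t))\<^sup>2 \<le> t\<^sup>2 * (2 - 2 * cos (ray_angle x0 \<alpha> \<beta>))"
    using ray_angle_le_iff[OF assms(1,2), of "ray_angle x0 \<alpha> \<beta>"] ray_angle_facts[OF assms(1,2)] assms(3) by simp
  then have "dist (\<alpha> t) (\<beta> t) \<le> sqrt (t\<^sup>2 * (2 - 2 * cos (ray_angle x0 \<alpha> \<beta>)))" by (rule real_le_rsqrt)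
  then show ?thesis using assms(3) by (simp add: real_sqrt_mult)
qed

lemma ray_angle_commute: "\<alpha> \<in> rays x0 \<Longrightarrow> \<beta> \<in> rays x0 \<Longrightarrow> ray_angle x0 \<alpha> \<beta> = ray_angle x0 \<beta> \<alpha>"
  by (simp add: ray_angle_eq asymptotic_ratio_def dist_commute)

lemma ray_angle_self: "\<alpha> \<in> rays x0 \<Longrightarrow> ray_angle x0 \<alpha> \<alpha> = 0"
  using ray_angle_le_iff[of \<alpha> \<alpha> 0] ray_angle_nonneg[of \<alpha> \<alpha>] by simp

lemma ray_angle_0_imp_eq:
  assumes "\<alpha> \<in> rays x0" "\<beta> \<in> rays x0" "ray_angle x0 \<alpha> \<beta> = 0"
  shows "\<alpha> = \<beta>"
proof (rule rays_eqI[OF assms(1,2)])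
  fix t :: real assume "0 \<le> t"
  then show "\<alpha> t = \<beta> t" using ray_dist_le_angle[OF assms(1,2), of t] assms(3) by simp
qed

text \<open>\<open>q\<close> is the cosine of the comparison angle at unequal parameters. It
  decreases in each parameter, so it is squeezed between its values on the diagonal, where the limit
  is known.\<close>

lemma ray_cone_limit:
  assumes \<alpha>: "\<alpha> \<in> rays x0" and \<beta>: "\<beta> \<in> rays x0" and st: "0 < s" "0 < t"
  shows "((\<lambda>R. dist (\<alpha> (s * R)) (\<beta> (t * R)) / R) \<longlongrightarrow>
    sqrt (s\<^sup>2 + t\<^sup>2 - 2 * s * t * cos (ray_angle x0 \<alpha> \<beta>))) at_top"
proof -
  define q where "q a b = (a\<^sup>2 + b\<^sup>2 - (dist (\<alpha> a) (\<beta> b))\<^sup>2) / (2 * a * b)" for a b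
  have qm: "q a' b' \<le> q a b" if "0 < a" "a \<le> a'" "0 < b" "b \<le> b'" for a b a' b'
  proof -
    have "(dist (\<alpha> a) (\<beta> b))\<^sup>2 \<le> a\<^sup>2 + b\<^sup>2 - a * b / (a' * b') * (a'\<^sup>2 + b'\<^sup>2 - (dist (\<alpha> a') (\<beta> b'))\<^sup>2)"
      using ray_compare[OF \<alpha> \<beta>] that by simp
    also have "\<dots> = a\<^sup>2 + b\<^sup>2 - 2 * a * b * q a' b'" using that by (simp add: q_def)
    finally show ?thesis unfolding q_def[of a b] using that by (simp add: field_simps)
  qed
  have diag: "((\<lambda>R. q (c * R) (c * R)) \<longlongrightarrow> cos (ray_angle x0 \<alpha> \<beta>)) at_top" if c: "0 < c" for c
  proof -
    have "((\<lambda>t. 1 - (dist (\<alpha> t) (\<beta> t) / t)\<^sup>2 / 2) \<longlongrightarrow> cos (ray_angle x0 \<alpha> \<beta>)) at_top"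
      unfolding cos_ray_angle[OF \<alpha> \<beta>] by (intro tendsto_intros asymptotic_ratio(1)[OF \<alpha> \<beta>]) simp
    moreover have "filterlim (\<lambda>R. c * R) at_top at_top"
      using c by (intro filterlim_tendsto_pos_mult_at_top[OF tendsto_const] filterlim_ident)
    ultimately have "((\<lambda>R. 1 - (dist (\<alpha> (c * R)) (\<beta> (c * R)) / (c * R))\<^sup>2 / 2) \<longlongrightarrow> cos (ray_angle x0 \<alpha> \<beta>)) at_top"
      by (rule filterlim_compose)
    moreover have "eventually (\<lambda>R. 1 - (dist (\<alpha> (c * R)) (\<beta> (c * R)) / (c * R))\<^sup>2 / 2 = q (c * R) (c * R)) at_top"
      using eventually_gt_at_top[of 0]
    proof eventually_elim
      case (elim R)
      then show ?case using c unfolding q_def by (simp add: power2_eq_square diff_divide_distrib)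
    qed
    ultimately show ?thesis by (rule Lim_transform_eventually)
  qed
  have q: "((\<lambda>R. q (s * R) (t * R)) \<longlongrightarrow> cos (ray_angle x0 \<alpha> \<beta>)) at_top"
  proof (rule tendsto_sandwich[OF _ _ diag[of "max s t"] diag[of "min s t"]])
    show "eventually (\<lambda>R. q (max s t * R) (max s t * R) \<le> q (s * R) (t * R)) at_top"
      using eventually_gt_at_top[of 0] by eventually_elim (use st in \<open>auto intro!: qm mult_right_mono\<close>)
    show "eventually (\<lambda>R. q (s * R) (t * R) \<le> q (min s t * R) (min s t * R)) at_top"
      using eventually_gt_at_top[of 0] by eventually_elim (use st in \<open>auto intro!: qm mult_right_mono simp: min_less_iff_conj\<close>)
  qed (use st in auto)
  have "((\<lambda>R. sqrt (s\<^sup>2 + t\<^sup>2 - 2 * s * t * q (s * R) (t * R))) \<longlongrightarrow>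
      sqrt (s\<^sup>2 + t\<^sup>2 - 2 * s * t * cos (ray_angle x0 \<alpha> \<beta>))) at_top"
    by (intro tendsto_intros q)
  moreover have "eventually (\<lambda>R. sqrt (s\<^sup>2 + t\<^sup>2 - 2 * s * t * q (s * R) (t * R)) = dist (\<alpha> (s * R)) (\<beta> (t * R)) / R) at_top"
    using eventually_gt_at_top[of 0]
  proof eventually_elim
    case (elim R)
    have "s\<^sup>2 + t\<^sup>2 - 2 * s * t * q (s * R) (t * R) = (dist (\<alpha> (s * R)) (\<beta> (t * R)) / R)\<^sup>2"
      unfolding q_def using elim st by (simp add: field_simps power2_eq_square)
    then show ?case using elim by (simp add: real_sqrt_abs)
  qed
  ultimately show ?thesis by (rule Lim_transform_eventually)
qed

text \<open>In the plane, the point at distance \<open>sin (\<theta>1 + \<theta>2) / 2\<close> on the middle ray is the midpoint of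
  the points at distances \<open>sin \<theta>2\<close> and \<open>sin \<theta>1\<close> on the outer rays.\<close>

lemma ray_angle_triangle:
  assumes \<alpha>: "\<alpha> \<in> rays x0" and \<beta>: "\<beta> \<in> rays x0" and \<gamma>: "\<gamma> \<in> rays x0"
  shows "ray_angle x0 \<alpha> \<gamma> \<le> ray_angle x0 \<alpha> \<beta> + ray_angle x0 \<beta> \<gamma>"
proof (rule ccontr)
  define p q r where "p = ray_angle x0 \<alpha> \<beta>" and "q = ray_angle x0 \<beta> \<gamma>" and "r = ray_angle x0 \<alpha> \<gamma>"
  assume "\<not> ?thesis"
  then have less: "p + q < r" by (simp add: p_def q_def r_def)
  have nn: "0 \<le> p" "0 \<le> q" "r \<le> pi"
    using ray_angle_facts[OF \<alpha> \<beta>] ray_angle_facts[OF \<beta> \<gamma>] ray_angle_facts[OF \<alpha> \<gamma>] by (auto simp: p_def q_def r_def)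
  have "p \<noteq> 0"
  proof
    assume "p = 0"
    then have "\<alpha> = \<beta>" using ray_angle_0_imp_eq[OF \<alpha> \<beta>] by (simp add: p_def)
    then show False using less nn by (simp add: q_def r_def)
  qed
  moreover have "q \<noteq> 0"
  proof
    assume "q = 0"
    then have "\<beta> = \<gamma>" using ray_angle_0_imp_eq[OF \<beta> \<gamma>] by (simp add: q_def)
    then show False using less nn by (simp add: p_def r_def)
  qed
  ultimately have pos: "0 < p" "0 < q" "p < pi" "q < pi" "p + q < pi" using nn less by auto
  define a c s where "a = sin q" and "c = sin p" and "s = sin (p + q) / 2"
  have acs: "0 < a" "0 < c" "0 < s" using pos by (auto simp: a_def c_def s_def intro!: sin_gt_zero)
  define M where "M = a\<^sup>2 + c\<^sup>2 - 2 * a * c * cos (p + q)"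
  have sq: "(sin p)\<^sup>2 = 1 - (cos p)\<^sup>2" "(sin q)\<^sup>2 = 1 - (cos q)\<^sup>2" by (simp_all add: sin_squared_eq)
  have e1: "a\<^sup>2 + s\<^sup>2 - 2 * a * s * cos p = M / 4"
    and e2: "s\<^sup>2 + c\<^sup>2 - 2 * s * c * cos q = M / 4"
  proof -
    define sp cp sq' cq where d: "sp = sin p" "cp = cos p" "sq' = sin q" "cq = cos q"
    have h: "sp\<^sup>2 = 1 - cp\<^sup>2" "sq'\<^sup>2 = 1 - cq\<^sup>2" using sq by (auto simp: d)
    define w where "w = sp * cq + cp * sq'"
    have s: "s = w / 2" unfolding s_def sin_add w_def d[symmetric] by simp
    have M: "M = sq'\<^sup>2 + sp\<^sup>2 - 2 * sq' * sp * (cp * cq - sp * sq')"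
      unfolding M_def a_def c_def cos_add d[symmetric] ..
    have "4 * sq'\<^sup>2 + w\<^sup>2 - 4 * sq' * w * cp = M" "w\<^sup>2 + 4 * sp\<^sup>2 - 4 * w * sp * cq = M"
      unfolding M w_def using h by algebra+
    then show "a\<^sup>2 + s\<^sup>2 - 2 * a * s * cos p = M / 4" "s\<^sup>2 + c\<^sup>2 - 2 * s * c * cos q = M / 4"
      unfolding s a_def c_def d[symmetric] by (simp_all add: power_divide field_simps)
  qed
  \<comment> \<open>The triangle inequality in the space, divided by \<open>R\<close> and passed to
    the limit. The right-hand side is the third side of the planar triangle with the angle
    \<open>p + q\<close>; the left-hand side belongs to the larger angle \<open>r\<close> and ought
    to be longer.\<close>
  have "sqrt (a\<^sup>2 + c\<^sup>2 - 2 * a * c * cos r)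
      \<le> sqrt (a\<^sup>2 + s\<^sup>2 - 2 * a * s * cos p) + sqrt (s\<^sup>2 + c\<^sup>2 - 2 * s * c * cos q)"
  proof (rule tendsto_le[OF trivial_limit_at_top_linorder])
    show "((\<lambda>R. dist (\<alpha> (a * R)) (\<beta> (s * R)) / R + dist (\<beta> (s * R)) (\<gamma> (c * R)) / R) \<longlongrightarrow>
      sqrt (a\<^sup>2 + s\<^sup>2 - 2 * a * s * cos p) + sqrt (s\<^sup>2 + c\<^sup>2 - 2 * s * c * cos q)) at_top"
      unfolding p_def q_def by (intro tendsto_add ray_cone_limit \<alpha> \<beta> \<gamma> acs)
    show "((\<lambda>R. dist (\<alpha> (a * R)) (\<gamma> (c * R)) / R) \<longlongrightarrow> sqrt (a\<^sup>2 + c\<^sup>2 - 2 * a * c * cos r)) at_top"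
      unfolding r_def by (intro ray_cone_limit \<alpha> \<gamma> acs)
    show "eventually (\<lambda>R. dist (\<alpha> (a * R)) (\<gamma> (c * R)) / R
      \<le> dist (\<alpha> (a * R)) (\<beta> (s * R)) / R + dist (\<beta> (s * R)) (\<gamma> (c * R)) / R) at_top"
      using eventually_gt_at_top[of 0]
      by eventually_elim (simp add: add_divide_distrib[symmetric] divide_right_mono dist_triangle)
  qed
  also have "\<dots> = sqrt M" unfolding e1 e2 by (simp add: real_sqrt_divide)
  finally have "a\<^sup>2 + c\<^sup>2 - 2 * a * c * cos r \<le> M" by simp
  moreover have "cos r < cos (p + q)" using less pos nn by (intro cos_monotone_0_pi) auto
  then have "a * c * cos r < a * c * cos (p + q)" using acs by simp
  ultimately show False by (simp add: M_def)
qed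

end

end

section \<open>Midpoints in the angle metric and the Tits metric\<close>

context proper_cat0
begin

context
  fixes x0 :: 'a
begin

lemma ray_angle_lower_semicontinuous:
  assumes "\<alpha> \<in> rays x0" "\<beta> \<in> rays x0" "0 \<le> c"
    and \<alpha>: "\<And>t. 0 \<le> t \<Longrightarrow> ((\<lambda>n. A n t) \<longlongrightarrow> \<alpha> t) \<omega>" and \<beta>: "\<And>t. 0 \<le> t \<Longrightarrow> ((\<lambda>n. B n t) \<longlongrightarrow> \<beta> t) \<omega>"
    and rays: "\<And>n. A n \<in> rays x0" "\<And>n. B n \<in> rays x0"
    and le: "eventually (\<lambda>n. ray_angle x0 (A n) (B n) \<le> c) \<omega>"
  shows "ray_angle x0 \<alpha> \<beta> \<le> c"
proof (cases "c \<le> pi")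
  case True
  have "(dist (\<alpha> t) (\<beta> t))\<^sup>2 \<le> t\<^sup>2 * (2 - 2 * cos c)" if t: "0 < t" for t
  proof (rule tendsto_upperbound[OF _ _ not_bot])
    show "((\<lambda>n. (dist (A n t) (B n t))\<^sup>2) \<longlongrightarrow> (dist (\<alpha> t) (\<beta> t))\<^sup>2) \<omega>"
      using t by (intro tendsto_intros \<alpha> \<beta>) auto
    show "eventually (\<lambda>n. (dist (A n t) (B n t))\<^sup>2 \<le> t\<^sup>2 * (2 - 2 * cos c)) \<omega>"
      using le by eventually_elim (use ray_angle_le_iff[OF rays assms(3) True] t in simp)
  qed
  then show ?thesis using ray_angle_le_iff[OF assms(1,2,3) True] by simp
next
  case False
  then show ?thesis using ray_angle_le_pi[OF assms(1,2)] by simp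
qed

text \<open>An angle less than \<pi> makes the chord \<open>l\<close> less than 2, so the midpoints
  of the segments from \<open>\<alpha> n\<close> to \<open>\<beta> n\<close> escape to infinity and
  the geodesics to them have a limit ray.\<close>

lemma ray_midpoint:
  assumes \<alpha>: "\<alpha> \<in> rays x0" and \<beta>: "\<beta> \<in> rays x0" and less: "ray_angle x0 \<alpha> \<beta> < pi"
  shows "\<exists>\<mu>\<in>rays x0. ray_angle x0 \<alpha> \<mu> \<le> ray_angle x0 \<alpha> \<beta> / 2 \<and> ray_angle x0 \<mu> \<beta> \<le> ray_angle x0 \<alpha> \<beta> / 2"
proof -
  define \<theta> where "\<theta> = ray_angle x0 \<alpha> \<beta>"
  define l where "l = asymptotic_ratio \<alpha> \<beta>"
  define k where "k = cos (\<theta> / 2)"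
  have \<theta>: "0 \<le> \<theta>" "\<theta> < pi" using ray_angle_nonneg[OF \<alpha> \<beta>] less by (auto simp: \<theta>_def)
  have l: "0 \<le> l" using asymptotic_ratio_bounds[OF \<alpha> \<beta>] by (simp add: l_def)
  have k: "0 < k" using \<theta> by (auto simp: k_def intro!: cos_gt_zero_pi)
  have "cos \<theta> = 1 - l\<^sup>2 / 2" using cos_ray_angle[OF \<alpha> \<beta>] by (simp add: \<theta>_def l_def)
  then have lk: "l\<^sup>2 = 4 * (1 - k\<^sup>2)" using cos_double_cos[of "\<theta> / 2"] by (simp add: k_def)
  have "0 < k\<^sup>2" using k by simp
  then have "l\<^sup>2 < 2\<^sup>2" using lk by simp
  then have l2: "l < 2" by (rule power2_less_imp_less) simp
  define d where "d n = dist (\<alpha> (real n)) (\<beta> (real n))" for n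
  define m where "m n = Xi (\<alpha> (real n)) (\<beta> (real n)) (d n / 2)" for n
  have d: "d n \<le> l * real n" for n
  proof (cases "n = 0")
    case True
    then show ?thesis using ray_0[OF \<alpha>] ray_0[OF \<beta>] by (simp add: d_def)
  next
    case False
    then show ?thesis using asymptotic_ratio(2)[OF \<alpha> \<beta>, of "real n"] by (simp add: d_def l_def field_simps)
  qed
  have d0: "0 \<le> d n" for n by (simp add: d_def)
  have m1: "dist (\<alpha> (real n)) (m n) = d n / 2" for n
    unfolding m_def using d0[of n] by (intro dist_base_Xi) (simp_all add: d_def)
  have m2: "dist (\<beta> (real n)) (m n) = d n / 2" for n
    using dist_Xi_Xi_same[of "d n" "\<alpha> (real n)" "\<beta> (real n)" "d n / 2"] d0[of n]
    by (simp add: m_def d_def[symmetric]) (simp add: d_def)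
  have r: "(1 - l / 2) * real n \<le> dist x0 (m n)" for n
    using dist_triangle[of x0 "\<alpha> (real n)" "m n"] m1[of n] d[of n] ray_dist_base[OF \<alpha>, of "real n"]
    by (simp add: dist_commute algebra_simps)
  have "filterlim (\<lambda>n. (1 - l / 2) * real n) at_top \<omega>"
    using l2 by (intro filterlim_tendsto_pos_mult_at_top[OF tendsto_const _ real_at_top]) auto
  then have far: "filterlim (\<lambda>n. dist x0 (m n)) at_top \<omega>"
    by (rule filterlim_at_top_mono) (simp add: r always_eventually)
  then obtain \<mu> where \<mu>: "\<mu> \<in> rays x0" "\<And>t. 0 \<le> t \<Longrightarrow> ((\<lambda>n. Xi x0 (m n) t) \<longlongrightarrow> \<mu> t) \<omega>"
    by (rule limit_ray) (rule that; assumption)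
  have half: "ray_angle x0 \<gamma> \<mu> \<le> \<theta> / 2" if \<gamma>: "\<gamma> \<in> rays x0" and g: "\<And>n. dist (\<gamma> (real n)) (m n) = d n / 2" for \<gamma>
  proof -
    have "(dist (\<gamma> t) (\<mu> t))\<^sup>2 \<le> t\<^sup>2 * (2 - 2 * cos (\<theta> / 2))" if t: "0 < t" for t
    proof (rule tendsto_upperbound[OF _ _ not_bot])
      show "((\<lambda>n. (dist (\<gamma> t) (Xi x0 (m n) t))\<^sup>2) \<longlongrightarrow> (dist (\<gamma> t) (\<mu> t))\<^sup>2) \<omega>"
        using t by (intro tendsto_intros \<mu>(2)) auto
      have "eventually (\<lambda>n. t \<le> real n) \<omega>" "eventually (\<lambda>n. t \<le> dist x0 (m n)) \<omega>"
        using real_at_top far by (simp_all add: filterlim_at_top)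
      then show "eventually (\<lambda>n. (dist (\<gamma> t) (Xi x0 (m n) t))\<^sup>2 \<le> t\<^sup>2 * (2 - 2 * cos (\<theta> / 2))) \<omega>"
      proof eventually_elim
        case (elim n)
        define \<rho> where "\<rho> = dist x0 (m n)"
        have pos: "0 < real n" "0 < \<rho>" using elim t by (auto simp: \<rho>_def)
        have "(dist (\<gamma> t) (Xi x0 (m n) t))\<^sup>2 \<le> t\<^sup>2 + t\<^sup>2
            - t * t / (real n * \<rho>) * ((real n)\<^sup>2 + \<rho>\<^sup>2 - (d n / 2)\<^sup>2)"
          using Xi_compare[of t x0 "\<gamma> (real n)" t "m n"] elim t g[of n]
          by (simp add: Xi_geodesic_ray[OF \<gamma>] ray_dist_base[OF \<gamma>] \<rho>_def)
        also have "\<dots> \<le> t\<^sup>2 + t\<^sup>2 - t * t / (real n * \<rho>) * (2 * k * real n * \<rho>)"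
        proof -
          have "(d n)\<^sup>2 \<le> (l * real n)\<^sup>2" using d[of n] d0[of n] by (intro power_mono)
          moreover have "(l * real n)\<^sup>2 = 4 * ((1 - k\<^sup>2) * (real n)\<^sup>2)" by (simp add: power_mult_distrib lk)
          ultimately have "(d n / 2)\<^sup>2 \<le> (1 - k\<^sup>2) * (real n)\<^sup>2" by (simp add: power_divide)
          \<comment> \<open>Whatever the distance \<open>\<rho>\<close> of the midpoint from
            \<open>x0\<close>, this square bounds the comparison angle at \<open>x0\<close> by
            \<open>\<theta> / 2\<close>, because the opposite side \<open>d n / 2\<close> is at most
            \<open>sin (\<theta> / 2) * real n\<close>.\<close>
          moreover have "0 \<le> (k * real n - \<rho>)\<^sup>2" by simp
          ultimately have "2 * k * real n * \<rho> \<le> (real n)\<^sup>2 + \<rho>\<^sup>2 - (d n / 2)\<^sup>2"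
            by (simp add: power2_eq_square algebra_simps)
          then show ?thesis using pos t by (intro diff_left_mono mult_left_mono) auto
        qed
        also have "\<dots> = t\<^sup>2 * (2 - 2 * cos (\<theta> / 2))"
          using pos by (simp add: k_def power2_eq_square algebra_simps)
        finally show ?case .
      qed
    qed
    then show ?thesis using ray_angle_le_iff[OF \<gamma> \<mu>(1), of "\<theta> / 2"] \<theta> by simp
  qed
  have "ray_angle x0 \<mu> \<beta> \<le> \<theta> / 2" using half[OF \<beta> m2] ray_angle_commute[OF \<mu>(1) \<beta>] by simp
  then show ?thesis using half[OF \<alpha> m1] \<mu>(1) by (intro bexI[of _ \<mu>]) (simp_all add: \<theta>_def)
qed

definition mid_ray :: "(real \<Rightarrow> 'a) \<Rightarrow> (real \<Rightarrow> 'a) \<Rightarrow> (real \<Rightarrow> 'a)" where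
  "mid_ray \<alpha> \<beta> = (SOME \<mu>. \<mu> \<in> rays x0 \<and> ray_angle x0 \<alpha> \<mu> \<le> ray_angle x0 \<alpha> \<beta> / 2
     \<and> ray_angle x0 \<mu> \<beta> \<le> ray_angle x0 \<alpha> \<beta> / 2)"

text \<open>Entry \<open>k\<close> of level \<open>n\<close> stands for the parameter
  \<open>k / 2 ^ n\<close>; the even entries repeat the level before.\<close>

primrec dyadic_ray :: "(real \<Rightarrow> 'a) \<Rightarrow> (real \<Rightarrow> 'a) \<Rightarrow> nat \<Rightarrow> nat \<Rightarrow> (real \<Rightarrow> 'a)" where
  "dyadic_ray \<alpha> \<beta> 0 k = (if k = 0 then \<alpha> else \<beta>)"
| "dyadic_ray \<alpha> \<beta> (Suc n) k = (if even k then dyadic_ray \<alpha> \<beta> n (k div 2)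
     else mid_ray (dyadic_ray \<alpha> \<beta> n (k div 2)) (dyadic_ray \<alpha> \<beta> n (Suc (k div 2))))"

lemma mid_ray:
  assumes "\<alpha> \<in> rays x0" "\<beta> \<in> rays x0" "ray_angle x0 \<alpha> \<beta> < pi"
  shows "mid_ray \<alpha> \<beta> \<in> rays x0 \<and> ray_angle x0 \<alpha> (mid_ray \<alpha> \<beta>) \<le> ray_angle x0 \<alpha> \<beta> / 2
     \<and> ray_angle x0 (mid_ray \<alpha> \<beta>) \<beta> \<le> ray_angle x0 \<alpha> \<beta> / 2"
  unfolding mid_ray_def using ray_midpoint[OF assms] unfolding Bex_def by (rule someI_ex)

lemma dyadic_ray_ends: "dyadic_ray \<alpha> \<beta> n 0 = \<alpha>" "dyadic_ray \<alpha> \<beta> n (2 ^ n) = \<beta>"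
  by (induction n) auto

context
  fixes \<alpha> \<beta> :: "real \<Rightarrow> 'a"
  assumes \<alpha>: "\<alpha> \<in> rays x0" and \<beta>: "\<beta> \<in> rays x0" and less: "ray_angle x0 \<alpha> \<beta> < pi"
begin

lemma dyadic_ray_step:
  "(\<forall>k\<le>2 ^ n. dyadic_ray \<alpha> \<beta> n k \<in> rays x0) \<and>
   (\<forall>k<2 ^ n. ray_angle x0 (dyadic_ray \<alpha> \<beta> n k) (dyadic_ray \<alpha> \<beta> n (Suc k)) \<le> ray_angle x0 \<alpha> \<beta> / 2 ^ n)"
proof (induction n)
  case 0
  then show ?case using \<alpha> \<beta> by auto
next
  case (Suc n)
  let ?g = "dyadic_ray \<alpha> \<beta> n" and ?\<theta> = "ray_angle x0 \<alpha> \<beta>"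
  have g: "?g k \<in> rays x0" if "k \<le> 2 ^ n" for k using Suc that by simp
  have a: "ray_angle x0 (?g k) (?g (Suc k)) \<le> ?\<theta> / 2 ^ n" if "k < 2 ^ n" for k using Suc that by simp
  have "?\<theta> / 2 ^ n \<le> ?\<theta>"
    using ray_angle_nonneg[OF \<alpha> \<beta>] by (simp add: divide_le_eq mult_le_cancel_left1)
  then have pi: "?\<theta> / 2 ^ n < pi" using less by simp
  have mid: "mid_ray (?g k) (?g (Suc k)) \<in> rays x0 \<and>
      ray_angle x0 (?g k) (mid_ray (?g k) (?g (Suc k))) \<le> ?\<theta> / 2 ^ Suc n \<and>
      ray_angle x0 (mid_ray (?g k) (?g (Suc k))) (?g (Suc k)) \<le> ?\<theta> / 2 ^ Suc n" if k: "k < 2 ^ n" for k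
  proof -
    have h: "ray_angle x0 (?g k) (?g (Suc k)) / 2 \<le> ?\<theta> / 2 ^ Suc n" using a[OF k] by (simp add: field_simps)
    have "ray_angle x0 (?g k) (?g (Suc k)) < pi" using a[OF k] pi by simp
    then have "mid_ray (?g k) (?g (Suc k)) \<in> rays x0 \<and>
      ray_angle x0 (?g k) (mid_ray (?g k) (?g (Suc k))) \<le> ray_angle x0 (?g k) (?g (Suc k)) / 2 \<and>
      ray_angle x0 (mid_ray (?g k) (?g (Suc k))) (?g (Suc k)) \<le> ray_angle x0 (?g k) (?g (Suc k)) / 2"
      using k by (intro mid_ray g) auto
    then show ?thesis using h by linarith
  qed
  show ?case
  proof (intro conjI allI impI)
    fix k :: nat assume k: "k \<le> 2 ^ Suc n"
    show "dyadic_ray \<alpha> \<beta> (Suc n) k \<in> rays x0"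
    proof (cases "even k")
      case True
      then show ?thesis using g[of "k div 2"] k by simp
    next
      case False
      define m :: nat where "m = 2 ^ n"
      have "k \<le> 2 * m" using k by (simp add: m_def)
      then have "k div 2 < m" using False by presburger
      then have "k div 2 < 2 ^ n" by (simp add: m_def)
      then show ?thesis using mid False by simp
    qed
  next
    fix k :: nat assume k: "k < 2 ^ Suc n"
    then have k2: "k div 2 < 2 ^ n" by simp
    show "ray_angle x0 (dyadic_ray \<alpha> \<beta> (Suc n) k) (dyadic_ray \<alpha> \<beta> (Suc n) (Suc k)) \<le> ?\<theta> / 2 ^ Suc n"
      using mid[OF k2] by (cases "even k") simp_all
  qed
qed

lemma dyadic_ray_angle:
  assumes "j \<le> k" "k \<le> 2 ^ n"
  shows "ray_angle x0 (dyadic_ray \<alpha> \<beta> n j) (dyadic_ray \<alpha> \<beta> n k) \<le> real (k - j) * (ray_angle x0 \<alpha> \<beta> / 2 ^ n)"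
  using assms
proof (induction k rule: dec_induct)
  case base
  then show ?case using dyadic_ray_step[of n] ray_angle_self by simp
next
  case (step k)
  have r: "dyadic_ray \<alpha> \<beta> n i \<in> rays x0" if "i \<le> 2 ^ n" for i using dyadic_ray_step[of n] that by simp
  have "ray_angle x0 (dyadic_ray \<alpha> \<beta> n j) (dyadic_ray \<alpha> \<beta> n (Suc k))
    \<le> ray_angle x0 (dyadic_ray \<alpha> \<beta> n j) (dyadic_ray \<alpha> \<beta> n k) + ray_angle x0 (dyadic_ray \<alpha> \<beta> n k) (dyadic_ray \<alpha> \<beta> n (Suc k))"
    using step by (intro ray_angle_triangle r) auto
  also have "\<dots> \<le> real (k - j) * (ray_angle x0 \<alpha> \<beta> / 2 ^ n) + ray_angle x0 \<alpha> \<beta> / 2 ^ n"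
    using step dyadic_ray_step[of n] by (intro add_mono) auto
  also have "\<dots> = real (Suc k - j) * (ray_angle x0 \<alpha> \<beta> / 2 ^ n)"
  proof -
    have "real (Suc k - j) = real (k - j) + 1" using step.hyps by (simp add: Suc_diff_le)
    then show ?thesis by (simp only: distrib_right mult_1_left)
  qed
  finally show ?case .
qed

text \<open>The curve is the pointwise ultralimit of the step functions through the dyadic rays.
  Semicontinuity of the angle under such limits carries the Lipschitz bound over.\<close>

lemma exists_angle_geodesic:
  "\<exists>p. (\<forall>s. 0 \<le> s \<longrightarrow> s \<le> 1 \<longrightarrow> p s \<in> rays x0) \<and> p 0 = \<alpha> \<and> p 1 = \<beta> \<and>
    (\<forall>s t. 0 \<le> s \<longrightarrow> s \<le> t \<longrightarrow> t \<le> 1 \<longrightarrow> ray_angle x0 (p s) (p t) \<le> (t - s) * ray_angle x0 \<alpha> \<beta>)"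
proof -
  let ?\<theta> = "ray_angle x0 \<alpha> \<beta>"
  define g where "g s n = dyadic_ray \<alpha> \<beta> n (nat \<lfloor>2 ^ n * s\<rfloor>)" for s :: real and n
  have fl: "nat \<lfloor>2 ^ n * s\<rfloor> \<le> 2 ^ n" if "0 \<le> s" "s \<le> 1" for s :: real and n :: nat
  proof -
    have "2 ^ n * s \<le> 2 ^ n * 1" using that by (intro mult_left_mono) auto
    then have "\<lfloor>2 ^ n * s\<rfloor> \<le> \<lfloor>(2::real) ^ n\<rfloor>" by (intro floor_mono) simp
    then show ?thesis by (simp add: nat_le_iff)
  qed
  have g: "g s n \<in> rays x0" if "0 \<le> s" "s \<le> 1" for s n
    unfolding g_def using dyadic_ray_step[of n] fl[OF that] by simp
  have "\<forall>s. \<exists>\<gamma>. 0 \<le> s \<longrightarrow> s \<le> 1 \<longrightarrow> \<gamma> \<in> rays x0 \<and> (\<forall>t\<ge>0. ((\<lambda>n. g s n t) \<longlongrightarrow> \<gamma> t) \<omega>)"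
  proof
    fix s
    show "\<exists>\<gamma>. 0 \<le> s \<longrightarrow> s \<le> 1 \<longrightarrow> \<gamma> \<in> rays x0 \<and> (\<forall>t\<ge>0. ((\<lambda>n. g s n t) \<longlongrightarrow> \<gamma> t) \<omega>)"
    proof (cases "0 \<le> s \<and> s \<le> 1")
      case True
      then have gr: "g s n \<in> rays x0" for n using g by simp
      obtain \<gamma> where "\<gamma> \<in> rays x0" "\<And>t. 0 \<le> t \<Longrightarrow> ((\<lambda>n. g s n t) \<longlongrightarrow> \<gamma> t) \<omega>"
        by (rule limit_of_rays[OF gr]) (rule that; assumption)
      then show ?thesis by (intro exI[of _ \<gamma>]) simp
    qed auto
  qed
  then obtain p where p: "\<forall>s. 0 \<le> s \<longrightarrow> s \<le> 1 \<longrightarrow> p s \<in> rays x0 \<and> (\<forall>t\<ge>0. ((\<lambda>n. g s n t) \<longlongrightarrow> p s t) \<omega>)"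
    by (rule choice[THEN exE])
  have p1: "p s \<in> rays x0" and p2: "\<And>t. 0 \<le> t \<Longrightarrow> ((\<lambda>n. g s n t) \<longlongrightarrow> p s t) \<omega>"
    if "0 \<le> s" "s \<le> 1" for s using p that by auto
  have const: "p s = \<gamma>" if s: "0 \<le> s" "s \<le> 1" and \<gamma>: "\<gamma> \<in> rays x0" and c: "\<And>n. g s n = \<gamma>" for s \<gamma>
  proof (rule rays_eqI[OF p1[OF s] \<gamma>])
    fix t :: real assume "0 \<le> t"
    then have "((\<lambda>n. \<gamma> t) \<longlongrightarrow> p s t) \<omega>" using p2[OF s] by (simp add: c)
    then show "p s t = \<gamma> t" by (rule tendsto_unique[OF not_bot _ tendsto_const])
  qed
  have "p 0 = \<alpha>" by (rule const) (auto simp: g_def dyadic_ray_ends \<alpha>)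
  moreover have "p 1 = \<beta>"
  proof (rule const)
    have "nat \<lfloor>2 ^ n * 1 :: real\<rfloor> = 2 ^ n" for n :: nat
    proof -
      have "2 ^ n * 1 = real_of_int (2 ^ n)" by simp
      then show ?thesis by (simp only: floor_of_int) (simp add: nat_power_eq)
    qed
    then show "g 1 n = \<beta>" for n unfolding g_def by (simp add: dyadic_ray_ends nat_power_eq)
  qed (auto simp: \<beta>)
  moreover have "ray_angle x0 (p s) (p t) \<le> (t - s) * ?\<theta>" if st: "0 \<le> s" "s \<le> t" "t \<le> 1" for s t
  proof (rule field_le_epsilon)
    fix e :: real assume e: "0 < e"
    have s: "0 \<le> s" "s \<le> 1" and t: "0 \<le> t" "t \<le> 1" using st by auto
    have \<theta>0: "0 \<le> ?\<theta>" by (rule ray_angle_nonneg[OF \<alpha> \<beta>])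
    have "((\<lambda>n. ?\<theta> * (1/2) ^ n) \<longlongrightarrow> ?\<theta> * 0) sequentially"
      by (intro tendsto_mult tendsto_const LIMSEQ_power_zero) simp
    then have "((\<lambda>n. ?\<theta> * (1/2) ^ n) \<longlongrightarrow> 0) \<omega>" using tendsto_mono[OF omega_le_sequentially] by fastforce
    then have small: "eventually (\<lambda>n. ?\<theta> * (1/2) ^ n < e) \<omega>" using e by (rule order_tendstoD)
    show "ray_angle x0 (p s) (p t) \<le> (t - s) * ?\<theta> + e"
    proof (rule ray_angle_lower_semicontinuous[OF p1[OF s] p1[OF t] _ p2[OF s] p2[OF t] g[OF s] g[OF t]])
      show "0 \<le> (t - s) * ?\<theta> + e" using st \<theta>0 e by simp
      show "eventually (\<lambda>n. ray_angle x0 (g s n) (g t n) \<le> (t - s) * ?\<theta> + e) \<omega>"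
        using small
      proof eventually_elim
        case (elim n)
        let ?j = "nat \<lfloor>2 ^ n * s\<rfloor>" and ?k = "nat \<lfloor>2 ^ n * t\<rfloor>"
        have "2 ^ n * s \<le> 2 ^ n * t" using st by (intro mult_left_mono) auto
        then have jk: "?j \<le> ?k" by (intro nat_mono floor_mono)
        have "0 \<le> \<lfloor>2 ^ n * s\<rfloor>" "0 \<le> \<lfloor>2 ^ n * t\<rfloor>" using st by simp_all
        then have "real ?k = of_int \<lfloor>2 ^ n * t\<rfloor>" "real ?j = of_int \<lfloor>2 ^ n * s\<rfloor>" by simp_all
        \<comment> \<open>Rounding the parameters down costs at most one dyadic step, an angle of
          \<open>?\<theta> / 2 ^ n\<close>, which \<open>small\<close> absorbs.\<close>
        then have "real (?k - ?j) \<le> 2 ^ n * t - 2 ^ n * s + 1"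
          using jk by (simp only: of_nat_diff) linarith
        then have "real (?k - ?j) * (?\<theta> / 2 ^ n) \<le> (2 ^ n * t - 2 ^ n * s + 1) * (?\<theta> / 2 ^ n)"
          using \<theta>0 by (intro mult_right_mono) auto
        also have "\<dots> = (t - s) * ?\<theta> + ?\<theta> * (1/2) ^ n" by (simp add: field_simps power_divide)
        finally show ?case using dyadic_ray_angle[OF jk fl[OF t, of n]] elim by (simp add: g_def)
      qed
    qed
  qed
  ultimately show ?thesis using p1 by (intro exI[of _ p]) simp
qed

text \<open>The partition sums of the curve from \<open>exists_angle_geodesic\<close> telescope to
  at most the angle.\<close>

lemma tits_dist_le: "tits_dist x0 \<alpha> \<beta> \<le> ennreal (ray_angle x0 \<alpha> \<beta>)"
proof -
  let ?\<theta> = "ray_angle x0 \<alpha> \<beta>"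
  obtain p where p: "\<forall>s. 0 \<le> s \<longrightarrow> s \<le> 1 \<longrightarrow> p s \<in> rays x0" "p 0 = \<alpha>" "p 1 = \<beta>"
    "\<forall>s t. 0 \<le> s \<longrightarrow> s \<le> t \<longrightarrow> t \<le> 1 \<longrightarrow> ray_angle x0 (p s) (p t) \<le> (t - s) * ?\<theta>"
    using exists_angle_geodesic by (elim exE conjE)
  have \<theta>0: "0 \<le> ?\<theta>" by (rule ray_angle_nonneg[OF \<alpha> \<beta>])
  have lip: "ray_angle x0 (p s) (p t) \<le> \<bar>s - t\<bar> * ?\<theta>" if "s \<in> {0..1}" "t \<in> {0..1}" for s t
  proof (cases "s \<le> t")
    case True
    then show ?thesis using p(4) that by simp
  next
    case False
    then have "ray_angle x0 (p t) (p s) \<le> (s - t) * ?\<theta>" using p(4) that by simp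
    then show ?thesis using False ray_angle_commute[of "p s" x0 "p t"] p(1) that by simp
  qed
  have "p \<in> curves_between (rays x0) (ray_angle x0) \<alpha> \<beta>"
    unfolding curves_between_def mem_Collect_eq
  proof (intro conjI ballI)
    fix t :: real assume t: "t \<in> {0..1}"
    have "((\<lambda>s. \<bar>s - t\<bar> * ?\<theta>) \<longlongrightarrow> \<bar>t - t\<bar> * ?\<theta>) (at t within {0..1})"
      by (intro tendsto_mult tendsto_const tendsto_rabs tendsto_diff tendsto_ident_at)
    then have lim: "((\<lambda>s. \<bar>s - t\<bar> * ?\<theta>) \<longlongrightarrow> 0) (at t within {0..1})" by simp
    show "((\<lambda>s. ray_angle x0 (p s) (p t)) \<longlongrightarrow> 0) (at t within {0..1})"
    proof (rule tendsto_sandwich[OF _ _ tendsto_const lim])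
      show "eventually (\<lambda>s. 0 \<le> ray_angle x0 (p s) (p t)) (at t within {0..1})"
        unfolding eventually_at_filter using p(1) t
        by (intro always_eventually allI impI ray_angle_nonneg) simp_all
      show "eventually (\<lambda>s. ray_angle x0 (p s) (p t) \<le> \<bar>s - t\<bar> * ?\<theta>) (at t within {0..1})"
        unfolding eventually_at_filter using t by (intro always_eventually allI impI lip)
    qed
  next
    show "p ` {0..1} \<subseteq> rays x0" by (rule image_subsetI) (use p(1) in simp)
  qed (rule p)+
  then have "tits_dist x0 \<alpha> \<beta> \<le> curve_length (ray_angle x0) p"
    unfolding tits_dist_def path_metric_def by (rule INF_lower)
  also have "\<dots> \<le> ennreal ?\<theta>"
    unfolding curve_length_def
  proof (rule SUP_least)
    fix x assume "x \<in> {(n::nat, s::nat \<Rightarrow> real). (\<forall>i\<le>n. s i \<in> {0..1}) \<and> (\<forall>i<n. s i \<le> s (Suc i))}"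
    then obtain n s where x: "x = (n, s)" and s: "\<forall>i\<le>n. s i \<in> {0..1}" "\<forall>i<n. s i \<le> s (Suc i)" by auto
    have "(\<Sum>i<n. ennreal (ray_angle x0 (p (s i)) (p (s (Suc i))))) \<le> (\<Sum>i<n. ennreal ((s (Suc i) - s i) * ?\<theta>))"
    proof (rule sum_mono)
      fix i assume i: "i \<in> {..<n}"
      have "0 \<le> s i" "s i \<le> s (Suc i)" "s (Suc i) \<le> 1" using s i by (auto simp: Suc_le_eq)
      then show "ennreal (ray_angle x0 (p (s i)) (p (s (Suc i)))) \<le> ennreal ((s (Suc i) - s i) * ?\<theta>)"
        using p(4) by (intro ennreal_leI) simp
    qed
    also have "\<dots> = ennreal (\<Sum>i<n. (s (Suc i) - s i) * ?\<theta>)"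
      using s \<theta>0 by (intro sum_ennreal) auto
    also have "(\<Sum>i<n. (s (Suc i) - s i) * ?\<theta>) = (s n - s 0) * ?\<theta>"
      by (simp add: sum_distrib_right[symmetric] sum_lessThan_telescope)
    also have "\<dots> \<le> 1 * ?\<theta>"
    proof (rule mult_right_mono[OF _ \<theta>0])
      have "0 \<le> s 0" "s n \<le> 1" using s(1) by auto
      then show "s n - s 0 \<le> 1" by simp
    qed
    finally show "(case x of (n, s) \<Rightarrow> \<Sum>i<n. ennreal (ray_angle x0 (p (s i)) (p (s (Suc i))))) \<le> ennreal ?\<theta>"
      by (simp add: x ennreal_leI)
  qed
  finally show ?thesis .
qed

end

lemma tits_dist_ge:
  "ennreal (ray_angle x0 \<alpha> \<beta>) \<le> tits_dist x0 \<alpha> \<beta>"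
  unfolding tits_dist_def path_metric_def
proof (rule INF_greatest)
  fix p assume p: "p \<in> curves_between (rays x0) (ray_angle x0) \<alpha> \<beta>"
  \<comment> \<open>The partition with the single interval from 0 to 1.\<close>
  let ?s = "\<lambda>i::nat. if i = 0 then 0 else 1 :: real"
  have "(case (1, ?s) of (n, s) \<Rightarrow> \<Sum>i<n. ennreal (ray_angle x0 (p (s i)) (p (s (Suc i)))))
      \<le> curve_length (ray_angle x0) p"
    unfolding curve_length_def by (rule SUP_upper) auto
  then show "ennreal (ray_angle x0 \<alpha> \<beta>) \<le> curve_length (ray_angle x0) p"
    using p by (simp add: curves_between_def)
qed

text \<open>Below \<pi> the angle is realised by a curve; at \<pi> the truncation hides whatever the
  Tits distance is. Hence both metrics give the same cone.\<close>

lemma truncated_tits_dist: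
  assumes \<alpha>: "\<alpha> \<in> rays x0" and \<beta>: "\<beta> \<in> rays x0"
  shows "enn2real (min (ennreal pi) (tits_dist x0 \<alpha> \<beta>)) = ray_angle x0 \<alpha> \<beta>"
proof (cases "ray_angle x0 \<alpha> \<beta> < pi")
  case True
  have "tits_dist x0 \<alpha> \<beta> = ennreal (ray_angle x0 \<alpha> \<beta>)"
    using tits_dist_le[OF \<alpha> \<beta> True] tits_dist_ge by (rule antisym)
  then show ?thesis using True ray_angle_nonneg[OF \<alpha> \<beta>] by (simp add: min_def ennreal_leI)
next
  case False
  then have "ray_angle x0 \<alpha> \<beta> = pi" using ray_angle_le_pi[OF \<alpha> \<beta>] by simp
  then show ?thesis using tits_dist_ge[of \<alpha> \<beta>] by (simp add: min_def)
qed

end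

end

section \<open>Asymptotic cones and their direct limit\<close>

lemma in_cone_space_iff:
  "P \<in> cone_space Z \<longleftrightarrow> P = Apex \<or> (\<exists>t z. 0 < t \<and> z \<in> Z \<and> P = Off_Apex t z)"
proof
  assume "P \<in> cone_space Z"
  then have "P = Apex \<or> (\<exists>t z. P = cone_point t z \<and> 0 \<le> t \<and> z \<in> Z)" by (simp add: cone_space_def)
  then show "P = Apex \<or> (\<exists>t z. 0 < t \<and> z \<in> Z \<and> P = Off_Apex t z)"
  proof (elim disjE exE conjE)
    fix t z assume "P = cone_point t z" "0 \<le> t" "z \<in> Z"
    then show ?thesis by (cases "t = 0") (auto simp: cone_point_def)
  qed simp
next
  assume "P = Apex \<or> (\<exists>t z. 0 < t \<and> z \<in> Z \<and> P = Off_Apex t z)"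
  then show "P \<in> cone_space Z"
  proof (elim disjE exE conjE)
    fix t z assume tz: "0 < t" "z \<in> Z" "P = Off_Apex t z"
    then have "P = cone_point t z \<and> 0 \<le> t \<and> z \<in> Z" by (simp add: cone_point_def)
    then have "\<exists>t z. P = cone_point t z \<and> 0 \<le> t \<and> z \<in> Z" by (intro exI)
    then show ?thesis by (simp add: cone_space_def)
  qed (simp add: cone_space_def)
qed

lemma cone_space_cases [consumes 1, case_names Apex Off_Apex]:
  assumes "P \<in> cone_space Z" "P = Apex \<Longrightarrow> thesis"
    "\<And>t z. P = Off_Apex t z \<Longrightarrow> 0 < t \<Longrightarrow> z \<in> Z \<Longrightarrow> thesis"
  shows thesis
  using assms(1) unfolding in_cone_space_iff by (elim disjE exE conjE) (rule assms(2,3); assumption)+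

text \<open>A point of the cone is read as a ray of constant speed, the speed being the radius; the
  apex is the constant path.\<close>

primrec cone_ray :: "'a \<Rightarrow> (real \<Rightarrow> 'a) euclidean_cone \<Rightarrow> real \<Rightarrow> 'a" where
  "cone_ray x0 Apex R = x0"
| "cone_ray x0 (Off_Apex t \<alpha>) R = \<alpha> (t * R)"

primrec cone_radius :: "'z euclidean_cone \<Rightarrow> real" where
  "cone_radius Apex = 0"
| "cone_radius (Off_Apex t z) = t"

context cat0_space
begin

context
  fixes x0 :: 'a
begin

lemma cone_ray_0: "P \<in> cone_space (rays x0) \<Longrightarrow> cone_ray x0 P 0 = x0"
  by (erule cone_space_cases) (simp_all add: ray_0)

lemma dist_cone_ray: "P \<in> cone_space (rays x0) \<Longrightarrow> 0 \<le> R \<Longrightarrow> dist x0 (cone_ray x0 P R) = cone_radius P * R"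
  by (erule cone_space_cases) (simp_all add: ray_dist_base)

lemma Xi_cone_ray:
  assumes "P \<in> cone_space (rays x0)" "0 \<le> R" "R \<le> S"
  shows "Xi x0 (cone_ray x0 P S) (cone_radius P * R) = cone_ray x0 P R"
  using assms(1)
proof (cases rule: cone_space_cases)
  case (Off_Apex t z)
  then show ?thesis using Xi_geodesic_ray[of z x0 "t * R" "t * S"] assms(2,3) by simp
qed simp

lemma cone_ray_ratio_mono:
  assumes P: "P \<in> cone_space (rays x0)" and Q: "Q \<in> cone_space (rays x0)" and R: "0 < R" "R \<le> S"
  shows "dist (cone_ray x0 P R) (cone_ray x0 Q R) / R \<le> dist (cone_ray x0 P S) (cone_ray x0 Q S) / S"
proof -
  have e: "Xi x0 (cone_ray x0 P S) (R / S * dist x0 (cone_ray x0 P S)) = cone_ray x0 P R"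
    if "P \<in> cone_space (rays x0)" for P
    using Xi_cone_ray[OF that, of R S] dist_cone_ray[OF that, of S] R by (simp add: mult.commute)
  have "dist (cone_ray x0 P R) (cone_ray x0 Q R) \<le> R / S * dist (cone_ray x0 P S) (cone_ray x0 Q S)"
    using Xi_contract[of "R / S" x0 "cone_ray x0 P S" "cone_ray x0 Q S"] R
    unfolding e[OF P] e[OF Q] by simp
  then show ?thesis using R by (simp add: field_simps)
qed

text \<open>The cone distance is the linear growth rate of the distance between the two rays; for
  two points off the apex this is \<open>ray_cone_limit\<close>, and otherwise the ratio is
  constant.\<close>

lemma angle_cone_limit:
  assumes P: "P \<in> cone_space (rays x0)" and Q: "Q \<in> cone_space (rays x0)"
  shows "((\<lambda>R. dist (cone_ray x0 P R) (cone_ray x0 Q R) / R) \<longlongrightarrow> angle_cone_dist x0 P Q) at_top"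
  using P
proof (cases rule: cone_space_cases)
  case Apex
  have "eventually (\<lambda>R. cone_radius Q = dist (cone_ray x0 P R) (cone_ray x0 Q R) / R) at_top"
    using eventually_gt_at_top[of 0] by eventually_elim (simp add: Apex dist_cone_ray[OF Q])
  then have "((\<lambda>R. dist (cone_ray x0 P R) (cone_ray x0 Q R) / R) \<longlongrightarrow> cone_radius Q) at_top"
    by (rule Lim_transform_eventually[OF tendsto_const])
  moreover have "angle_cone_dist x0 P Q = cone_radius Q"
    by (cases Q) (simp_all add: Apex angle_cone_dist_def)
  ultimately show ?thesis by simp
next
  case (Off_Apex t \<alpha>)
  note P' = this
  show ?thesis using Q
  proof (cases rule: cone_space_cases)
    case Apex
    have "eventually (\<lambda>R. cone_radius P = dist (cone_ray x0 P R) (cone_ray x0 Q R) / R) at_top"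
      using eventually_gt_at_top[of 0]
    proof eventually_elim
      case (elim R)
      have "dist (cone_ray x0 P R) x0 = cone_radius P * R"
        using dist_cone_ray[OF P, of R] elim by (simp add: dist_commute)
      then show ?case using elim by (simp add: Apex)
    qed
    then have "((\<lambda>R. dist (cone_ray x0 P R) (cone_ray x0 Q R) / R) \<longlongrightarrow> cone_radius P) at_top"
      by (rule Lim_transform_eventually[OF tendsto_const])
    moreover have "angle_cone_dist x0 P Q = cone_radius P"
      by (cases P) (simp_all add: Apex angle_cone_dist_def)
    ultimately show ?thesis by simp
  next
    case (Off_Apex s \<beta>)
    have a: "0 \<le> ray_angle x0 \<alpha> \<beta>" "ray_angle x0 \<alpha> \<beta> \<le> pi"
      using ray_angle_facts P' Off_Apex by auto
    then have "enn2real (min (ennreal pi) (ennreal (ray_angle x0 \<alpha> \<beta>))) = ray_angle x0 \<alpha> \<beta>"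
      by (simp add: min_def ennreal_leI)
    then show ?thesis
      using ray_cone_limit[OF P'(3) Off_Apex(3) P'(2) Off_Apex(2)]
      by (simp add: P'(1) Off_Apex(1) angle_cone_dist_def)
  qed
qed

lemma cone_ray_ratio_le:
  assumes P: "P \<in> cone_space (rays x0)" and Q: "Q \<in> cone_space (rays x0)" and R: "0 < R"
  shows "dist (cone_ray x0 P R) (cone_ray x0 Q R) / R \<le> angle_cone_dist x0 P Q"
proof (rule tendsto_lowerbound[OF angle_cone_limit[OF P Q]])
  show "eventually (\<lambda>S. dist (cone_ray x0 P R) (cone_ray x0 Q R) / R \<le> dist (cone_ray x0 P S) (cone_ray x0 Q S) / S) at_top"
    using eventually_ge_at_top[of R] by eventually_elim (rule cone_ray_ratio_mono[OF P Q R])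
qed simp

lemma cone_ray_inject:
  assumes P: "P \<in> cone_space (rays x0)" and Q: "Q \<in> cone_space (rays x0)"
    and eq: "\<And>R. 0 \<le> R \<Longrightarrow> cone_ray x0 P R = cone_ray x0 Q R"
  shows "P = Q"
proof -
  have r: "cone_radius P = cone_radius Q"
    using dist_cone_ray[OF P, of 1] dist_cone_ray[OF Q, of 1] eq[of 1] by simp
  show ?thesis using P
  proof (cases rule: cone_space_cases)
    case Apex
    show ?thesis using Q by (cases rule: cone_space_cases) (use r Apex in simp_all)
  next
    case (Off_Apex t \<alpha>)
    note P' = this
    show ?thesis using Q
    proof (cases rule: cone_space_cases)
      case Apex
      then show ?thesis using r P' by simp
    next
      case (Off_Apex s \<beta>)
      have ts: "s = t" using r by (simp add: P' Off_Apex)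
      have "\<alpha> = \<beta>"
      proof (rule rays_eqI[OF P'(3) Off_Apex(3)])
        fix u :: real assume "0 \<le> u"
        then show "\<alpha> u = \<beta> u" using eq[of "u / t"] P'(2) by (simp add: P'(1) Off_Apex(1) ts)
      qed
      then show ?thesis by (simp add: P' Off_Apex ts)
    qed
  qed
qed

lemma angle_cone_dist_0_iff:
  assumes P: "P \<in> cone_space (rays x0)" and Q: "Q \<in> cone_space (rays x0)"
  shows "angle_cone_dist x0 P Q = 0 \<longleftrightarrow> P = Q"
proof
  assume z: "angle_cone_dist x0 P Q = 0"
  show "P = Q"
  proof (rule cone_ray_inject[OF P Q])
    fix R :: real assume R: "0 \<le> R"
    show "cone_ray x0 P R = cone_ray x0 Q R"
    proof (cases "R = 0")
      case True
      then show ?thesis using cone_ray_0 P Q by simp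
    next
      case False
      then have "dist (cone_ray x0 P R) (cone_ray x0 Q R) / R \<le> 0"
        using cone_ray_ratio_le[OF P Q, of R] R z by simp
      then show ?thesis using False R by (simp add: divide_le_0_iff)
    qed
  qed
next
  assume "P = Q"
  then have "((\<lambda>R::real. 0) \<longlongrightarrow> angle_cone_dist x0 P Q) at_top" using angle_cone_limit[OF P Q] by simp
  then show "angle_cone_dist x0 P Q = 0"
    by (rule tendsto_unique[OF trivial_limit_at_top_linorder _ tendsto_const])
qed

end

end

lemma (in proper_cat0) tits_cone_dist_eq:
  assumes P: "P \<in> cone_space (rays (x0::'a))" and Q: "Q \<in> cone_space (rays x0)"
  shows "tits_cone_dist x0 P Q = angle_cone_dist x0 P Q"
  using P
proof (cases rule: cone_space_cases)
  case Apex
  then show ?thesis by (cases Q) (simp_all add: tits_cone_dist_def angle_cone_dist_def)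
next
  case (Off_Apex t \<alpha>)
  note P' = this
  show ?thesis using Q
  proof (cases rule: cone_space_cases)
    case Apex
    then show ?thesis by (simp add: P' tits_cone_dist_def angle_cone_dist_def)
  next
    case (Off_Apex s \<beta>)
    have a: "0 \<le> ray_angle x0 \<alpha> \<beta>" "ray_angle x0 \<alpha> \<beta> \<le> pi"
      using ray_angle_facts P' Off_Apex by auto
    then have "enn2real (min (ennreal pi) (ennreal (ray_angle x0 \<alpha> \<beta>))) = ray_angle x0 \<alpha> \<beta>"
      by (simp add: min_def ennreal_leI)
    then show ?thesis
      by (simp add: P'(1) Off_Apex(1) tits_cone_dist_def angle_cone_dist_def truncated_tits_dist[OF P'(3) Off_Apex(3)])
  qed
qed

text \<open>\<open>\<rho>\<close> is the pullback of \<open>\<delta>\<close> along \<open>L\<close>,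
  and \<open>g\<close> is a section of \<open>L\<close>. The classes are the fibres of
  \<open>L\<close>, so the representatives chosen in \<open>quotient_dist\<close> do not
  matter.\<close>

lemma metric_quotient_pullback:
  assumes L: "\<And>x. x \<in> S \<Longrightarrow> L x \<in> C" and g: "\<And>P. P \<in> C \<Longrightarrow> g P \<in> S" "\<And>P. P \<in> C \<Longrightarrow> L (g P) = P"
    and \<rho>: "\<And>x y. x \<in> S \<Longrightarrow> y \<in> S \<Longrightarrow> \<rho> x y = \<delta> (L x) (L y)"
    and \<delta>: "\<And>P Q. P \<in> C \<Longrightarrow> Q \<in> C \<Longrightarrow> \<delta> P Q = 0 \<longleftrightarrow> P = Q"
  shows "isometry_onto (\<lambda>P. quotient_class S \<rho> (g P)) C \<delta> (metric_quotient S \<rho>) (quotient_dist \<rho>)"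
    and "x \<in> S \<Longrightarrow> y \<in> S \<Longrightarrow> L x = L y \<Longrightarrow> quotient_class S \<rho> x = quotient_class S \<rho> y"
proof -
  have cl: "quotient_class S \<rho> x = {y \<in> S. L x = L y}" if "x \<in> S" for x
    unfolding quotient_class_def zero_dist_rel_def using that \<rho> \<delta> L by auto
  show same: "quotient_class S \<rho> x = quotient_class S \<rho> y" if "x \<in> S" "y \<in> S" "L x = L y" for x y
    using that by (simp add: cl)
  have rep: "(SOME y. y \<in> quotient_class S \<rho> x) \<in> S \<and> L (SOME y. y \<in> quotient_class S \<rho> x) = L x" if x: "x \<in> S" for x
  proof -
    have "x \<in> quotient_class S \<rho> x" using x by (simp add: cl)
    then have "(SOME y. y \<in> quotient_class S \<rho> x) \<in> quotient_class S \<rho> x" by (rule someI)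
    then show ?thesis using cl[OF x] by simp
  qed
  show "isometry_onto (\<lambda>P. quotient_class S \<rho> (g P)) C \<delta> (metric_quotient S \<rho>) (quotient_dist \<rho>)"
    unfolding isometry_onto_def
  proof (intro conjI ballI)
    show "bij_betw (\<lambda>P. quotient_class S \<rho> (g P)) C (metric_quotient S \<rho>)"
      unfolding bij_betw_def
    proof
      show "inj_on (\<lambda>P. quotient_class S \<rho> (g P)) C"
      proof (rule inj_onI)
        fix P Q assume PQ: "P \<in> C" "Q \<in> C" "quotient_class S \<rho> (g P) = quotient_class S \<rho> (g Q)"
        have "g P \<in> quotient_class S \<rho> (g P)" by (simp add: cl[OF g(1)[OF PQ(1)]] g(1)[OF PQ(1)])
        then have "g P \<in> quotient_class S \<rho> (g Q)" by (simp only: PQ(3))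
        then have "L (g Q) = L (g P)" by (simp add: cl[OF g(1)[OF PQ(2)]])
        then show "P = Q" by (simp add: g(2)[OF PQ(1)] g(2)[OF PQ(2)])
      qed
      show "(\<lambda>P. quotient_class S \<rho> (g P)) ` C = metric_quotient S \<rho>"
      proof (rule antisym; rule subsetI)
        fix A assume "A \<in> (\<lambda>P. quotient_class S \<rho> (g P)) ` C"
        then obtain P where "P \<in> C" "A = quotient_class S \<rho> (g P)" by auto
        then show "A \<in> metric_quotient S \<rho>"
          unfolding metric_quotient_def quotient_class_def using g(1) by (auto intro: quotientI)
      next
        fix A assume "A \<in> metric_quotient S \<rho>"
        then obtain x where x: "x \<in> S" "A = quotient_class S \<rho> x"
          unfolding metric_quotient_def quotient_class_def by (auto elim: quotientE)
        have "A = quotient_class S \<rho> (g (L x))"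
          unfolding x(2) by (rule same) (simp_all add: x(1) L g)
        then show "A \<in> (\<lambda>P. quotient_class S \<rho> (g P)) ` C" using L[OF x(1)] by simp
      qed
    qed
    fix P Q assume PQ: "P \<in> C" "Q \<in> C"
    show "quotient_dist \<rho> (quotient_class S \<rho> (g P)) (quotient_class S \<rho> (g Q)) = \<delta> P Q"
      unfolding quotient_dist_def using rep[OF g(1)[OF PQ(1)]] rep[OF g(1)[OF PQ(2)]] \<rho> g(2) PQ by simp
  qed
qed

lemma isometry_onto_sym:
  assumes "isometry_onto f M \<rho> N \<sigma>"
  shows "isometry_onto (inv_into M f) N \<sigma> M \<rho>"
proof -
  have f: "bij_betw f M N" "\<And>x y. x \<in> M \<Longrightarrow> y \<in> M \<Longrightarrow> \<sigma> (f x) (f y) = \<rho> x y"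
    using assms by (simp_all add: isometry_onto_def)
  have g: "inv_into M f y \<in> M" "f (inv_into M f y) = y" if "y \<in> N" for y
    using that f(1) by (simp_all add: bij_betw_def inv_into_into f_inv_into_f)
  show ?thesis
    unfolding isometry_onto_def
  proof (intro conjI ballI)
    show "bij_betw (inv_into M f) N M" by (rule bij_betw_inv_into[OF f(1)])
    show "\<rho> (inv_into M f x) (inv_into M f y) = \<sigma> x y" if "x \<in> N" "y \<in> N" for x y
      using f(2)[of "inv_into M f x" "inv_into M f y"] g that by simp
  qed
qed

section \<open>Sequences, their directions and the metric of the direct limit\<close>

context proper_cat0
begin

context
  fixes x0 :: 'a
begin

abbreviation cone_seqs :: "(nat \<Rightarrow> real) \<Rightarrow> (nat \<Rightarrow> 'a) set" where
  "cone_seqs d \<equiv> bounded_sequences (\<lambda>_. UNIV) (rescaled_dist d) (\<lambda>_. x0)"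

abbreviation cone_class :: "(nat \<Rightarrow> real) \<Rightarrow> (nat \<Rightarrow> 'a) \<Rightarrow> (nat \<Rightarrow> 'a) set" where
  "cone_class d \<equiv> asymptotic_cone_class \<omega> x0 d"

lemma cone_seqs_iff: "a \<in> cone_seqs d \<longleftrightarrow> (\<exists>B. \<forall>n. dist (a n) x0 / d n \<le> B)"
  by (simp add: bounded_sequences_def rescaled_dist_def)

lemma scalingD:
  assumes "scaling_sequence \<omega> d"
  shows "0 < d n" "filterlim d at_top \<omega>" "eventually (\<lambda>n. R \<le> d n) \<omega>"
  using assms by (auto simp: scaling_sequence_def filterlim_at_top)

lemma dist_limit:
  assumes d: "scaling_sequence \<omega> d" and a: "a \<in> cone_seqs d" and b: "b \<in> cone_seqs d"
  shows "((\<lambda>n. dist (a n) (b n) / d n) \<longlongrightarrow> ultra_dist \<omega> (rescaled_dist d) a b) \<omega>"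
proof -
  obtain A where A: "\<forall>n. dist (a n) x0 / d n \<le> A" using a unfolding cone_seqs_iff by (elim exE)
  obtain B where B: "\<forall>n. dist (b n) x0 / d n \<le> B" using b unfolding cone_seqs_iff by (elim exE)
  have "\<bar>dist (a n) (b n) / d n\<bar> \<le> A + B" for n
  proof -
    have "dist (a n) (b n) / d n \<le> (dist (a n) x0 + dist (b n) x0) / d n"
      using scalingD(1)[OF d, of n] by (intro divide_right_mono dist_triangle2) auto
    also have "\<dots> \<le> A + B"
      using spec[OF A, of n] spec[OF B, of n] by (simp add: add_divide_distrib)
    finally show ?thesis using scalingD(1)[OF d, of n] by simp
  qed
  then obtain l where l: "((\<lambda>n. dist (a n) (b n) / d n) \<longlongrightarrow> l) \<omega>"
    by (rule bounded_limit[OF always_eventually[OF allI]])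
  then show ?thesis unfolding ultra_dist_def rescaled_dist_def by (simp add: Lim_eq[OF l])
qed

lemma ultra_dist_eq:
  assumes "((\<lambda>n. dist (a n) (b n) / d n) \<longlongrightarrow> l) \<omega>"
  shows "ultra_dist \<omega> (rescaled_dist d) a b = l"
  unfolding ultra_dist_def rescaled_dist_def by (rule Lim_eq[OF assms])

lemma x0_seq: "(\<lambda>_. x0) \<in> cone_seqs d"
  unfolding cone_seqs_iff by (intro exI[of _ 0]) simp

lemma in_cone_class_iff:
  assumes d: "scaling_sequence \<omega> d" and a: "a \<in> cone_seqs d"
  shows "b \<in> cone_class d a \<longleftrightarrow> b \<in> cone_seqs d \<and> ((\<lambda>n. dist (a n) (b n) / d n) \<longlongrightarrow> 0) \<omega>"
proof -
  have "b \<in> cone_class d a \<longleftrightarrow> b \<in> cone_seqs d \<and> ultra_dist \<omega> (rescaled_dist d) a b = 0"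
    using a by (auto simp: asymptotic_cone_class_def quotient_class_def zero_dist_rel_def)
  also have "\<dots> \<longleftrightarrow> b \<in> cone_seqs d \<and> ((\<lambda>n. dist (a n) (b n) / d n) \<longlongrightarrow> 0) \<omega>"
    using dist_limit[OF d a, of b] ultra_dist_eq[of a b d 0] by auto
  finally show ?thesis .
qed

lemma asymptotic_cone_eq: "asymptotic_cone \<omega> x0 d = cone_class d ` cone_seqs d"
  unfolding asymptotic_cone_def ultraproduct_def metric_quotient_def asymptotic_cone_class_def quotient_class_def
  by (auto simp: quotient_def)

lemma rep_in_class:
  assumes d: "scaling_sequence \<omega> d" and a: "a \<in> cone_seqs d"
  shows "(SOME b. b \<in> cone_class d a) \<in> cone_seqs d"
    "((\<lambda>n. dist (a n) ((SOME b. b \<in> cone_class d a) n) / d n) \<longlongrightarrow> 0) \<omega>"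
proof -
  have "a \<in> cone_class d a" unfolding in_cone_class_iff[OF d a] using a by simp
  then have "(SOME b. b \<in> cone_class d a) \<in> cone_class d a"
    by (rule someI[of "\<lambda>b. b \<in> cone_class d a"])
  then show "(SOME b. b \<in> cone_class d a) \<in> cone_seqs d"
    "((\<lambda>n. dist (a n) ((SOME b. b \<in> cone_class d a) n) / d n) \<longlongrightarrow> 0) \<omega>"
    unfolding in_cone_class_iff[OF d a] by auto
qed

lemma null_add:
  assumes d: "scaling_sequence \<omega> d"
    and "((\<lambda>n. dist (a n) (b n) / d n) \<longlongrightarrow> 0) \<omega>" "((\<lambda>n. dist (b n) (c n) / d n) \<longlongrightarrow> 0) \<omega>"
  shows "((\<lambda>n. dist (a n) (c n) / d n) \<longlongrightarrow> 0) \<omega>"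
proof (rule tendsto_sandwich[OF _ _ tendsto_const])
  show "((\<lambda>n. dist (a n) (b n) / d n + dist (b n) (c n) / d n) \<longlongrightarrow> 0) \<omega>"
    using tendsto_add[OF assms(2,3)] by simp
  show "eventually (\<lambda>n. dist (a n) (c n) / d n \<le> dist (a n) (b n) / d n + dist (b n) (c n) / d n) \<omega>"
    unfolding add_divide_distrib[symmetric]
    by (intro always_eventually allI divide_right_mono dist_triangle less_imp_le[OF scalingD(1)[OF d]])
  show "eventually (\<lambda>n. 0 \<le> dist (a n) (c n) / d n) \<omega>"
    by (intro always_eventually allI divide_nonneg_nonneg zero_le_dist less_imp_le[OF scalingD(1)[OF d]])
qed

lemma cone_class_eqI:
  assumes d: "scaling_sequence \<omega> d" and a: "a \<in> cone_seqs d" and b: "b \<in> cone_seqs d"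
    and ab: "((\<lambda>n. dist (a n) (b n) / d n) \<longlongrightarrow> 0) \<omega>"
  shows "cone_class d a = cone_class d b"
proof -
  have ba: "((\<lambda>n. dist (b n) (a n) / d n) \<longlongrightarrow> 0) \<omega>" using ab by (simp add: dist_commute)
  show ?thesis
  proof (rule set_eqI)
    fix c
    show "c \<in> cone_class d a \<longleftrightarrow> c \<in> cone_class d b"
      unfolding in_cone_class_iff[OF d a] in_cone_class_iff[OF d b]
      using null_add[OF d ab, of c] null_add[OF d ba, of c] by auto
  qed
qed

text \<open>\<open>quotient_dist\<close> works with representatives picked by \<open>SOME\<close>.
  They differ from \<open>a\<close> and \<open>b\<close> by amounts that are negligible at scale
  \<open>d\<close>.\<close>

lemma asymptotic_cone_dist_eq:
  assumes d: "scaling_sequence \<omega> d" and a: "a \<in> cone_seqs d" and b: "b \<in> cone_seqs d"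
    and l: "((\<lambda>n. dist (a n) (b n) / d n) \<longlongrightarrow> l) \<omega>"
  shows "asymptotic_cone_dist \<omega> d (cone_class d a) (cone_class d b) = l"
proof -
  let ?a = "SOME y. y \<in> cone_class d a" and ?b = "SOME y. y \<in> cone_class d b"
  have "((\<lambda>n. dist (?a n) (?b n) / d n) \<longlongrightarrow> l) \<omega>"
  proof (rule Lim_transform2[OF l])
    show "((\<lambda>n. dist (a n) (b n) / d n - dist (?a n) (?b n) / d n) \<longlongrightarrow> 0) \<omega>"
    proof (rule tendsto_rabs_zero_cancel, rule tendsto_sandwich[OF _ _ tendsto_const])
      show "((\<lambda>n. dist (a n) (?a n) / d n + dist (b n) (?b n) / d n) \<longlongrightarrow> 0) \<omega>"
        using tendsto_add[OF rep_in_class(2)[OF d a] rep_in_class(2)[OF d b]] by simp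
      show "eventually (\<lambda>n. \<bar>dist (a n) (b n) / d n - dist (?a n) (?b n) / d n\<bar>
          \<le> dist (a n) (?a n) / d n + dist (b n) (?b n) / d n) \<omega>"
      proof (intro always_eventually allI)
        fix n
        have "\<bar>dist (a n) (b n) - dist (?a n) (?b n)\<bar> \<le> dist (a n) (?a n) + dist (b n) (?b n)"
          using dist_triangle[of "a n" "b n" "?a n"] dist_triangle[of "?a n" "b n" "?b n"]
            dist_triangle[of "?a n" "?b n" "a n"] dist_triangle[of "a n" "?b n" "b n"]
          by (simp add: dist_commute)
        then have "\<bar>dist (a n) (b n) - dist (?a n) (?b n)\<bar> / d n \<le> (dist (a n) (?a n) + dist (b n) (?b n)) / d n"
          using scalingD(1)[OF d, of n] by (intro divide_right_mono) auto
        moreover have "\<bar>dist (a n) (b n) / d n - dist (?a n) (?b n) / d n\<bar> = \<bar>dist (a n) (b n) - dist (?a n) (?b n)\<bar> / d n"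
          using scalingD(1)[OF d, of n] by (simp add: diff_divide_distrib[symmetric])
        ultimately show "\<bar>dist (a n) (b n) / d n - dist (?a n) (?b n) / d n\<bar>
          \<le> dist (a n) (?a n) / d n + dist (b n) (?b n) / d n" by (simp add: add_divide_distrib)
      qed
      show "eventually (\<lambda>n. 0 \<le> \<bar>dist (a n) (b n) / d n - dist (?a n) (?b n) / d n\<bar>) \<omega>" by simp
    qed
  qed
  then show ?thesis unfolding asymptotic_cone_dist_def quotient_dist_def by (rule ultra_dist_eq)
qed

text \<open>With \<open>R = k n\<close> this is the connecting map to the scale \<open>k\<close>;
  with \<open>R\<close> fixed the points stay in a bounded region and converge. The one formula thus
  links the connecting maps to limit rays.\<close>

definition speed_geodesic :: "(nat \<Rightarrow> real) \<Rightarrow> (nat \<Rightarrow> 'a) \<Rightarrow> real \<Rightarrow> nat \<Rightarrow> 'a" where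
  "speed_geodesic d a R n = Xi x0 (a n) (R / d n * dist (a n) x0)"

text \<open>In the direct limit only small scales survive, so a sequence \<open>a\<close> is represented there by the
  limit of the geodesics from \<open>x0\<close> to \<open>a n\<close>, run through with speed \<open>dist (a n) x0 / d n\<close>.\<close>

definition directs :: "(nat \<Rightarrow> real) \<Rightarrow> (nat \<Rightarrow> 'a) \<Rightarrow> (real \<Rightarrow> 'a) euclidean_cone \<Rightarrow> bool" where
  "directs d a P \<longleftrightarrow> P \<in> cone_space (rays x0) \<and>
     (\<forall>R\<ge>0. (speed_geodesic d a R \<longlongrightarrow> cone_ray x0 P R) \<omega>)"

lemma directs_unique:
  assumes "directs d a P" "directs d a Q" shows "P = Q"
proof (rule cone_ray_inject)
  show "P \<in> cone_space (rays x0)" "Q \<in> cone_space (rays x0)" using assms by (simp_all add: directs_def)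
  show "cone_ray x0 P R = cone_ray x0 Q R" if "0 \<le> R" for R
    using assms that by (intro tendsto_unique[OF not_bot, of "speed_geodesic d a R"]) (simp_all add: directs_def)
qed

text \<open>The limit \<open>t\<close> of the rescaled distances is the speed. If it is 0, the paths
  shrink to \<open>x0\<close> and the direction is the apex; otherwise the points escape to infinity
  and a limit ray exists.\<close>

lemma ex_directs:
  assumes d: "scaling_sequence \<omega> d" and a: "a \<in> cone_seqs d"
  shows "\<exists>P. directs d a P"
proof -
  obtain t where t: "((\<lambda>n. dist (a n) x0 / d n) \<longlongrightarrow> t) \<omega>" by (rule that) (rule dist_limit[OF d a x0_seq])
  have t0: "0 \<le> t"
    by (rule tendsto_lowerbound[OF t always_eventually not_bot])
      (intro allI divide_nonneg_nonneg zero_le_dist less_imp_le[OF scalingD(1)[OF d]])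
  show ?thesis
  proof (cases "t = 0")
    case True
    have "directs d a Apex"
      unfolding directs_def
    proof (intro conjI allI impI)
      fix R :: real assume R: "0 \<le> R"
      have "((\<lambda>n. dist (speed_geodesic d a R n) x0) \<longlongrightarrow> 0) \<omega>"
      proof (rule tendsto_sandwich[OF _ _ tendsto_const])
        show "((\<lambda>n. R * (dist (a n) x0 / d n)) \<longlongrightarrow> 0) \<omega>"
          using tendsto_mult[OF tendsto_const[of R] t] by (simp add: True)
        show "eventually (\<lambda>n. dist (speed_geodesic d a R n) x0 \<le> R * (dist (a n) x0 / d n)) \<omega>"
        proof (intro always_eventually allI)
          fix n
          show "dist (speed_geodesic d a R n) x0 \<le> R * (dist (a n) x0 / d n)"
            using dist_Xi_le[of "R / d n * dist (a n) x0" 0 x0 "a n"] R scalingD(1)[OF d, of n]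
            by (simp add: speed_geodesic_def)
        qed
      qed simp
      then show "(speed_geodesic d a R \<longlongrightarrow> cone_ray x0 Apex R) \<omega>"
        unfolding cone_ray.simps by (rule tendsto_dist_iff[THEN iffD2])
    qed (simp add: in_cone_space_iff)
    then show ?thesis by (rule exI)
  next
    case False
    then have tpos: "0 < t" using t0 by simp
    have "filterlim (\<lambda>n. dist (a n) x0 / d n * d n) at_top \<omega>"
      by (rule filterlim_tendsto_pos_mult_at_top[OF t tpos scalingD(2)[OF d]])
    moreover have "dist (a n) x0 / d n * d n = dist x0 (a n)" for n
      using scalingD(1)[OF d, of n] by (simp add: dist_commute)
    ultimately have "filterlim (\<lambda>n. dist x0 (a n)) at_top \<omega>" by simp
    then obtain \<alpha> where \<alpha>: "\<alpha> \<in> rays x0" "\<And>u. 0 \<le> u \<Longrightarrow> ((\<lambda>n. Xi x0 (a n) u) \<longlongrightarrow> \<alpha> u) \<omega>"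
      by (rule limit_ray) (rule that; assumption)
    have "directs d a (Off_Apex t \<alpha>)"
      unfolding directs_def
    proof (intro conjI allI impI)
      show "Off_Apex t \<alpha> \<in> cone_space (rays x0)" using tpos \<alpha>(1) by (simp add: in_cone_space_iff)
      fix R :: real assume R: "0 \<le> R"
      have "((\<lambda>n. dist (speed_geodesic d a R n) (\<alpha> (t * R))) \<longlongrightarrow> 0) \<omega>"
      proof (rule tendsto_sandwich[OF _ _ tendsto_const])
        have "((\<lambda>n. \<bar>R * (dist (a n) x0 / d n) - t * R\<bar> + dist (Xi x0 (a n) (t * R)) (\<alpha> (t * R)))
            \<longlongrightarrow> \<bar>R * t - t * R\<bar> + dist (\<alpha> (t * R)) (\<alpha> (t * R))) \<omega>"
          using R t0 by (intro tendsto_intros t \<alpha>(2)) simp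
        then show "((\<lambda>n. \<bar>R * (dist (a n) x0 / d n) - t * R\<bar> + dist (Xi x0 (a n) (t * R)) (\<alpha> (t * R))) \<longlongrightarrow> 0) \<omega>"
          by (simp add: mult.commute)
        show "eventually (\<lambda>n. dist (speed_geodesic d a R n) (\<alpha> (t * R))
          \<le> \<bar>R * (dist (a n) x0 / d n) - t * R\<bar> + dist (Xi x0 (a n) (t * R)) (\<alpha> (t * R))) \<omega>"
        proof (intro always_eventually allI)
          fix n
          have "dist (speed_geodesic d a R n) (Xi x0 (a n) (t * R)) \<le> \<bar>R * (dist (a n) x0 / d n) - t * R\<bar>"
            using dist_Xi_le[of "R / d n * dist (a n) x0" "t * R" x0 "a n"] R t0 scalingD(1)[OF d, of n]
            by (simp add: speed_geodesic_def)
          then show "dist (speed_geodesic d a R n) (\<alpha> (t * R))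
            \<le> \<bar>R * (dist (a n) x0 / d n) - t * R\<bar> + dist (Xi x0 (a n) (t * R)) (\<alpha> (t * R))"
            using dist_triangle[of "speed_geodesic d a R n" "\<alpha> (t * R)" "Xi x0 (a n) (t * R)"] by simp
        qed
      qed simp
      then show "(speed_geodesic d a R \<longlongrightarrow> cone_ray x0 (Off_Apex t \<alpha>) R) \<omega>"
        unfolding cone_ray.simps by (rule tendsto_dist_iff[THEN iffD2])
    qed
    then show ?thesis by (rule exI)
  qed
qed

text \<open>At parameter \<open>R\<close> the paths to \<open>a n\<close> and \<open>b n\<close>
  differ by at most \<open>R * (dist (a n) (b n) / d n)\<close>, by \<open>Xi_contract\<close>, and
  this tends to 0 for sequences that agree at scale \<open>d\<close>.\<close>

lemma directs_cong:
  assumes d: "scaling_sequence \<omega> d" and ab: "((\<lambda>n. dist (a n) (b n) / d n) \<longlongrightarrow> 0) \<omega>" and P: "directs d a P"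
  shows "directs d b P"
  unfolding directs_def
proof (intro conjI allI impI)
  show "P \<in> cone_space (rays x0)" using P by (simp add: directs_def)
  fix R :: real assume R: "0 \<le> R"
  have "((\<lambda>n. dist (speed_geodesic d b R n) (cone_ray x0 P R)) \<longlongrightarrow> 0) \<omega>"
  proof (rule tendsto_sandwich[OF _ _ tendsto_const])
    have "((\<lambda>n. dist (speed_geodesic d a R n) (cone_ray x0 P R)) \<longlongrightarrow> 0) \<omega>"
      by (rule tendsto_dist_iff[THEN iffD1]) (use P R in \<open>simp add: directs_def\<close>)
    then show "((\<lambda>n. R * (dist (a n) (b n) / d n) + dist (speed_geodesic d a R n) (cone_ray x0 P R)) \<longlongrightarrow> 0) \<omega>"
      using tendsto_add[OF tendsto_mult[OF tendsto_const[of R] ab]] by fastforce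
    show "eventually (\<lambda>n. dist (speed_geodesic d b R n) (cone_ray x0 P R)
      \<le> R * (dist (a n) (b n) / d n) + dist (speed_geodesic d a R n) (cone_ray x0 P R)) \<omega>"
      using scalingD(3)[OF d, of R]
    proof eventually_elim
      case (elim n)
      have "dist (speed_geodesic d a R n) (speed_geodesic d b R n) \<le> R / d n * dist (a n) (b n)"
        using Xi_contract[of "R / d n" x0 "a n" "b n"] elim R scalingD(1)[OF d, of n]
        by (simp add: speed_geodesic_def dist_commute)
      then show ?case
        using dist_triangle3[of "speed_geodesic d b R n" "cone_ray x0 P R" "speed_geodesic d a R n"] by simp
    qed
  qed simp
  then show "(speed_geodesic d b R \<longlongrightarrow> cone_ray x0 P R) \<omega>" by (rule tendsto_dist_iff[THEN iffD2])
qed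

definition direction :: "(nat \<Rightarrow> real) \<times> (nat \<Rightarrow> 'a) set \<Rightarrow> (real \<Rightarrow> 'a) euclidean_cone" where
  "direction = (\<lambda>(d, A). THE P. directs d (SOME a. a \<in> A) P)"

lemma direction:
  assumes d: "scaling_sequence \<omega> d" and a: "a \<in> cone_seqs d"
  shows "directs d a P \<Longrightarrow> direction (d, cone_class d a) = P"
    and "directs d a (direction (d, cone_class d a))"
    and "directs d (SOME b. b \<in> cone_class d a) (direction (d, cone_class d a))"
proof -
  have eq: "direction (d, cone_class d a) = P" and rep: "directs d (SOME b. b \<in> cone_class d a) P"
    if P: "directs d a P" for P
  proof -
    show *: "directs d (SOME b. b \<in> cone_class d a) P"
      by (rule directs_cong[OF d rep_in_class(2)[OF d a] P])
    show "direction (d, cone_class d a) = P"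
      unfolding direction_def case_prod_conv
    proof (rule the_equality)
      show "directs d (SOME b. b \<in> cone_class d a) P" by (rule *)
      show "Q = P" if "directs d (SOME b. b \<in> cone_class d a) Q" for Q by (rule directs_unique[OF that *])
    qed
  qed
  show "directs d a P \<Longrightarrow> direction (d, cone_class d a) = P" by (rule eq)
  obtain P where P: "directs d a P" using ex_directs[OF d a] by (elim exE)
  then show "directs d a (direction (d, cone_class d a))" by (simp add: eq[OF P])
  show "directs d (SOME b. b \<in> cone_class d a) (direction (d, cone_class d a))"
    using rep[OF P] by (simp add: eq[OF P])
qed

text \<open>The geodesic from \<open>x0\<close> to a point of a ray is the ray itself, so the
  sequence along the ray has the direction \<open>P\<close>: at every scale \<open>Psi\<close> is a
  section of \<open>direction\<close>.\<close>

lemma cone_ray_seq: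
  assumes d: "scaling_sequence \<omega> d" and P: "P \<in> cone_space (rays x0)"
  shows "(\<lambda>n. cone_ray x0 P (d n)) \<in> cone_seqs d" "directs d (\<lambda>n. cone_ray x0 P (d n)) P"
    "Psi \<omega> x0 d P = cone_class d (\<lambda>n. cone_ray x0 P (d n))"
proof -
  have r: "dist (cone_ray x0 P (d n)) x0 = cone_radius P * d n" for n
    using dist_cone_ray[OF P, of "d n"] scalingD(1)[OF d, of n] by (simp add: dist_commute)
  show "(\<lambda>n. cone_ray x0 P (d n)) \<in> cone_seqs d"
    unfolding cone_seqs_iff using scalingD(1)[OF d] by (intro exI[of _ "cone_radius P"]) (simp add: r less_imp_neq[symmetric])
  show "directs d (\<lambda>n. cone_ray x0 P (d n)) P"
    unfolding directs_def
  proof (intro conjI allI impI P)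
    fix R :: real assume R: "0 \<le> R"
    have "eventually (\<lambda>n. speed_geodesic d (\<lambda>n. cone_ray x0 P (d n)) R n = cone_ray x0 P R) \<omega>"
      using scalingD(3)[OF d, of R]
    proof eventually_elim
      case (elim n)
      have "R / d n * (cone_radius P * d n) = cone_radius P * R" using scalingD(1)[OF d, of n] by simp
      then show ?case using Xi_cone_ray[OF P R elim] by (simp add: speed_geodesic_def r)
    qed
    then show "(speed_geodesic d (\<lambda>n. cone_ray x0 P (d n)) R \<longlongrightarrow> cone_ray x0 P R) \<omega>"
      by (rule tendsto_eventually)
  qed
  show "Psi \<omega> x0 d P = cone_class d (\<lambda>n. cone_ray x0 P (d n))" by (cases P) simp_all
qed

lemma speed_geodesic_seq:
  assumes d: "scaling_sequence \<omega> d" and k: "scaling_sequence \<omega> k" and a: "a \<in> cone_seqs d"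
  shows "(\<lambda>n. speed_geodesic d a (k n) n) \<in> cone_seqs k"
proof -
  obtain B where B: "\<forall>n. dist (a n) x0 / d n \<le> B" using a unfolding cone_seqs_iff by (elim exE)
  have "dist (speed_geodesic d a (k n) n) x0 / k n \<le> B" for n
  proof -
    have "dist (speed_geodesic d a (k n) n) x0 \<le> k n / d n * dist (a n) x0"
      using dist_Xi_le[of "k n / d n * dist (a n) x0" 0 x0 "a n"] scalingD(1)[OF d, of n] scalingD(1)[OF k, of n]
      by (simp add: speed_geodesic_def)
    then have "dist (speed_geodesic d a (k n) n) x0 / k n \<le> (k n / d n * dist (a n) x0) / k n"
      using scalingD(1)[OF k, of n] by (intro divide_right_mono) auto
    also have "\<dots> = dist (a n) x0 / d n" using scalingD(1)[OF k, of n] by simp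
    finally show ?thesis using spec[OF B, of n] by simp
  qed
  then show ?thesis unfolding cone_seqs_iff by (intro exI[of _ B] allI)
qed

lemma connecting_map_eq:
  "connecting_map \<omega> x0 d k A = cone_class k (\<lambda>n. speed_geodesic d (SOME a. a \<in> A) (k n) n)"
  by (simp add: connecting_map_def Let_def speed_geodesic_def)

lemma speed_geodesic_speed_geodesic:
  assumes "0 \<le> R" "R \<le> k" "0 < k" "k \<le> d n"
  shows "Xi x0 (speed_geodesic d a k n) (R / k * dist x0 (speed_geodesic d a k n)) = speed_geodesic d a R n"
proof -
  define D where "D = dist x0 (a n)"
  have d: "0 < d n" using assms by linarith
  have "k / d n \<le> 1" using assms d by simp
  then have "k / d n * D \<le> 1 * D" by (intro mult_right_mono) (simp_all add: D_def)
  then have le: "k / d n * D \<le> D" by simp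
  have s: "speed_geodesic d a r n = Xi x0 (a n) (r / d n * D)" for r
    by (simp add: speed_geodesic_def D_def dist_commute)
  have 1: "dist x0 (Xi x0 (a n) (k / d n * D)) = k / d n * D"
    using dist_base_Xi[of "k / d n * D" x0 "a n"] le assms d by (simp add: D_def)
  have 2: "R / k * (k / d n * D) = R / d n * D" using assms by simp
  have 3: "Xi x0 (Xi x0 (a n) (k / d n * D)) (R / d n * D) = Xi x0 (a n) (R / d n * D)"
    using le assms d by (intro Xi_Xi) (auto simp: D_def intro!: mult_right_mono divide_right_mono)
  show ?thesis unfolding s 1 2 3 ..
qed

text \<open>For fixed \<open>R\<close> the ratio at \<open>R\<close> is eventually at most the ratio
  at \<open>k n\<close>, by contraction towards \<open>x0\<close>. Passing to the limit first along
  \<open>\<omega>\<close> and then in \<open>R\<close> gives the cone distance.\<close>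

lemma cone_predist_lower:
  assumes k: "scaling_sequence \<omega> k" and d: "scaling_le \<omega> k d" and e: "scaling_le \<omega> k e"
    and P: "directs d a P" and Q: "directs e b Q"
    and l: "((\<lambda>n. dist (speed_geodesic d a (k n) n) (speed_geodesic e b (k n) n) / k n) \<longlongrightarrow> l) \<omega>"
  shows "angle_cone_dist x0 P Q \<le> l"
proof -
  have PQ: "P \<in> cone_space (rays x0)" "Q \<in> cone_space (rays x0)" using P Q by (simp_all add: directs_def)
  have le: "dist (cone_ray x0 P R) (cone_ray x0 Q R) / R \<le> l" if R: "0 < R" for R
  proof (rule tendsto_le[OF not_bot l])
    show "((\<lambda>n. dist (speed_geodesic d a R n) (speed_geodesic e b R n) / R)
        \<longlongrightarrow> dist (cone_ray x0 P R) (cone_ray x0 Q R) / R) \<omega>"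
      using P Q R by (intro tendsto_intros) (auto simp: directs_def)
    show "eventually (\<lambda>n. dist (speed_geodesic d a R n) (speed_geodesic e b R n) / R
        \<le> dist (speed_geodesic d a (k n) n) (speed_geodesic e b (k n) n) / k n) \<omega>"
      using scalingD(3)[OF k, of R] d[unfolded scaling_le_def] e[unfolded scaling_le_def]
    proof eventually_elim
      case (elim n)
      have kn: "0 < k n" by (rule scalingD(1)[OF k])
      have *: "Xi x0 (speed_geodesic d a (k n) n) (R / k n * dist x0 (speed_geodesic d a (k n) n)) = speed_geodesic d a R n"
        "Xi x0 (speed_geodesic e b (k n) n) (R / k n * dist x0 (speed_geodesic e b (k n) n)) = speed_geodesic e b R n"
        by (rule speed_geodesic_speed_geodesic; use elim R kn in simp)+
      have "0 \<le> R / k n" "R / k n \<le> 1" using R elim kn by simp_all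
      from Xi_contract[OF this, of x0 "speed_geodesic d a (k n) n" "speed_geodesic e b (k n) n"]
      have "dist (speed_geodesic d a R n) (speed_geodesic e b R n)
          \<le> R / k n * dist (speed_geodesic d a (k n) n) (speed_geodesic e b (k n) n)"
        unfolding * .
      then show ?case using R kn by (simp add: field_simps)
    qed
  qed
  have ev: "eventually (\<lambda>R. dist (cone_ray x0 P R) (cone_ray x0 Q R) / R \<le> l) at_top"
    using eventually_gt_at_top[of "0::real"] by eventually_elim (rule le)
  show ?thesis by (rule tendsto_upperbound[OF angle_cone_limit[OF PQ] ev]) simp
qed

text \<open>Along a sufficiently slow sequence \<open>k\<close> the geodesics have not yet left their limit rays, and
  the infimum in the direct limit is attained.\<close>

lemma cone_predist_attained:
  assumes d: "scaling_sequence \<omega> d" and e: "scaling_sequence \<omega> e" and P: "directs d a P" and Q: "directs e b Q"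
  shows "\<exists>k. scaling_sequence \<omega> k \<and> scaling_le \<omega> k d \<and> scaling_le \<omega> k e \<and>
    ((\<lambda>n. dist (speed_geodesic d a (k n) n) (speed_geodesic e b (k n) n) / k n) \<longlongrightarrow> angle_cone_dist x0 P Q) \<omega>"
proof -
  \<comment> \<open>The tolerance 1 is arbitrary: the total error 2 disappears after division by
    \<open>k n\<close>. The last two conditions place \<open>k\<close> below both scales.\<close>
  define G where "G R n \<longleftrightarrow> dist (speed_geodesic d a R n) (cone_ray x0 P R) < 1 \<and>
    dist (speed_geodesic e b R n) (cone_ray x0 Q R) < 1 \<and> R \<le> d n \<and> R \<le> e n" for R n
  have "eventually (G (real R)) \<omega>" for R :: nat
    unfolding G_def using P Q
    by (intro eventually_conj tendstoD scalingD(3) d e) (simp_all add: directs_def)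
  then obtain j :: "nat \<Rightarrow> nat" where j: "\<And>n. 1 \<le> j n" "filterlim j at_top \<omega>" "eventually (\<lambda>n. G (real (j n)) n) \<omega>"
    by (rule slow_sequence[of "\<lambda>R n. G (real R) n"]) (rule that; assumption)
  define k where "k n = real (j n)" for n
  have k1: "0 < k n" for n using j(1)[of n] by (simp add: k_def)
  have kinf: "filterlim k at_top \<omega>"
    unfolding k_def by (rule filterlim_compose[OF filterlim_real_sequentially j(2)])
  have kG: "eventually (\<lambda>n. G (k n) n) \<omega>" using j(3) by (simp add: k_def)
  have k: "scaling_sequence \<omega> k" using k1 kinf by (simp add: scaling_sequence_def)
  have le: "scaling_le \<omega> k d" "scaling_le \<omega> k e"
    unfolding scaling_le_def using kG by (rule eventually_mono, simp add: G_def)+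
  have PQ: "P \<in> cone_space (rays x0)" "Q \<in> cone_space (rays x0)" using P Q by (simp_all add: directs_def)
  have lim: "((\<lambda>n. dist (cone_ray x0 P (k n)) (cone_ray x0 Q (k n)) / k n) \<longlongrightarrow> angle_cone_dist x0 P Q) \<omega>"
    by (rule filterlim_compose[OF angle_cone_limit[OF PQ] kinf])
  have "((\<lambda>n. dist (speed_geodesic d a (k n) n) (speed_geodesic e b (k n) n) / k n) \<longlongrightarrow> angle_cone_dist x0 P Q) \<omega>"
  proof (rule Lim_transform2[OF lim], rule tendsto_rabs_zero_cancel, rule tendsto_sandwich[OF _ _ tendsto_const])
    show "((\<lambda>n. 2 / k n) \<longlongrightarrow> 0) \<omega>"
      by (rule tendsto_divide_0[OF tendsto_const filterlim_at_top_imp_at_infinity[OF kinf]])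
    show "eventually (\<lambda>n. \<bar>dist (cone_ray x0 P (k n)) (cone_ray x0 Q (k n)) / k n
        - dist (speed_geodesic d a (k n) n) (speed_geodesic e b (k n) n) / k n\<bar> \<le> 2 / k n) \<omega>"
      using kG
    proof eventually_elim
      case (elim n)
      let ?p = "cone_ray x0 P (k n)" and ?q = "cone_ray x0 Q (k n)"
        and ?u = "speed_geodesic d a (k n) n" and ?v = "speed_geodesic e b (k n) n"
      have "dist ?u ?p < 1" "dist ?v ?q < 1" using elim by (simp_all add: G_def)
      then have "\<bar>dist ?p ?q - dist ?u ?v\<bar> \<le> 2"
        using dist_triangle[of ?p ?q ?u] dist_triangle[of ?u ?q ?v] dist_triangle[of ?u ?v ?p] dist_triangle[of ?p ?v ?q]
        by (simp add: dist_commute)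
      then have "\<bar>dist ?p ?q - dist ?u ?v\<bar> / k n \<le> 2 / k n" using k1[of n] by (intro divide_right_mono) auto
      then show ?case using k1[of n] by (simp add: diff_divide_distrib[symmetric])
    qed
  qed simp
  then show ?thesis using k le by (intro exI[of _ k] conjI)
qed

abbreviation "cone_limit_predist \<equiv>
  direct_limit_predist {d. scaling_sequence \<omega> d} (scaling_le \<omega>) (asymptotic_cone_dist \<omega>) (connecting_map \<omega> x0)"

lemma cone_limit_predist_eq:
  assumes d: "scaling_sequence \<omega> d" and e: "scaling_sequence \<omega> e"
    and a: "a \<in> cone_seqs d" and b: "b \<in> cone_seqs e"
  shows "cone_limit_predist (d, cone_class d a) (e, cone_class e b)
    = angle_cone_dist x0 (direction (d, cone_class d a)) (direction (e, cone_class e b))"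
proof -
  \<comment> \<open>\<open>connecting_map\<close> evaluates \<open>SOME\<close> representatives, so
    the estimates must be applied to these; their directions are those of the classes.\<close>
  define a' b' where "a' = (SOME x. x \<in> cone_class d a)" and "b' = (SOME x. x \<in> cone_class e b)"
  define P Q where "P = direction (d, cone_class d a)" and "Q = direction (e, cone_class e b)"
  have a': "a' \<in> cone_seqs d" "directs d a' P" unfolding a'_def P_def by (rule rep_in_class[OF d a] direction[OF d a])+
  have b': "b' \<in> cone_seqs e" "directs e b' Q" unfolding b'_def Q_def by (rule rep_in_class[OF e b] direction[OF e b])+
  define K where "K = {k \<in> {d. scaling_sequence \<omega> d}. scaling_le \<omega> k d \<and> scaling_le \<omega> k e}"
  define f where "f k = asymptotic_cone_dist \<omega> k (connecting_map \<omega> x0 d k (cone_class d a)) (connecting_map \<omega> x0 e k (cone_class e b))" for k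
  have f: "f k = l" if k: "scaling_sequence \<omega> k"
    and l: "((\<lambda>n. dist (speed_geodesic d a' (k n) n) (speed_geodesic e b' (k n) n) / k n) \<longlongrightarrow> l) \<omega>" for k l
    unfolding f_def connecting_map_eq a'_def[symmetric] b'_def[symmetric]
    by (rule asymptotic_cone_dist_eq[OF k speed_geodesic_seq[OF d k a'(1)] speed_geodesic_seq[OF e k b'(1)] l])
  have lower: "angle_cone_dist x0 P Q \<le> f k" if "k \<in> K" for k
  proof -
    have k: "scaling_sequence \<omega> k" "scaling_le \<omega> k d" "scaling_le \<omega> k e" using that by (simp_all add: K_def)
    note l = dist_limit[OF k(1) speed_geodesic_seq[OF d k(1) a'(1)] speed_geodesic_seq[OF e k(1) b'(1)]]
    show ?thesis unfolding f[OF k(1) l] by (rule cone_predist_lower[OF k a'(2) b'(2) l])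
  qed
  from cone_predist_attained[OF d e a'(2) b'(2)] obtain k where k: "scaling_sequence \<omega> k" "scaling_le \<omega> k d" "scaling_le \<omega> k e"
    "((\<lambda>n. dist (speed_geodesic d a' (k n) n) (speed_geodesic e b' (k n) n) / k n) \<longlongrightarrow> angle_cone_dist x0 P Q) \<omega>"
    by (elim exE conjE)
  have "k \<in> K" using k by (simp add: K_def)
  moreover have "f k = angle_cone_dist x0 P Q" by (rule f[OF k(1,4)])
  ultimately have "angle_cone_dist x0 P Q \<in> f ` K" using imageI[of k K f] by simp
  then have "Inf (f ` K) = angle_cone_dist x0 P Q"
    by (rule cInf_eq_minimum) (use lower in auto)
  then show ?thesis unfolding direct_limit_predist_def P_def Q_def f_def K_def by simp
qed

lemma Theta_eq: "Theta \<omega> x0 d A = quotient_class (SIGMA d:{d. scaling_sequence \<omega> d}. asymptotic_cone \<omega> x0 d) cone_limit_predist (d, A)"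
  by (simp add: Theta_def canonical_projection_def)

text \<open>The pseudometric of the direct limit is the pullback of the cone metric along
  \<open>direction\<close>, and \<open>Psi\<close> at the single scale \<open>d\<close> is a
  section, so \<open>metric_quotient_pullback\<close> applies.\<close>

lemma cone_limit_isometry:
  assumes d: "scaling_sequence \<omega> d"
  shows "isometry_onto (Theta \<omega> x0 d \<circ> Psi \<omega> x0 d) (cone_space (rays x0)) (angle_cone_dist x0)
      (cone_limit \<omega> x0) (cone_limit_dist \<omega> x0)"
    and "a \<in> cone_seqs d \<Longrightarrow> b \<in> cone_seqs d \<Longrightarrow> directs d a P \<Longrightarrow> directs d b P \<Longrightarrow>
      Theta \<omega> x0 d (cone_class d a) = Theta \<omega> x0 d (cone_class d b)"
proof -
  let ?S = "SIGMA d:{d. scaling_sequence \<omega> d}. asymptotic_cone \<omega> x0 d"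
  have S: "\<exists>e a. scaling_sequence \<omega> e \<and> a \<in> cone_seqs e \<and> x = (e, cone_class e a)" if "x \<in> ?S" for x
    using that unfolding asymptotic_cone_eq by (auto simp: image_iff)
  have S': "(e, cone_class e a) \<in> ?S" if "scaling_sequence \<omega> e" "a \<in> cone_seqs e" for e a
    using that unfolding asymptotic_cone_eq by simp
  have L: "direction x \<in> cone_space (rays x0)" if "x \<in> ?S" for x
  proof -
    from S[OF that] obtain e a where "scaling_sequence \<omega> e" "a \<in> cone_seqs e" "x = (e, cone_class e a)" by (elim exE conjE)
    then show ?thesis using direction(2)[of e a] by (simp add: directs_def)
  qed
  have \<rho>: "cone_limit_predist x y = angle_cone_dist x0 (direction x) (direction y)" if "x \<in> ?S" "y \<in> ?S" for x y
  proof -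
    from S[OF that(1)] obtain e a where x: "scaling_sequence \<omega> e" "a \<in> cone_seqs e" "x = (e, cone_class e a)" by (elim exE conjE)
    from S[OF that(2)] obtain f b where y: "scaling_sequence \<omega> f" "b \<in> cone_seqs f" "y = (f, cone_class f b)" by (elim exE conjE)
    show ?thesis unfolding x(3) y(3) by (rule cone_limit_predist_eq[OF x(1) y(1) x(2) y(2)])
  qed
  have g1: "(d, Psi \<omega> x0 d P) \<in> ?S" if "P \<in> cone_space (rays x0)" for P
    unfolding cone_ray_seq(3)[OF d that] by (rule S'[OF d cone_ray_seq(1)[OF d that]])
  have g2: "direction (d, Psi \<omega> x0 d P) = P" if "P \<in> cone_space (rays x0)" for P
    unfolding cone_ray_seq(3)[OF d that] by (rule direction(1)[OF d cone_ray_seq(1,2)[OF d that]])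
  have q1: "isometry_onto (\<lambda>P. quotient_class ?S cone_limit_predist (d, Psi \<omega> x0 d P)) (cone_space (rays x0))
      (angle_cone_dist x0) (metric_quotient ?S cone_limit_predist) (quotient_dist cone_limit_predist)"
    by (rule metric_quotient_pullback(1)[where L = direction]; (rule L g1 g2 \<rho> angle_cone_dist_0_iff; assumption))
  have q2: "quotient_class ?S cone_limit_predist x = quotient_class ?S cone_limit_predist y"
    if "x \<in> ?S" "y \<in> ?S" "direction x = direction y" for x y
    by (rule metric_quotient_pullback(2)[where L = direction and C = "cone_space (rays x0)"
          and g = "\<lambda>P. (d, Psi \<omega> x0 d P)" and \<delta> = "angle_cone_dist x0", OF _ _ _ _ _ that];
        (rule L g1 g2 \<rho> angle_cone_dist_0_iff; assumption))
  have "Theta \<omega> x0 d \<circ> Psi \<omega> x0 d = (\<lambda>P. quotient_class ?S cone_limit_predist (d, Psi \<omega> x0 d P))"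
    by (rule ext) (simp add: Theta_eq)
  then show "isometry_onto (Theta \<omega> x0 d \<circ> Psi \<omega> x0 d) (cone_space (rays x0)) (angle_cone_dist x0)
      (cone_limit \<omega> x0) (cone_limit_dist \<omega> x0)"
    using q1 by (simp add: cone_limit_def direct_limit_def cone_limit_dist_def direct_limit_dist_def)
  assume ab: "a \<in> cone_seqs d" "b \<in> cone_seqs d" "directs d a P" "directs d b P"
  show "Theta \<omega> x0 d (cone_class d a) = Theta \<omega> x0 d (cone_class d b)"
    unfolding Theta_eq
    by (rule q2[OF S'[OF d ab(1)] S'[OF d ab(2)]])
      (simp add: direction(1)[OF d ab(1,3)] direction(1)[OF d ab(2,4)])
qed

lemma Theta_in_cone_limit:
  assumes "scaling_sequence \<omega> d" "A \<in> asymptotic_cone \<omega> x0 d"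
  shows "Theta \<omega> x0 d A \<in> cone_limit \<omega> x0"
  unfolding Theta_eq cone_limit_def direct_limit_def metric_quotient_def quotient_class_def
  using assms by (intro quotientI) simp

section \<open>The ultraproduct of the boundary and its map to the asymptotic cone\<close>

lemma ray_seq_close:
  assumes "\<And>n. \<alpha> n \<in> rays x0" "\<And>n. \<gamma> n \<in> rays x0" "((\<lambda>n. ray_angle x0 (\<alpha> n) (\<gamma> n)) \<longlongrightarrow> 0) \<omega>"
    and d: "\<And>n. 0 < d n" and t: "0 \<le> t"
  shows "((\<lambda>n. dist (\<alpha> n (t * d n)) (\<gamma> n (t * d n)) / d n) \<longlongrightarrow> 0) \<omega>"
proof (rule tendsto_sandwich[OF _ _ tendsto_const])
  \<comment> \<open>The rescaled distance is at most \<open>t\<close> times the chord of the angle,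
    whatever the scale.\<close>
  have "((\<lambda>n. t * sqrt (2 - 2 * cos (ray_angle x0 (\<alpha> n) (\<gamma> n)))) \<longlongrightarrow> t * sqrt (2 - 2 * cos 0)) \<omega>"
    by (intro tendsto_intros assms(3))
  then show "((\<lambda>n. t * sqrt (2 - 2 * cos (ray_angle x0 (\<alpha> n) (\<gamma> n)))) \<longlongrightarrow> 0) \<omega>" by simp
  show "eventually (\<lambda>n. dist (\<alpha> n (t * d n)) (\<gamma> n (t * d n)) / d n
      \<le> t * sqrt (2 - 2 * cos (ray_angle x0 (\<alpha> n) (\<gamma> n)))) \<omega>"
  proof (intro always_eventually allI)
    fix n
    have "dist (\<alpha> n (t * d n)) (\<gamma> n (t * d n)) \<le> t * d n * sqrt (2 - 2 * cos (ray_angle x0 (\<alpha> n) (\<gamma> n)))"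
      using d[of n] t by (intro ray_dist_le_angle assms(1,2)) auto
    then show "dist (\<alpha> n (t * d n)) (\<gamma> n (t * d n)) / d n \<le> t * sqrt (2 - 2 * cos (ray_angle x0 (\<alpha> n) (\<gamma> n)))"
      using d[of n] by (simp add: pos_divide_le_eq mult.commute mult.left_commute)
  qed
  show "eventually (\<lambda>n. 0 \<le> dist (\<alpha> n (t * d n)) (\<gamma> n (t * d n)) / d n) \<omega>"
    using d by (intro always_eventually allI divide_nonneg_nonneg zero_le_dist less_imp_le)
qed

abbreviation "boundary_seqs \<equiv> bounded_sequences (\<lambda>_. rays x0) (\<lambda>_. ray_angle x0) (\<lambda>_. SOME \<alpha>. \<alpha> \<in> rays x0)"

lemma boundary_seqs_iff: "\<alpha> \<in> boundary_seqs \<longleftrightarrow> (\<forall>n. \<alpha> n \<in> rays x0)"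
proof
  assume \<alpha>: "\<forall>n. \<alpha> n \<in> rays x0"
  then have "(SOME \<alpha>. \<alpha> \<in> rays x0) \<in> rays x0" by (intro someI[of "\<lambda>\<alpha>. \<alpha> \<in> rays x0" "\<alpha> 0"]) simp
  then have "ray_angle x0 (\<alpha> n) (SOME \<alpha>. \<alpha> \<in> rays x0) \<le> pi" for n using \<alpha> by (intro ray_angle_le_pi) auto
  then show "\<alpha> \<in> boundary_seqs" unfolding bounded_sequences_def using \<alpha> by (intro CollectI conjI exI[of _ pi]) auto
qed (simp add: bounded_sequences_def)

lemma angle_ultralimit:
  assumes "\<forall>n. \<alpha> n \<in> rays x0" "\<forall>n. \<gamma> n \<in> rays x0"
  shows "((\<lambda>n. ray_angle x0 (\<alpha> n) (\<gamma> n)) \<longlongrightarrow> ultra_dist \<omega> (\<lambda>_. ray_angle x0) \<alpha> \<gamma>) \<omega>"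
proof -
  have "\<bar>ray_angle x0 (\<alpha> n) (\<gamma> n)\<bar> \<le> pi" for n
    using ray_angle_nonneg ray_angle_le_pi assms by simp
  then obtain l where l: "((\<lambda>n. ray_angle x0 (\<alpha> n) (\<gamma> n)) \<longlongrightarrow> l) \<omega>"
    by (rule bounded_limit[OF always_eventually[OF allI]])
  then show ?thesis unfolding ultra_dist_def by (simp add: Lim_eq[OF l])
qed

lemma ultra_boundary_rep:
  assumes A: "A \<in> ultra_boundary \<omega> x0"
  shows "\<alpha> \<in> A \<Longrightarrow> \<alpha> n \<in> rays x0" "(SOME \<alpha>. \<alpha> \<in> A) \<in> A"
    "\<alpha> \<in> A \<Longrightarrow> \<gamma> \<in> A \<Longrightarrow> ((\<lambda>n. ray_angle x0 (\<alpha> n) (\<gamma> n)) \<longlongrightarrow> 0) \<omega>"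
proof -
  let ?\<rho> = "ultra_dist \<omega> (\<lambda>_. ray_angle x0)"
  obtain \<xi> where \<xi>: "\<xi> \<in> boundary_seqs" "A = zero_dist_rel boundary_seqs ?\<rho> `` {\<xi>}"
    using A unfolding ultra_boundary_def ultraproduct_def metric_quotient_def by (rule quotientE)
  have \<xi>r: "\<forall>n. \<xi> n \<in> rays x0" using \<xi>(1) by (rule boundary_seqs_iff[THEN iffD1])
  have mem: "\<alpha> \<in> A \<longleftrightarrow> \<alpha> \<in> boundary_seqs \<and> ?\<rho> \<xi> \<alpha> = 0" for \<alpha>
    unfolding \<xi>(2) zero_dist_rel_def using \<xi>(1) by auto
  have r: "\<forall>n. \<alpha> n \<in> rays x0" if "\<alpha> \<in> A" for \<alpha> using that unfolding mem boundary_seqs_iff by simp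
  then show "\<alpha> \<in> A \<Longrightarrow> \<alpha> n \<in> rays x0" by simp
  have "(\<lambda>n. ray_angle x0 (\<xi> n) (\<xi> n)) = (\<lambda>n. 0)" by (rule ext, rule ray_angle_self, rule spec[OF \<xi>r])
  then have "?\<rho> \<xi> \<xi> = 0" unfolding ultra_dist_def by (simp add: Lim_eq[OF tendsto_const])
  then have "\<xi> \<in> A" using \<xi>(1) by (simp add: mem)
  then show "(SOME \<alpha>. \<alpha> \<in> A) \<in> A" by (rule someI[of "\<lambda>\<alpha>. \<alpha> \<in> A"])
  have lim: "((\<lambda>n. ray_angle x0 (\<xi> n) (\<alpha> n)) \<longlongrightarrow> 0) \<omega>" if "\<alpha> \<in> A" for \<alpha>
    using angle_ultralimit[OF \<xi>r r[OF that]] that by (simp add: mem)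
  show "((\<lambda>n. ray_angle x0 (\<alpha> n) (\<gamma> n)) \<longlongrightarrow> 0) \<omega>" if "\<alpha> \<in> A" "\<gamma> \<in> A"
  proof (rule tendsto_sandwich[OF _ _ tendsto_const])
    show "((\<lambda>n. ray_angle x0 (\<xi> n) (\<alpha> n) + ray_angle x0 (\<xi> n) (\<gamma> n)) \<longlongrightarrow> 0) \<omega>"
      using tendsto_add[OF lim[OF that(1)] lim[OF that(2)]] by simp
    show "eventually (\<lambda>n. ray_angle x0 (\<alpha> n) (\<gamma> n) \<le> ray_angle x0 (\<xi> n) (\<alpha> n) + ray_angle x0 (\<xi> n) (\<gamma> n)) \<omega>"
    proof (intro always_eventually allI)
      fix n
      show "ray_angle x0 (\<alpha> n) (\<gamma> n) \<le> ray_angle x0 (\<xi> n) (\<alpha> n) + ray_angle x0 (\<xi> n) (\<gamma> n)"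
        using ray_angle_triangle[of "\<alpha> n" x0 "\<xi> n" "\<gamma> n"] ray_angle_commute[of "\<alpha> n" x0 "\<xi> n"] r that \<xi>r by simp
    qed
    show "eventually (\<lambda>n. 0 \<le> ray_angle x0 (\<alpha> n) (\<gamma> n)) \<omega>"
      using r that by (intro always_eventually allI ray_angle_nonneg) simp_all
  qed
qed

lemma ray_seq_in_cone_seqs:
  assumes "scaling_sequence \<omega> d" "\<And>n. \<gamma> n \<in> rays x0" "0 \<le> t"
  shows "(\<lambda>n. \<gamma> n (t * d n)) \<in> cone_seqs d"
proof -
  have "dist (\<gamma> n (t * d n)) x0 / d n \<le> t" for n
    using ray_dist_base[OF assms(2), of "t * d n" n] scalingD(1)[OF assms(1), of n] assms(3)
    by (simp add: dist_commute)
  then show ?thesis unfolding cone_seqs_iff by (intro exI[of _ t] allI)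
qed

lemma Psi_ultra_eq:
  assumes A: "A \<in> ultra_boundary \<omega> x0"
  shows "Psi_ultra \<omega> x0 d (cone_point t A) = cone_class d (\<lambda>n. (SOME \<alpha>. \<alpha> \<in> A) n (t * d n))"
proof (cases "t = 0")
  case True
  have "(SOME \<alpha>. \<alpha> \<in> A) n 0 = x0" for n
    using ray_0 ultra_boundary_rep(1)[OF A ultra_boundary_rep(2)[OF A]] by blast
  then show ?thesis using True by (simp add: cone_point_def)
qed (simp add: cone_point_def)

text \<open>The members of a class in the ultraproduct have one common visual limit
  \<open>\<beta>\<close>, since small angles mean small distances at every fixed parameter. The
  geodesic to \<open>\<gamma> n (t * d n)\<close> follows \<open>\<gamma> n\<close>, so this
  sequence has the direction given by \<open>t\<close> and \<open>\<beta>\<close>, as has the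
  sequence along \<open>\<beta>\<close> itself.\<close>

lemma Theta_Psi_ultra:
  assumes d: "scaling_sequence \<omega> d" and t: "0 \<le> t" and A: "A \<in> ultra_boundary \<omega> x0" and \<alpha>: "\<alpha> \<in> A"
  shows "Theta \<omega> x0 d (Psi_ultra \<omega> x0 d (cone_point t A)) =
    Theta \<omega> x0 d (Psi \<omega> x0 d (cone_point t (visual_lim \<omega> x0 \<alpha>)))"
proof -
  define \<gamma> where "\<gamma> = (SOME \<alpha>. \<alpha> \<in> A)"
  have \<gamma>A: "\<gamma> \<in> A" unfolding \<gamma>_def by (rule ultra_boundary_rep(2)[OF A])
  have r: "\<alpha> n \<in> rays x0" "\<gamma> n \<in> rays x0" for n by (rule ultra_boundary_rep(1)[OF A]; fact)+
  obtain \<beta> where \<beta>: "\<beta> \<in> rays x0" "\<And>u. 0 \<le> u \<Longrightarrow> ((\<lambda>n. \<alpha> n u) \<longlongrightarrow> \<beta> u) \<omega>"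
    by (rule limit_of_rays[OF r(1)]) (rule that; assumption)
  have vis: "visual_lim \<omega> x0 \<alpha> = \<beta>" by (rule visual_lim_eq[OF r(1) \<beta>])
  have \<gamma>lim: "((\<lambda>n. \<gamma> n u) \<longlongrightarrow> \<beta> u) \<omega>" if u: "0 \<le> u" for u
  proof -
    \<comment> \<open>\<open>ray_seq_close\<close> with the constant scale 1, that is, without
      rescaling.\<close>
    have "((\<lambda>n. dist (\<alpha> n (u * 1)) (\<gamma> n (u * 1)) / 1) \<longlongrightarrow> 0) \<omega>"
      by (rule ray_seq_close[OF r(1) r(2) ultra_boundary_rep(3)[OF A \<alpha> \<gamma>A] _ u]) simp
    then have "((\<lambda>n. dist (\<alpha> n u) (\<gamma> n u)) \<longlongrightarrow> 0) \<omega>" by simp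
    from tendsto_add[OF this tendsto_dist_iff[THEN iffD1, OF \<beta>(2)[OF u]]]
    have lim: "((\<lambda>n. dist (\<alpha> n u) (\<gamma> n u) + dist (\<alpha> n u) (\<beta> u)) \<longlongrightarrow> 0) \<omega>" by simp
    have "((\<lambda>n. dist (\<gamma> n u) (\<beta> u)) \<longlongrightarrow> 0) \<omega>"
      by (rule tendsto_sandwich[OF _ _ tendsto_const lim]) (simp_all add: dist_triangle3)
    then show ?thesis by (rule tendsto_dist_iff[THEN iffD2])
  qed
  let ?P = "cone_point t \<beta>"
  have P: "?P \<in> cone_space (rays x0)" using t \<beta>(1) by (auto simp: in_cone_space_iff cone_point_def)
  have cr: "cone_ray x0 ?P R = \<beta> (t * R)" for R using ray_0[OF \<beta>(1)] by (simp add: cone_point_def)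
  have "directs d (\<lambda>n. \<gamma> n (t * d n)) ?P"
    unfolding directs_def
  proof (intro conjI allI impI P)
    fix R :: real assume R: "0 \<le> R"
    have "eventually (\<lambda>n. \<gamma> n (t * R) = speed_geodesic d (\<lambda>n. \<gamma> n (t * d n)) R n) \<omega>"
      using scalingD(3)[OF d, of R]
    proof eventually_elim
      case (elim n)
      have dn: "0 < d n" by (rule scalingD(1)[OF d])
      have "dist (\<gamma> n (t * d n)) x0 = t * d n"
        using ray_dist_base[OF r(2), of "t * d n" n] t dn by (simp add: dist_commute)
      then have "speed_geodesic d (\<lambda>n. \<gamma> n (t * d n)) R n = Xi x0 (\<gamma> n (t * d n)) (t * R)"
        using dn by (simp add: speed_geodesic_def mult.commute)
      also have "\<dots> = \<gamma> n (t * R)" using elim R t by (intro Xi_geodesic_ray[OF r(2)] mult_left_mono) auto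
      finally show ?case by simp
    qed
    then show "(speed_geodesic d (\<lambda>n. \<gamma> n (t * d n)) R \<longlongrightarrow> cone_ray x0 ?P R) \<omega>"
      unfolding cr using \<gamma>lim[of "t * R"] t R by (elim Lim_transform_eventually[rotated]) simp
  qed
  then show ?thesis
    unfolding Psi_ultra_eq[OF A] \<gamma>_def[symmetric] vis cone_ray_seq(3)[OF d P]
    by (rule cone_limit_isometry(2)[OF d ray_seq_in_cone_seqs[OF d r(2) t] cone_ray_seq(1)[OF d P] _ cone_ray_seq(2)[OF d P]])
qed

text \<open>A ray passing within the constant \<open>D\<close> of \<open>a n\<close> can replace
  \<open>a n\<close>, because \<open>D\<close> is negligible at scale \<open>d\<close>; the
  parameter on it may then be taken to be \<open>t * d n\<close> with \<open>t\<close> the limit of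
  the rescaled distances.\<close>

lemma Psi_ultra_surjective:
  assumes cc: "cocompact_space TYPE('a)" and d: "scaling_sequence \<omega> d" and ne: "rays x0 \<noteq> {}"
    and x: "x \<in> asymptotic_cone \<omega> x0 d"
  shows "\<exists>t\<ge>0. \<exists>A\<in>ultra_boundary \<omega> x0. Psi_ultra \<omega> x0 d (cone_point t A) = x"
proof -
  from x obtain a where a: "a \<in> cone_seqs d" "x = cone_class d a" unfolding asymptotic_cone_eq by (elim imageE)
  obtain \<beta> where \<beta>: "\<beta> \<in> rays x0" using ne by auto
  \<comment> \<open>A single ray makes the space unbounded, as almost geodesic completeness
    requires.\<close>
  have "\<exists>y. B < dist x0 y" for B
    using ray_dist_base[OF \<beta>, of "\<bar>B\<bar> + 1"] by (intro exI[of _ "\<beta> (\<bar>B\<bar> + 1)"]) simp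
  from almost_geodesically_complete[OF cc this]
  obtain D where D: "\<forall>x. \<exists>\<alpha>\<in>rays x0. \<exists>s\<ge>0. dist (\<alpha> s) x \<le> D" by (elim exE)
  have "\<forall>n. \<exists>\<alpha>. \<alpha> \<in> rays x0 \<and> (\<exists>s\<ge>0. dist (\<alpha> s) (a n) \<le> D)" using D by (simp add: Bex_def)
  then obtain \<alpha> where "\<forall>n. \<alpha> n \<in> rays x0 \<and> (\<exists>s\<ge>0. dist (\<alpha> n s) (a n) \<le> D)" by (rule choice[THEN exE])
  then have \<alpha>: "\<alpha> n \<in> rays x0" "\<exists>s\<ge>0. dist (\<alpha> n s) (a n) \<le> D" for n by simp_all
  obtain t where t: "((\<lambda>n. dist (a n) x0 / d n) \<longlongrightarrow> t) \<omega>" by (rule that) (rule dist_limit[OF d a(1) x0_seq])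
  have t0: "0 \<le> t"
    by (rule tendsto_lowerbound[OF t always_eventually not_bot])
      (intro allI divide_nonneg_nonneg zero_le_dist less_imp_le[OF scalingD(1)[OF d]])
  have close: "((\<lambda>n. dist (a n) (\<alpha> n (t * d n)) / d n) \<longlongrightarrow> 0) \<omega>"
  proof (rule tendsto_sandwich[OF _ _ tendsto_const])
    \<comment> \<open>One \<open>D\<close> is the distance from \<open>a n\<close> to its ray; the
      other is the difference between the parameter there and the distance of \<open>a n\<close>
      from \<open>x0\<close>.\<close>
    have "((\<lambda>n. 2 * D / d n + \<bar>dist (a n) x0 / d n - t\<bar>) \<longlongrightarrow> 0 + \<bar>t - t\<bar>) \<omega>"
      by (intro tendsto_intros t tendsto_divide_0[OF tendsto_const filterlim_at_top_imp_at_infinity[OF scalingD(2)[OF d]]])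
    then show "((\<lambda>n. 2 * D / d n + \<bar>dist (a n) x0 / d n - t\<bar>) \<longlongrightarrow> 0) \<omega>" by simp
    show "eventually (\<lambda>n. dist (a n) (\<alpha> n (t * d n)) / d n \<le> 2 * D / d n + \<bar>dist (a n) x0 / d n - t\<bar>) \<omega>"
    proof (intro always_eventually allI)
      fix n
      have dn: "0 < d n" by (rule scalingD(1)[OF d])
      obtain s where s: "0 \<le> s" "dist (\<alpha> n s) (a n) \<le> D" using \<alpha>(2)[of n] by (elim exE conjE)
      have "\<bar>s - dist (a n) x0\<bar> \<le> D"
        using s ray_dist_base[OF \<alpha>(1)[of n] s(1)] dist_triangle[of x0 "\<alpha> n s" "a n"] dist_triangle[of x0 "a n" "\<alpha> n s"]
        by (simp add: dist_commute)
      moreover have "dist (\<alpha> n s) (\<alpha> n (t * d n)) = \<bar>s - t * d n\<bar>" using s(1) t0 dn by (intro ray_dist[OF \<alpha>(1)]) auto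
      ultimately have "dist (a n) (\<alpha> n (t * d n)) \<le> 2 * D + \<bar>dist (a n) x0 - t * d n\<bar>"
        using s(2) dist_triangle3[of "a n" "\<alpha> n (t * d n)" "\<alpha> n s"] by linarith
      then have "dist (a n) (\<alpha> n (t * d n)) / d n \<le> (2 * D + \<bar>dist (a n) x0 - t * d n\<bar>) / d n"
        using dn by (intro divide_right_mono) auto
      also have "\<bar>dist (a n) x0 - t * d n\<bar> = d n * \<bar>dist (a n) x0 / d n - t\<bar>"
      proof -
        have "dist (a n) x0 - t * d n = d n * (dist (a n) x0 / d n - t)" using dn by (simp add: field_simps)
        then show ?thesis using dn by (simp add: abs_mult)
      qed
      finally show "dist (a n) (\<alpha> n (t * d n)) / d n \<le> 2 * D / d n + \<bar>dist (a n) x0 / d n - t\<bar>"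
        using dn by (simp add: add_divide_distrib)
    qed
    show "eventually (\<lambda>n. 0 \<le> dist (a n) (\<alpha> n (t * d n)) / d n) \<omega>"
      by (intro always_eventually allI divide_nonneg_nonneg zero_le_dist less_imp_le[OF scalingD(1)[OF d]])
  qed
  define A where "A = zero_dist_rel boundary_seqs (ultra_dist \<omega> (\<lambda>_. ray_angle x0)) `` {\<alpha>}"
  have \<alpha>b: "\<alpha> \<in> boundary_seqs" using \<alpha>(1) by (simp only: boundary_seqs_iff) simp
  have A: "A \<in> ultra_boundary \<omega> x0"
    unfolding A_def ultra_boundary_def ultraproduct_def metric_quotient_def by (rule quotientI[OF \<alpha>b])
  have "(\<lambda>n. ray_angle x0 (\<alpha> n) (\<alpha> n)) = (\<lambda>n. 0)" by (intro ext ray_angle_self \<alpha>(1))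
  then have "ultra_dist \<omega> (\<lambda>_. ray_angle x0) \<alpha> \<alpha> = 0" unfolding ultra_dist_def by (simp add: Lim_eq[OF tendsto_const])
  then have \<alpha>A: "\<alpha> \<in> A" unfolding A_def zero_dist_rel_def using \<alpha>b by simp
  define \<gamma> where "\<gamma> = (SOME \<alpha>. \<alpha> \<in> A)"
  have \<gamma>A: "\<gamma> \<in> A" unfolding \<gamma>_def by (rule ultra_boundary_rep(2)[OF A])
  have \<gamma>: "\<gamma> n \<in> rays x0" for n by (rule ultra_boundary_rep(1)[OF A \<gamma>A])
  have "((\<lambda>n. dist (\<alpha> n (t * d n)) (\<gamma> n (t * d n)) / d n) \<longlongrightarrow> 0) \<omega>"
    by (rule ray_seq_close[OF \<alpha>(1) \<gamma> ultra_boundary_rep(3)[OF A \<alpha>A \<gamma>A] scalingD(1)[OF d] t0])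
  then have "((\<lambda>n. dist (a n) (\<gamma> n (t * d n)) / d n) \<longlongrightarrow> 0) \<omega>" by (rule null_add[OF d close])
  then have "x = cone_class d (\<lambda>n. \<gamma> n (t * d n))"
    unfolding a(2) by (rule cone_class_eqI[OF d a(1) ray_seq_in_cone_seqs[OF d \<gamma> t0]])
  then have "Psi_ultra \<omega> x0 d (cone_point t A) = x" unfolding Psi_ultra_eq[OF A] \<gamma>_def[symmetric] by simp
  then show ?thesis using t0 A by (intro exI[of _ t] conjI bexI[of _ A])
qed

end

end

text \<open>That the equation determines the projection is expressed by quantifying over all maps
  \<open>F\<close> into the limit that satisfy it.\<close>

theorem theorem1:
  fixes x0 :: "'a::metric_space" and \<omega> :: "nat filter"
  assumes "CAT0_space TYPE('a)"
    and "proper_space TYPE('a)"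
    and "cocompact_space TYPE('a)"
    and "nonprincipal_ultrafilter \<omega>"
  shows "isometric_spaces (cone_limit \<omega> x0) (cone_limit_dist \<omega> x0)
           (cone_space (rays x0)) (tits_cone_dist x0)
    \<and> (\<forall>d. scaling_sequence \<omega> d \<longrightarrow>
         (\<forall>t\<ge>0. \<forall>A\<in>ultra_boundary \<omega> x0. \<forall>\<alpha>\<in>A.
            Theta \<omega> x0 d (Psi_ultra \<omega> x0 d (cone_point t A)) =
            Theta \<omega> x0 d (Psi \<omega> x0 d (cone_point t (visual_lim \<omega> x0 \<alpha>))))
       \<and> (\<forall>F. F \<in> asymptotic_cone \<omega> x0 d \<rightarrow> cone_limit \<omega> x0 \<and>
              (\<forall>t\<ge>0. \<forall>A\<in>ultra_boundary \<omega> x0. \<forall>\<alpha>\<in>A.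
                 F (Psi_ultra \<omega> x0 d (cone_point t A)) =
                 Theta \<omega> x0 d (Psi \<omega> x0 d (cone_point t (visual_lim \<omega> x0 \<alpha>)))) \<longrightarrow>
              (\<forall>x\<in>asymptotic_cone \<omega> x0 d. F x = Theta \<omega> x0 d x))
       \<and> isometry_onto (Theta \<omega> x0 d \<circ> Psi \<omega> x0 d)
           (cone_space (rays x0)) (tits_cone_dist x0) (cone_limit \<omega> x0) (cone_limit_dist \<omega> x0)
       \<and> isometry_onto (Theta \<omega> x0 d \<circ> Psi \<omega> x0 d)
           (cone_space (rays x0)) (angle_cone_dist x0) (cone_limit \<omega> x0) (cone_limit_dist \<omega> x0))"
proof -
  interpret proper_cat0 "TYPE('a)" \<omega>
    by unfold_locales (rule assms)+
  have tits: "isometry_onto (Theta \<omega> x0 d \<circ> Psi \<omega> x0 d)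
      (cone_space (rays x0)) (tits_cone_dist x0) (cone_limit \<omega> x0) (cone_limit_dist \<omega> x0)"
    if d: "scaling_sequence \<omega> d" for d
    using cone_limit_isometry(1)[OF d, of x0] unfolding isometry_onto_def by (simp add: tits_cone_dist_eq)
  \<comment> \<open>Any scaling sequence will do; the summand 1 keeps the scale at index 0
    positive.\<close>
  have "scaling_sequence \<omega> (\<lambda>n. real n + 1)"
    unfolding scaling_sequence_def
    using filterlim_tendsto_add_at_top[OF tendsto_const[of 1] real_at_top] by (simp add: add.commute)
  from isometry_onto_sym[OF tits[OF this]]
  have "isometric_spaces (cone_limit \<omega> x0) (cone_limit_dist \<omega> x0) (cone_space (rays x0)) (tits_cone_dist x0)"
    unfolding isometric_spaces_def by blast
  moreover have "F x = Theta \<omega> x0 d x"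
    if d: "scaling_sequence \<omega> d" and F: "F \<in> asymptotic_cone \<omega> x0 d \<rightarrow> cone_limit \<omega> x0"
      and eq: "\<forall>t\<ge>0. \<forall>A\<in>ultra_boundary \<omega> x0. \<forall>\<alpha>\<in>A. F (Psi_ultra \<omega> x0 d (cone_point t A)) =
        Theta \<omega> x0 d (Psi \<omega> x0 d (cone_point t (visual_lim \<omega> x0 \<alpha>)))"
      and x: "x \<in> asymptotic_cone \<omega> x0 d" for d F x
  proof (cases "rays x0 = {}")
    \<comment> \<open>Without rays the ultraproduct of the boundary is empty and the equation says
      nothing; but then the limit is a single point, so the codomain determines the map.\<close>
    case True
    then have "cone_space (rays x0) = {Apex}" by (simp add: cone_space_def)
    moreover have "(Theta \<omega> x0 d \<circ> Psi \<omega> x0 d) ` cone_space (rays x0) = cone_limit \<omega> x0"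
      using cone_limit_isometry(1)[OF d, of x0] by (simp add: isometry_onto_def bij_betw_def)
    ultimately have "\<exists>z. cone_limit \<omega> x0 = {z}" by (metis image_insert image_empty)
    then show ?thesis using Theta_in_cone_limit[OF d x] funcset_mem[OF F x] by auto
  next
    case False
    from Psi_ultra_surjective[OF assms(3) d False x]
    obtain t A where tA: "0 \<le> t" "A \<in> ultra_boundary \<omega> x0" "Psi_ultra \<omega> x0 d (cone_point t A) = x"
      by (elim exE conjE bexE)
    have rep: "(SOME \<alpha>. \<alpha> \<in> A) \<in> A" by (rule ultra_boundary_rep(2)[OF tA(2)])
    show ?thesis using eq tA rep Theta_Psi_ultra[OF d tA(1,2) rep] by auto
  qed
  ultimately show ?thesis
    using tits cone_limit_isometry(1) Theta_Psi_ultra by (intro conjI allI impI ballI) auto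
qed

end
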